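(* Let $n$ be a positive integer, let $\mathcal{M}$ be an $n$-cluster tilting subcategory of an exact category $\mathcal{E}$, and let $$\xi: 0\to X^0\to E^1\to E^2\to\cdots\to E^n\to X^{n+1}\to0$$ be an acyclic sequence in $\mathcal{E}$ with $X^0,X^{n+1}\in\mathcal{M}$. Then there is an admissible $n$-exact sequence $$0\to X^0\to X^1\to X^2\to\cdots\to X^n\to X^{n+1}\to0$$ in $\mathcal{M}$ that is Yoneda equivalent to $\xi$, and it is unique up to homotopy (any two such sequences are homotopy equivalent). If moreover $\mathcal{M}$ is an $n\mathbb{Z}$-cluster tilting subcategory of $\mathcal{E}$, $k$ is a positive integer, and $$\xi: 0\to X^0\to E^1\to\cdots\to E^{kn-1}\to E^{kn}\to X^{kn+1}\to0$$ is a $kn$-fold extension in $\mathcal{E}$ with $X^0,X^{kn+1}\in\mathcal{M}$, then $\xi$ is Yoneda equivalent to a splicing of $k$ admissible $n$-exact sequences in $\mathcal{M}$.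
   Context: All categories are additive; subcategories are full and closed under isomorphisms. Exact categories are in the sense of Quillen (inflations/admissible monomorphisms $\rightarrowtail$, deflations/admissible epimorphisms $\twoheadrightarrow$). A sequence in $\mathcal{E}$ is acyclic if it is obtained by splicing conflations. A $k$-fold extension of $C$ by $A$ is an acyclic sequence $A\rightarrowtail E_{k-1}\to\cdots\to E_0\twoheadrightarrow C$ in $\mathcal{E}$; two $k$-fold extensions $\xi,\xi'$ of $C$ by $A$ are Yoneda equivalent if there is a finite chain of $k$-fold extensions $\xi=\xi_0,\xi_1,\dots,\xi_l=\xi'$ of $C$ by $A$ such that for each $i$ there is a chain map $\xi_i\to\xi_{i+1}$ or $\xi_{i+1}\to\xi_i$ that is $1_A$ and $1_C$ at the ends. $\mathrm{Ext}^k_{\mathcal{E}}(C,A)$ is the group of Yoneda equivalence classes. A left $\mathcal{M}$-approximation of $E\in\mathcal{E}$ is a morphism $E\to M$ with $M\in\mathcal{M}$ such that $\mathrm{Hom}(M,M')\to\mathrm{Hom}(E,M')$ is surjective for all $M'\in\mathcal{M}$; right approximations are defined dually. A subcategory $\mathcal{M}$ of $\mathcal{E}$ is $n$-cluster tilting if: (i) every $E\in\mathcal{E}$ has a left $\mathcal{M}$-approximation that is an inflation $E\rightarrowtail M$; (ii) every $E\in\mathcal{E}$ has a right $\mathcal{M}$-approximation that is a deflation $M'\twoheadrightarrow E$; (iii) $\mathcal{M}=\{E\in\mathcal{E}\mid \mathrm{Ext}^i_{\mathcal{E}}(E,\mathcal{M})=0 \text{ for all } 1\le i\le n-1\}=\{E\in\mathcal{E}\mid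 \mathrm{Ext}^i_{\mathcal{E}}(\mathcal{M},E)=0\text{ for all } 1\le i\le n-1\}$. It is $n\mathbb{Z}$-cluster tilting if moreover: (iv) if $\mathrm{Ext}^k_{\mathcal{E}}(\mathcal{M},\mathcal{M})\ne0$ (i.e. $\mathrm{Ext}^k_{\mathcal{E}}(M,N)\neq 0$ for some $M,N\in\mathcal{M}$) then $k\in n\mathbb{Z}$. An $n$-cluster tilting subcategory $\mathcal{M}$ of $\mathcal{E}$ carries a natural $n$-exact structure whose admissible $n$-exact sequences are the acyclic sequences $0\to Y^0\to Y^1\to\cdots\to Y^n\to Y^{n+1}\to0$ in $\mathcal{E}$ with all terms in $\mathcal{M}$. Splicing $k$ such sequences, where the last term of one equals the first term of the next, yields a $kn$-fold extension. *)

theory Defs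
  imports "HOL-Algebra.Group"
begin

text \<open>
  Categories are given by a set of objects and a set of arrows inside two types; full subcategories
  are sets of objects.  Composition is written in the usual order: \<open>g \<cdot>\<^bsub>E\<^esub> f\<close> is \<open>g\<close> after \<open>f\<close>.
  A value of a field outside its intended domain (e.g. the composite of two non-composable arrows)
  is unconstrained and carries no meaning.
\<close>

record ('o, 'm) cat =
  Obj :: "'o set"
  Arr :: "'m set"
  Dom :: "'m \<Rightarrow> 'o"
  Cod :: "'m \<Rightarrow> 'o"
  Id :: "'o \<Rightarrow> 'm"
  Comp :: "'m \<Rightarrow> 'm \<Rightarrow> 'm"  (infixl "\<cdot>\<index>" 70)

record ('o, 'm) add_cat = "('o, 'm) cat" +
  Add :: "'m \<Rightarrow> 'm \<Rightarrow> 'm"  (infixl "\<boxplus>\<index>" 65)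
  Zero :: "'o \<Rightarrow> 'o \<Rightarrow> 'm"

record ('o, 'm) exact_cat = "('o, 'm) add_cat" +
  Confl :: "('m \<times> 'm) set"

definition Hom :: "('o, 'm, 'z) cat_scheme \<Rightarrow> 'o \<Rightarrow> 'o \<Rightarrow> 'm set" where
  "Hom E A B = {f \<in> Arr E. Dom E f = A \<and> Cod E f = B}"

definition hom_group :: "('o, 'm, 'z) add_cat_scheme \<Rightarrow> 'o \<Rightarrow> 'o \<Rightarrow> 'm monoid" where
  "hom_group E A B = \<lparr>carrier = Hom E A B, mult = Add E, one = Zero E A B\<rparr>"

definition iso_arr :: "('o, 'm, 'z) cat_scheme \<Rightarrow> 'm \<Rightarrow> bool" where
  "iso_arr E f \<longleftrightarrow> f \<in> Arr E \<and>
     (\<exists>g \<in> Hom E (Cod E f) (Dom E f). g \<cdot>\<^bsub>E\<^esub> f = Id E (Dom E f) \<and> f \<cdot>\<^bsub>E\<^esub> g = Id E (Cod E f))"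

definition zero_object :: "('o, 'm, 'z) cat_scheme \<Rightarrow> 'o \<Rightarrow> bool" where
  "zero_object E Z \<longleftrightarrow> Z \<in> Obj E \<and>
     (\<forall>A \<in> Obj E. (\<exists>!f. f \<in> Hom E A Z) \<and> (\<exists>!f. f \<in> Hom E Z A))"

definition biproduct :: "('o, 'm, 'z) add_cat_scheme \<Rightarrow> 'o \<Rightarrow> 'o \<Rightarrow> 'o \<Rightarrow> bool" where
  "biproduct E A B P \<longleftrightarrow> P \<in> Obj E \<and>
     (\<exists>i \<in> Hom E A P. \<exists>j \<in> Hom E B P. \<exists>p \<in> Hom E P A. \<exists>q \<in> Hom E P B.
        p \<cdot>\<^bsub>E\<^esub> i = Id E A \<and> q \<cdot>\<^bsub>E\<^esub> j = Id E B \<and>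
        p \<cdot>\<^bsub>E\<^esub> j = Zero E B A \<and> q \<cdot>\<^bsub>E\<^esub> i = Zero E A B \<and>
        (i \<cdot>\<^bsub>E\<^esub> p) \<boxplus>\<^bsub>E\<^esub> (j \<cdot>\<^bsub>E\<^esub> q) = Id E P)"

locale category =
  fixes E :: "('o, 'm, 'z) cat_scheme"
  assumes Dom_in_Obj: "f \<in> Arr E \<Longrightarrow> Dom E f \<in> Obj E"
    and Cod_in_Obj: "f \<in> Arr E \<Longrightarrow> Cod E f \<in> Obj E"
    and Id_in_Hom: "A \<in> Obj E \<Longrightarrow> Id E A \<in> Hom E A A"
    and Comp_in_Hom: "f \<in> Hom E A B \<Longrightarrow> g \<in> Hom E B C \<Longrightarrow> g \<cdot>\<^bsub>E\<^esub> f \<in> Hom E A C"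
    and Comp_Id: "f \<in> Hom E A B \<Longrightarrow> f \<cdot>\<^bsub>E\<^esub> Id E A = f"
    and Id_Comp: "f \<in> Hom E A B \<Longrightarrow> Id E B \<cdot>\<^bsub>E\<^esub> f = f"
    and Comp_assoc: "f \<in> Hom E A B \<Longrightarrow> g \<in> Hom E B C \<Longrightarrow> h \<in> Hom E C D \<Longrightarrow>
      (h \<cdot>\<^bsub>E\<^esub> g) \<cdot>\<^bsub>E\<^esub> f = h \<cdot>\<^bsub>E\<^esub> (g \<cdot>\<^bsub>E\<^esub> f)"

locale additive_category = category E
  for E :: "('o, 'm, 'z) add_cat_scheme" +
  assumes comm_group_Hom: "A \<in> Obj E \<Longrightarrow> B \<in> Obj E \<Longrightarrow> comm_group (hom_group E A B)"
    and Comp_Add: "f \<in> Hom E A B \<Longrightarrow> f' \<in> Hom E A B \<Longrightarrow> g \<in> Hom E B C \<Longrightarrow>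
      g \<cdot>\<^bsub>E\<^esub> (f \<boxplus>\<^bsub>E\<^esub> f') = (g \<cdot>\<^bsub>E\<^esub> f) \<boxplus>\<^bsub>E\<^esub> (g \<cdot>\<^bsub>E\<^esub> f')"
    and Add_Comp: "f \<in> Hom E A B \<Longrightarrow> g \<in> Hom E B C \<Longrightarrow> g' \<in> Hom E B C \<Longrightarrow>
      (g \<boxplus>\<^bsub>E\<^esub> g') \<cdot>\<^bsub>E\<^esub> f = (g \<cdot>\<^bsub>E\<^esub> f) \<boxplus>\<^bsub>E\<^esub> (g' \<cdot>\<^bsub>E\<^esub> f)"
    and zero_object_ex: "\<exists>Z. zero_object E Z"
    and biproduct_ex: "A \<in> Obj E \<Longrightarrow> B \<in> Obj E \<Longrightarrow> \<exists>P. biproduct E A B P"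

definition is_kernel :: "('o, 'm, 'z) add_cat_scheme \<Rightarrow> 'm \<Rightarrow> 'm \<Rightarrow> bool" where
  "is_kernel E i p \<longleftrightarrow> i \<in> Arr E \<and> p \<in> Arr E \<and> Cod E i = Dom E p \<and>
     p \<cdot>\<^bsub>E\<^esub> i = Zero E (Dom E i) (Cod E p) \<and>
     (\<forall>f \<in> Arr E. Cod E f = Dom E p \<longrightarrow> p \<cdot>\<^bsub>E\<^esub> f = Zero E (Dom E f) (Cod E p) \<longrightarrow>
        (\<exists>!g. g \<in> Hom E (Dom E f) (Dom E i) \<and> i \<cdot>\<^bsub>E\<^esub> g = f))"

definition is_cokernel :: "('o, 'm, 'z) add_cat_scheme \<Rightarrow> 'm \<Rightarrow> 'm \<Rightarrow> bool" where
  "is_cokernel E p i \<longleftrightarrow> i \<in> Arr E \<and> p \<in> Arr E \<and> Cod E i = Dom E p \<and>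
     p \<cdot>\<^bsub>E\<^esub> i = Zero E (Dom E i) (Cod E p) \<and>
     (\<forall>f \<in> Arr E. Dom E f = Cod E i \<longrightarrow> f \<cdot>\<^bsub>E\<^esub> i = Zero E (Dom E i) (Cod E f) \<longrightarrow>
        (\<exists>!g. g \<in> Hom E (Cod E p) (Cod E f) \<and> g \<cdot>\<^bsub>E\<^esub> p = f))"

text \<open>\<open>is_pushout E i f f' i'\<close> is the square with \<open>f' \<cdot> i = i' \<cdot> f\<close>, where \<open>i\<close> and \<open>f\<close> have the same
  domain and \<open>i'\<close> is opposite to \<open>i\<close>.\<close>

definition is_pushout :: "('o, 'm, 'z) cat_scheme \<Rightarrow> 'm \<Rightarrow> 'm \<Rightarrow> 'm \<Rightarrow> 'm \<Rightarrow> bool" where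
  "is_pushout E i f f' i' \<longleftrightarrow> {i, f, f', i'} \<subseteq> Arr E \<and>
     Dom E i = Dom E f \<and> Dom E f' = Cod E i \<and> Dom E i' = Cod E f \<and> Cod E f' = Cod E i' \<and>
     f' \<cdot>\<^bsub>E\<^esub> i = i' \<cdot>\<^bsub>E\<^esub> f \<and>
     (\<forall>T. \<forall>u \<in> Hom E (Cod E i) T. \<forall>v \<in> Hom E (Cod E f) T. u \<cdot>\<^bsub>E\<^esub> i = v \<cdot>\<^bsub>E\<^esub> f \<longrightarrow>
        (\<exists>!w. w \<in> Hom E (Cod E i') T \<and> w \<cdot>\<^bsub>E\<^esub> f' = u \<and> w \<cdot>\<^bsub>E\<^esub> i' = v))"

text \<open>\<open>is_pullback E p f f' p'\<close> is the square with \<open>p \<cdot> f' = f \<cdot> p'\<close>, where \<open>p\<close> and \<open>f\<close> have the same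
  codomain and \<open>p'\<close> is opposite to \<open>p\<close>.\<close>

definition is_pullback :: "('o, 'm, 'z) cat_scheme \<Rightarrow> 'm \<Rightarrow> 'm \<Rightarrow> 'm \<Rightarrow> 'm \<Rightarrow> bool" where
  "is_pullback E p f f' p' \<longleftrightarrow> {p, f, f', p'} \<subseteq> Arr E \<and>
     Cod E p = Cod E f \<and> Cod E f' = Dom E p \<and> Cod E p' = Dom E f \<and> Dom E f' = Dom E p' \<and>
     p \<cdot>\<^bsub>E\<^esub> f' = f \<cdot>\<^bsub>E\<^esub> p' \<and>
     (\<forall>T. \<forall>u \<in> Hom E T (Dom E p). \<forall>v \<in> Hom E T (Dom E f). p \<cdot>\<^bsub>E\<^esub> u = f \<cdot>\<^bsub>E\<^esub> v \<longrightarrow>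
        (\<exists>!w. w \<in> Hom E T (Dom E p') \<and> f' \<cdot>\<^bsub>E\<^esub> w = u \<and> p' \<cdot>\<^bsub>E\<^esub> w = v))"

definition inflation :: "('o, 'm, 'z) exact_cat_scheme \<Rightarrow> 'm \<Rightarrow> bool" where
  "inflation E i \<longleftrightarrow> (\<exists>p. (i, p) \<in> Confl E)"

definition deflation :: "('o, 'm, 'z) exact_cat_scheme \<Rightarrow> 'm \<Rightarrow> bool" where
  "deflation E p \<longleftrightarrow> (\<exists>i. (i, p) \<in> Confl E)"

text \<open>Quillen's axioms in the form without the redundant ``obscure axiom''.\<close>

locale exact_category = additive_category E
  for E :: "('o, 'm, 'z) exact_cat_scheme" +
  assumes Confl_ker_coker: "(i, p) \<in> Confl E \<Longrightarrow> is_kernel E i p \<and> is_cokernel E p i"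
    and Confl_iso_closed:
      "(i, p) \<in> Confl E \<Longrightarrow> i' \<in> Arr E \<Longrightarrow> p' \<in> Arr E \<Longrightarrow> Cod E i' = Dom E p' \<Longrightarrow>
       a \<in> Hom E (Dom E i) (Dom E i') \<Longrightarrow> b \<in> Hom E (Cod E i) (Cod E i') \<Longrightarrow>
       c \<in> Hom E (Cod E p) (Cod E p') \<Longrightarrow> iso_arr E a \<Longrightarrow> iso_arr E b \<Longrightarrow> iso_arr E c \<Longrightarrow>
       b \<cdot>\<^bsub>E\<^esub> i = i' \<cdot>\<^bsub>E\<^esub> a \<Longrightarrow> c \<cdot>\<^bsub>E\<^esub> p = p' \<cdot>\<^bsub>E\<^esub> b \<Longrightarrow> (i', p') \<in> Confl E"
    and inflation_Id: "A \<in> Obj E \<Longrightarrow> inflation E (Id E A)"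
    and deflation_Id: "A \<in> Obj E \<Longrightarrow> deflation E (Id E A)"
    and inflation_Comp: "inflation E i \<Longrightarrow> inflation E j \<Longrightarrow> Cod E i = Dom E j \<Longrightarrow>
      inflation E (j \<cdot>\<^bsub>E\<^esub> i)"
    and deflation_Comp: "deflation E p \<Longrightarrow> deflation E q \<Longrightarrow> Cod E p = Dom E q \<Longrightarrow>
      deflation E (q \<cdot>\<^bsub>E\<^esub> p)"
    and pushout_inflation: "inflation E i \<Longrightarrow> f \<in> Arr E \<Longrightarrow> Dom E f = Dom E i \<Longrightarrow>
      \<exists>f' i'. is_pushout E i f f' i' \<and> inflation E i'"
    and pullback_deflation: "deflation E p \<Longrightarrow> f \<in> Arr E \<Longrightarrow> Cod E f = Cod E p \<Longrightarrow>
      \<exists>f' p'. is_pullback E p f f' p' \<and> deflation E p'"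

text \<open>
  A sequence \<open>Y\<^sup>0 \<rightarrow> Y\<^sup>1 \<rightarrow> \<dots> \<rightarrow> Y\<^sup>k \<rightarrow> Y\<^sup>k\<^sup>+\<^sup>1\<close> is represented by the list
  \<open>[d\<^sup>0, \<dots>, d\<^sup>k]\<close> of its \<open>k + 1\<close> arrows.
\<close>

definition obj_at :: "('o, 'm, 'z) cat_scheme \<Rightarrow> 'm list \<Rightarrow> nat \<Rightarrow> 'o" where
  "obj_at E Y j = (if j < length Y then Dom E (Y ! j) else Cod E (last Y))"

text \<open>Splicing replaces the last arrow of \<open>Y\<close> and the first arrow of \<open>Z\<close> by their composite.\<close>

definition seq_splice :: "('o, 'm, 'z) cat_scheme \<Rightarrow> 'm list \<Rightarrow> 'm list \<Rightarrow> 'm list" where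
  "seq_splice E Y Z = butlast Y @ (hd Z \<cdot>\<^bsub>E\<^esub> last Y) # tl Z"

inductive is_splicing :: "('o, 'm, 'z) cat_scheme \<Rightarrow> 'm list set \<Rightarrow> nat \<Rightarrow> 'm list \<Rightarrow> bool"
  for E :: "('o, 'm, 'z) cat_scheme" and S :: "'m list set" where
  single: "Y \<in> S \<Longrightarrow> is_splicing E S 1 Y"
| splice: "is_splicing E S k Y \<Longrightarrow> Z \<in> S \<Longrightarrow> Cod E (last Y) = Dom E (hd Z) \<Longrightarrow>
    is_splicing E S (Suc k) (seq_splice E Y Z)"

text \<open>The number \<open>k\<close> of conflations is also the number of middle terms.\<close>

definition acyclic_seq :: "('o, 'm, 'z) exact_cat_scheme \<Rightarrow> nat \<Rightarrow> 'm list \<Rightarrow> bool" where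
  "acyclic_seq E k Y \<longleftrightarrow> is_splicing E {[i, p] | i p. (i, p) \<in> Confl E} k Y"

lemma acyclic_seq_length: "acyclic_seq E k Y \<Longrightarrow> length Y = Suc k"
  unfolding acyclic_seq_def
  by (induction rule: is_splicing.induct) (auto simp: seq_splice_def)

definition extensions :: "('o, 'm, 'z) exact_cat_scheme \<Rightarrow> nat \<Rightarrow> 'o \<Rightarrow> 'o \<Rightarrow> 'm list set" where
  "extensions E k C A = {Y. acyclic_seq E k Y \<and> Dom E (hd Y) = A \<and> Cod E (last Y) = C}"

definition chain_map ::
    "('o, 'm, 'z) cat_scheme \<Rightarrow> 'm list \<Rightarrow> 'm list \<Rightarrow> (nat \<Rightarrow> 'm) \<Rightarrow> bool" where
  "chain_map E Y Z f \<longleftrightarrow> length Y = length Z \<and>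
     (\<forall>j \<le> length Y. f j \<in> Hom E (obj_at E Y j) (obj_at E Z j)) \<and>
     (\<forall>j < length Y. f (Suc j) \<cdot>\<^bsub>E\<^esub> (Y ! j) = (Z ! j) \<cdot>\<^bsub>E\<^esub> f j)"

definition yoneda_step ::
    "('o, 'm, 'z) exact_cat_scheme \<Rightarrow> nat \<Rightarrow> 'o \<Rightarrow> 'o \<Rightarrow> ('m list \<times> 'm list) set" where
  "yoneda_step E k C A =
     {(Y, Z). Y \<in> extensions E k C A \<and> Z \<in> extensions E k C A \<and>
        (\<exists>f. chain_map E Y Z f \<and> f 0 = Id E A \<and> f (Suc k) = Id E C)}"

definition yoneda_rel ::
    "('o, 'm, 'z) exact_cat_scheme \<Rightarrow> nat \<Rightarrow> 'o \<Rightarrow> 'o \<Rightarrow> ('m list \<times> 'm list) set" where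
  "yoneda_rel E k C A =
     {(Y, Z). Y \<in> extensions E k C A \<and> Z \<in> extensions E k C A \<and>
        (Y, Z) \<in> (yoneda_step E k C A \<union> (yoneda_step E k C A)\<inverse>)\<^sup>*}"

lemma equiv_yoneda_rel: "equiv (extensions E k C A) (yoneda_rel E k C A)"
proof (rule equivI)
  show "yoneda_rel E k C A \<subseteq> extensions E k C A \<times> extensions E k C A"
    by (auto simp: yoneda_rel_def)
  show "refl_on (extensions E k C A) (yoneda_rel E k C A)"
    by (auto simp: refl_on_def yoneda_rel_def)
  have "sym ((yoneda_step E k C A \<union> (yoneda_step E k C A)\<inverse>)\<^sup>*)"
    by (intro sym_rtrancl sym_Un_converse)
  then show "sym (yoneda_rel E k C A)"
    by (auto simp: yoneda_rel_def sym_def)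
  show "trans (yoneda_rel E k C A)"
    unfolding yoneda_rel_def trans_def using rtrancl_trans by fastforce
qed

text \<open>
  The underlying set of the group \<open>Ext\<^sup>k(C, A)\<close> for \<open>k \<ge> 1\<close>.  Only the vanishing of this group is
  used, i.e. that its underlying set has exactly one element, so the Baer sum is not needed.
\<close>

definition Ext :: "('o, 'm, 'z) exact_cat_scheme \<Rightarrow> nat \<Rightarrow> 'o \<Rightarrow> 'o \<Rightarrow> 'm list set set" where
  "Ext E k C A = extensions E k C A // yoneda_rel E k C A"

definition Ext_vanishes :: "('o, 'm, 'z) exact_cat_scheme \<Rightarrow> nat \<Rightarrow> 'o \<Rightarrow> 'o \<Rightarrow> bool" where
  "Ext_vanishes E k C A \<longleftrightarrow> is_singleton (Ext E k C A)"

text \<open>The full subcategory on \<open>M\<close> is additive and closed under isomorphisms.\<close>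

definition additive_subcategory :: "('o, 'm, 'z) add_cat_scheme \<Rightarrow> 'o set \<Rightarrow> bool" where
  "additive_subcategory E M \<longleftrightarrow> M \<subseteq> Obj E \<and>
     (\<forall>f. iso_arr E f \<and> Dom E f \<in> M \<longrightarrow> Cod E f \<in> M) \<and>
     (\<forall>Z. zero_object E Z \<longrightarrow> Z \<in> M) \<and>
     (\<forall>A \<in> M. \<forall>B \<in> M. \<forall>P. biproduct E A B P \<longrightarrow> P \<in> M)"

definition left_approximation :: "('o, 'm, 'z) cat_scheme \<Rightarrow> 'o set \<Rightarrow> 'm \<Rightarrow> bool" where
  "left_approximation E M f \<longleftrightarrow> f \<in> Arr E \<and> Cod E f \<in> M \<and>
     (\<forall>N \<in> M. \<forall>g \<in> Hom E (Dom E f) N. \<exists>h \<in> Hom E (Cod E f) N. h \<cdot>\<^bsub>E\<^esub> f = g)"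

definition right_approximation :: "('o, 'm, 'z) cat_scheme \<Rightarrow> 'o set \<Rightarrow> 'm \<Rightarrow> bool" where
  "right_approximation E M f \<longleftrightarrow> f \<in> Arr E \<and> Dom E f \<in> M \<and>
     (\<forall>N \<in> M. \<forall>g \<in> Hom E N (Cod E f). \<exists>h \<in> Hom E N (Dom E f). f \<cdot>\<^bsub>E\<^esub> h = g)"

definition cluster_tilting :: "('o, 'm, 'z) exact_cat_scheme \<Rightarrow> nat \<Rightarrow> 'o set \<Rightarrow> bool" where
  "cluster_tilting E n M \<longleftrightarrow> additive_subcategory E M \<and>
     (\<forall>A \<in> Obj E. \<exists>f. Dom E f = A \<and> left_approximation E M f \<and> inflation E f) \<and>
     (\<forall>A \<in> Obj E. \<exists>f. Cod E f = A \<and> right_approximation E M f \<and> deflation E f) \<and>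
     M = {A \<in> Obj E. \<forall>N \<in> M. \<forall>i. 1 \<le> i \<and> i \<le> n - 1 \<longrightarrow> Ext_vanishes E i A N} \<and>
     M = {A \<in> Obj E. \<forall>N \<in> M. \<forall>i. 1 \<le> i \<and> i \<le> n - 1 \<longrightarrow> Ext_vanishes E i N A}"

definition nZ_cluster_tilting :: "('o, 'm, 'z) exact_cat_scheme \<Rightarrow> nat \<Rightarrow> 'o set \<Rightarrow> bool" where
  "nZ_cluster_tilting E n M \<longleftrightarrow> cluster_tilting E n M \<and>
     (\<forall>k \<ge> 1. (\<exists>A \<in> M. \<exists>B \<in> M. \<not> Ext_vanishes E k A B) \<longrightarrow> n dvd k)"

definition admissible_n_exact ::
    "('o, 'm, 'z) exact_cat_scheme \<Rightarrow> nat \<Rightarrow> 'o set \<Rightarrow> 'm list \<Rightarrow> bool" where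
  "admissible_n_exact E n M Y \<longleftrightarrow> acyclic_seq E n Y \<and> (\<forall>j \<le> Suc n. obj_at E Y j \<in> M)"

text \<open>
  \<open>h j\<close> is the component \<open>Y\<^sup>j \<rightarrow> Z\<^sup>j\<^sup>-\<^sup>1\<close> for \<open>1 \<le> j \<le> k + 1\<close>, where \<open>k + 1 = length Y\<close>; it satisfies
  \<open>f\<^sup>j = g\<^sup>j + d\<^sub>Z\<^sup>j\<^sup>-\<^sup>1 h\<^sup>j + h\<^sup>j\<^sup>+\<^sup>1 d\<^sub>Y\<^sup>j\<close>.  The terms that involve the zero objects at the two ends
  of the sequences are left out.
\<close>

definition chain_homotopic ::
    "('o, 'm, 'z) add_cat_scheme \<Rightarrow> 'm list \<Rightarrow> 'm list \<Rightarrow> (nat \<Rightarrow> 'm) \<Rightarrow> (nat \<Rightarrow> 'm) \<Rightarrow> bool" where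
  "chain_homotopic E Y Z f g \<longleftrightarrow>
     (\<exists>h. (\<forall>j. 1 \<le> j \<and> j \<le> length Y \<longrightarrow> h j \<in> Hom E (obj_at E Y j) (obj_at E Z (j - 1))) \<and>
        f 0 = g 0 \<boxplus>\<^bsub>E\<^esub> (h 1 \<cdot>\<^bsub>E\<^esub> (Y ! 0)) \<and>
        (\<forall>j. 1 \<le> j \<and> j < length Y \<longrightarrow>
           f j = g j \<boxplus>\<^bsub>E\<^esub> ((Z ! (j - 1)) \<cdot>\<^bsub>E\<^esub> h j \<boxplus>\<^bsub>E\<^esub> h (Suc j) \<cdot>\<^bsub>E\<^esub> (Y ! j))) \<and>
        f (length Y) = g (length Y) \<boxplus>\<^bsub>E\<^esub> (last Z \<cdot>\<^bsub>E\<^esub> h (length Y)))"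

definition homotopy_equivalent ::
    "('o, 'm, 'z) add_cat_scheme \<Rightarrow> 'm list \<Rightarrow> 'm list \<Rightarrow> bool" where
  "homotopy_equivalent E Y Z \<longleftrightarrow>
     (\<exists>f g. chain_map E Y Z f \<and> chain_map E Z Y g \<and>
        chain_homotopic E Y Y (\<lambda>j. g j \<cdot>\<^bsub>E\<^esub> f j) (\<lambda>j. Id E (obj_at E Y j)) \<and>
        chain_homotopic E Z Z (\<lambda>j. f j \<cdot>\<^bsub>E\<^esub> g j) (\<lambda>j. Id E (obj_at E Z j)))"

end

theory Submission
  imports Defs
begin

text \<open>
  Both existence statements are proved by approximating a given extension
  \<open>X\<^sup>0 \<rightarrow> E\<^sup>1 \<rightarrow> \<dots> \<rightarrow> E\<^sup>m \<rightarrow> X\<^sup>m\<^sup>+\<^sup>1\<close> by terms of \<open>M\<close>.  For \<open>m = n\<close>, inflations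
  \<open>E\<^sup>j \<rightarrow> X\<^sup>j\<close> with \<open>X\<^sup>j \<in> M\<close> and pushouts along the induced maps of kernels, taken from left to
  right, bring all middle terms except the last one into \<open>M\<close> (\<open>resolve_from_left\<close>).  Then right
  \<open>M\<close>-approximations and pullbacks are taken from right to left (\<open>resolve_from_right\<close>).  The kernel
  \<open>R\<close> of a right \<open>M\<close>-approximation has \<open>Ext\<^sup>1(M, R) = 0\<close>, and each further step raises the range of
  degrees in which \<open>Ext(M, -)\<close> vanishes by one.  When the process arrives at the first middle term,
  that term \<open>F\<close> has \<open>Ext\<^sup>i(M, F) = 0\<close> for \<open>0 < i < n\<close>, so it lies in \<open>M\<close> already.

  Uniqueness: let \<open>q : X\<^sup>n \<rightarrow> X\<^sup>n\<^sup>+\<^sup>1\<close> be the last map of an \<open>n\<close>-exact sequence \<open>X\<close>, and let \<open>X'\<close> be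
  another one that is Yoneda equivalent to it.  The pullback of \<open>X\<close> along \<open>q\<close> is trivial, hence so
  is the pullback of \<open>X'\<close>.  Because \<open>Ext\<^sup>i(X\<^sup>n, M) = 0\<close> for \<open>0 < i < n\<close>, the connecting maps
  \<open>Hom(X\<^sup>n, X\<^sup>n\<^sup>+\<^sup>1) \<rightarrow> Ext\<^sup>1 \<rightarrow> \<dots> \<rightarrow> Ext\<^sup>n(X\<^sup>n, X\<^sup>0)\<close> detect whether \<open>q\<close> lifts to the
  last but one term of \<open>X'\<close> (\<open>lift_of_null\<close>), so it does.  The lift extends to a chain map
  \<open>X \<rightarrow> X'\<close>, and likewise there is one back; the composites are homotopic to the identities since
  \<open>Hom(N, -)\<close> is exact on \<open>X\<close> and on \<open>X'\<close> for \<open>N \<in> M\<close>.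

  Splicings: cut a \<open>(k + 1)n\<close>-fold extension into a \<open>kn\<close>-fold extension \<open>S\<close> of \<open>X\<^sup>k\<^sup>n\<^sup>+\<^sup>n\<^sup>+\<^sup>1\<close> by \<open>K\<close>
  and an \<open>n\<close>-fold extension \<open>T\<close> of \<open>K\<close> by \<open>X\<^sup>0\<close>.  Let \<open>R\<close> be the kernel of a right \<open>M\<close>-approximation
  \<open>X \<rightarrow> K\<close>, where \<open>n \<ge> 2\<close> may be assumed, since \<open>M\<close> contains all objects for \<open>n = 1\<close>.
  Then \<open>R\<close> has a resolution of length \<open>n - 2\<close> by terms of \<open>M\<close>, so the \<open>n\<int>\<close> condition gives
  \<open>Ext\<^sup>k\<^sup>n\<^sup>+\<^sup>1(-, R) = 0\<close> on \<open>M\<close>.  Hence the class of \<open>S\<close> comes from an extension by \<open>X\<close>, and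
  after pulling \<open>T\<close> back to \<open>X\<close> the two parts have both ends in \<open>M\<close>; the first is treated by
  induction and the second by the case \<open>m = n\<close>.

  All this rests on the exactness of \<open>Ext(N, -)\<close> along conflations.  It is formulated through one
  relation, \<open>in_image f S c\<close>: the pullback along \<open>c\<close> of the extension \<open>S\<close> is, up to Yoneda
  equivalence, a pushout along \<open>f\<close>.  The relation is defined by recursion on the conflations of
  \<open>S\<close>, and exactness becomes the lemma \<open>in_image_kernel\<close>.
\<close>

section \<open>Arithmetic of maps and conflations\<close>

locale exact_cat = exact_category E
  for E :: "('o, 'm, 'z) exact_cat_scheme" (structure)
begin

lemma Hom_iff: "f \<in> Hom E A B \<longleftrightarrow> f \<in> Arr E \<and> Dom E f = A \<and> Cod E f = B"
  by (auto simp: Hom_def)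

lemma Hom_Obj: "f \<in> Hom E A B \<Longrightarrow> A \<in> Obj E" "f \<in> Hom E A B \<Longrightarrow> B \<in> Obj E"
  using Dom_in_Obj Cod_in_Obj by (auto simp: Hom_iff)

lemma Dom_Obj [simp]: "f \<in> Arr E \<Longrightarrow> Dom E f \<in> Obj E"
  and Cod_Obj [simp]: "f \<in> Arr E \<Longrightarrow> Cod E f \<in> Obj E"
  using Dom_in_Obj Cod_in_Obj by auto

lemma Id_simps [simp]:
  assumes "A \<in> Obj E"
  shows "Id E A \<in> Arr E" "Dom E (Id E A) = A" "Cod E (Id E A) = A"
  using Id_in_Hom[OF assms] by (auto simp: Hom_iff)

lemma comp_simps [simp]:
  assumes "f \<in> Arr E" "g \<in> Arr E" "Cod E f = Dom E g"
  shows "g \<cdot> f \<in> Arr E" "Dom E (g \<cdot> f) = Dom E f" "Cod E (g \<cdot> f) = Cod E g"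
  using Comp_in_Hom[of f "Dom E f" "Cod E f" g "Cod E g"] assms by (auto simp: Hom_iff)

lemma comp_Id_simps [simp]:
  assumes "f \<in> Arr E"
  shows "Dom E f = A \<Longrightarrow> f \<cdot> Id E A = f" "Cod E f = B \<Longrightarrow> Id E B \<cdot> f = f"
  using assms Comp_Id[of f "Dom E f" "Cod E f"] Id_Comp[of f "Dom E f" "Cod E f"]
  by (auto simp: Hom_iff)

lemma comp_assoc [simp]:
  assumes "f \<in> Arr E" "g \<in> Arr E" "h \<in> Arr E" "Cod E f = Dom E g" "Cod E g = Dom E h"
  shows "(h \<cdot> g) \<cdot> f = h \<cdot> (g \<cdot> f)"
  using Comp_assoc[of f "Dom E f" "Cod E f" g "Cod E g" h "Cod E h"] assms
  by (auto simp: Hom_iff)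

text \<open>
  Composites are normalised by bracketing to the right; this form lets an equation between composites
  act on the beginning of a longer composite.
\<close>

lemma comp_reduce:
  assumes "p \<cdot> b = e" "p \<in> Arr E" "b \<in> Arr E" "x \<in> Arr E" "Cod E x = Dom E b"
    "Cod E b = Dom E p"
  shows "p \<cdot> (b \<cdot> x) = e \<cdot> x"
  using assms comp_assoc by metis

lemma Zero_simps [simp]:
  assumes "A \<in> Obj E" "B \<in> Obj E"
  shows "Zero E A B \<in> Arr E" "Dom E (Zero E A B) = A" "Cod E (Zero E A B) = B"
proof -
  interpret G: comm_group "hom_group E A B" using comm_group_Hom assms by blast
  have "Zero E A B \<in> Hom E A B" using G.one_closed by (simp add: hom_group_def)
  then show "Zero E A B \<in> Arr E" "Dom E (Zero E A B) = A" "Cod E (Zero E A B) = B"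
    by (auto simp: Hom_iff)
qed

lemma add_Hom:
  assumes "f \<in> Hom E A B" "g \<in> Hom E A B"
  shows "f \<boxplus> g \<in> Hom E A B"
proof -
  interpret G: comm_group "hom_group E A B" using comm_group_Hom assms Hom_Obj by blast
  show ?thesis using G.m_closed assms by (simp add: hom_group_def)
qed

lemma add_simps [simp]:
  assumes "f \<in> Arr E" "g \<in> Arr E" "Dom E f = Dom E g" "Cod E f = Cod E g"
  shows "f \<boxplus> g \<in> Arr E" "Dom E (f \<boxplus> g) = Dom E g" "Cod E (f \<boxplus> g) = Cod E g"
  using add_Hom[of f "Dom E g" "Cod E g" g] assms by (auto simp: Hom_iff)

lemma add_group:
  assumes "f \<in> Hom E A B" "g \<in> Hom E A B"
  shows add_assoc: "h \<in> Hom E A B \<Longrightarrow> (f \<boxplus> g) \<boxplus> h = f \<boxplus> (g \<boxplus> h)"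
    and add_comm: "f \<boxplus> g = g \<boxplus> f"
    and add_left_cancel: "h \<in> Hom E A B \<Longrightarrow> f \<boxplus> g = f \<boxplus> h \<Longrightarrow> g = h"
    and add_zero: "Zero E A B \<boxplus> f = f" "f \<boxplus> Zero E A B = f"
    and add_diff: "\<exists>u \<in> Hom E A B. f = g \<boxplus> u"
proof -
  interpret G: comm_group "hom_group E A B" using comm_group_Hom assms Hom_Obj by blast
  have *: "carrier (hom_group E A B) = Hom E A B" "mult (hom_group E A B) = Add E"
    "one (hom_group E A B) = Zero E A B" by (auto simp: hom_group_def)
  note c = assms[folded *(1)]
  show "h \<in> Hom E A B \<Longrightarrow> (f \<boxplus> g) \<boxplus> h = f \<boxplus> (g \<boxplus> h)" using G.m_assoc[OF c] by (simp add: *)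
  show "f \<boxplus> g = g \<boxplus> f" using G.m_comm[OF c(1,2)] by (simp add: *)
  show "h \<in> Hom E A B \<Longrightarrow> f \<boxplus> g = f \<boxplus> h \<Longrightarrow> g = h"
    using G.Units_l_cancel[of f g h] c by (simp add: *)
  show "Zero E A B \<boxplus> f = f" using G.l_one[OF c(1)] by (simp add: *)
  show "f \<boxplus> Zero E A B = f" using G.r_one[OF c(1)] by (simp add: *)
  have "f = g \<otimes>\<^bsub>hom_group E A B\<^esub> (inv\<^bsub>hom_group E A B\<^esub> g \<otimes>\<^bsub>hom_group E A B\<^esub> f)"
    using c G.r_inv[OF c(2)] by (simp flip: G.m_assoc)
  moreover have "inv\<^bsub>hom_group E A B\<^esub> g \<otimes>\<^bsub>hom_group E A B\<^esub> f \<in> Hom E A B"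
    using G.m_closed[OF G.inv_closed[OF c(2)] c(1)] unfolding * .
  ultimately show "\<exists>u \<in> Hom E A B. f = g \<boxplus> u" unfolding * by blast
qed

lemma add_zero_simps [simp]:
  assumes "f \<in> Arr E"
  shows "Dom E f = A \<Longrightarrow> Cod E f = B \<Longrightarrow> Zero E A B \<boxplus> f = f"
    "Dom E f = A \<Longrightarrow> Cod E f = B \<Longrightarrow> f \<boxplus> Zero E A B = f"
  using add_zero[of f "Dom E f" "Cod E f" f] assms by (auto simp: Hom_iff)

lemma comp_add [simp]:
  assumes "f \<in> Arr E" "f' \<in> Arr E" "g \<in> Arr E"
    "Dom E f = Dom E f'" "Cod E f = Dom E g" "Cod E f' = Dom E g"
  shows "g \<cdot> (f \<boxplus> f') = g \<cdot> f \<boxplus> g \<cdot> f'"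
  using Comp_Add[of f "Dom E f" "Dom E g" f' g] assms by (auto simp: Hom_iff)

lemma add_comp [simp]:
  assumes "f \<in> Arr E" "g' \<in> Arr E" "g \<in> Arr E"
    "Cod E f = Dom E g" "Cod E f = Dom E g'" "Cod E g = Cod E g'"
  shows "(g \<boxplus> g') \<cdot> f = g \<cdot> f \<boxplus> g' \<cdot> f"
  using Add_Comp[of f "Dom E f" "Dom E g" g "Cod E g" g'] assms by (auto simp: Hom_iff)

lemma comp_zero [simp]:
  assumes "g \<in> Arr E" "A \<in> Obj E" "B = Dom E g"
  shows "g \<cdot> Zero E A B = Zero E A (Cod E g)"
proof -
  have "g \<cdot> Zero E A B \<boxplus> g \<cdot> Zero E A B = g \<cdot> Zero E A B \<boxplus> Zero E A (Cod E g)"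
    using assms by (simp flip: comp_add)
  then show ?thesis
    using add_left_cancel[of "g \<cdot> Zero E A B" A "Cod E g" "g \<cdot> Zero E A B" "Zero E A (Cod E g)"] assms
    by (simp add: Hom_iff)
qed

lemma zero_comp [simp]:
  assumes "f \<in> Arr E" "B \<in> Obj E" "A = Cod E f"
  shows "Zero E A B \<cdot> f = Zero E (Dom E f) B"
proof -
  have "Zero E A B \<cdot> f \<boxplus> Zero E A B \<cdot> f = Zero E A B \<cdot> f \<boxplus> Zero E (Dom E f) B"
    using assms by (simp flip: add_comp)
  then show ?thesis
    using add_left_cancel[of "Zero E A B \<cdot> f" "Dom E f" B "Zero E A B \<cdot> f" "Zero E (Dom E f) B"] assms
    by (simp add: Hom_iff)
qed

lemma add_diff_arr:
  assumes "f \<in> Hom E A B" "g \<in> Hom E A B"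
  obtains u where "u \<in> Hom E A B" "f = g \<boxplus> u"
  using add_diff[OF assms] by blast

lemma add_cancel_zero:
  assumes "f \<in> Hom E A B" "u \<in> Hom E A B" "f = f \<boxplus> u"
  shows "u = Zero E A B"
proof -
  have A: "A \<in> Obj E" "B \<in> Obj E" using Hom_Obj assms by auto
  have "f \<boxplus> u = f \<boxplus> Zero E A B" using assms A by (simp add: Hom_iff)
  then show ?thesis using add_left_cancel[OF assms(1,2), of "Zero E A B"] assms(3) A by (simp add: Hom_iff)
qed

text \<open>
  Conflations with their three objects made explicit, which fixes a normal form for domains and
  codomains.
\<close>

definition ses :: "'o \<Rightarrow> 'm \<Rightarrow> 'o \<Rightarrow> 'm \<Rightarrow> 'o \<Rightarrow> bool" where
  "ses A i B p C \<longleftrightarrow> (i, p) \<in> Confl E \<and> i \<in> Hom E A B \<and> p \<in> Hom E B C"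

lemma sesD:
  assumes "ses A i B p C"
  shows "i \<in> Arr E" "p \<in> Arr E" "Dom E i = A" "Cod E i = B" "Dom E p = B" "Cod E p = C"
    "A \<in> Obj E" "B \<in> Obj E" "C \<in> Obj E" "p \<cdot> i = Zero E A C"
proof -
  show *: "i \<in> Arr E" "p \<in> Arr E" "Dom E i = A" "Cod E i = B" "Dom E p = B" "Cod E p = C"
    using assms by (auto simp: ses_def Hom_iff)
  then show "A \<in> Obj E" "B \<in> Obj E" "C \<in> Obj E" by auto
  show "p \<cdot> i = Zero E A C"
    using assms * Confl_ker_coker[of i p] by (auto simp: ses_def is_kernel_def)
qed

lemma Confl_ses: "(i, p) \<in> Confl E \<Longrightarrow> ses (Dom E i) i (Dom E p) p (Cod E p)"
  using Confl_ker_coker[of i p] by (auto simp: ses_def is_kernel_def Hom_iff)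

lemma ses_Confl: "ses A i B p C \<Longrightarrow> (i, p) \<in> Confl E"
  by (simp add: ses_def)

lemma ConflD:
  assumes "(i, p) \<in> Confl E"
  shows "i \<in> Arr E" "p \<in> Arr E" "Cod E i = Dom E p" "p \<cdot> i = Zero E (Dom E i) (Cod E p)"
  using sesD[OF Confl_ses[OF assms]] by auto

lemma kernel_lift:
  assumes "ses A i B p C" "f \<in> Hom E T B" "p \<cdot> f = Zero E T C"
  obtains g where "g \<in> Hom E T A" "i \<cdot> g = f"
proof -
  have "is_kernel E i p" using assms(1) Confl_ker_coker by (auto simp: ses_def)
  then show ?thesis using that sesD[OF assms(1)] assms(2,3) unfolding is_kernel_def
    by (auto simp: Hom_iff)
qed

lemma inflation_mono:
  assumes "ses A i B p C" "f \<in> Hom E T A" "g \<in> Hom E T A" "i \<cdot> f = i \<cdot> g"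
  shows "f = g"
proof -
  note s = sesD[OF assms(1)]
  have "is_kernel E i p" using assms(1) Confl_ker_coker by (auto simp: ses_def)
  then have K: "\<forall>f \<in> Arr E. Cod E f = B \<longrightarrow> p \<cdot> f = Zero E (Dom E f) C \<longrightarrow>
      (\<exists>!g. g \<in> Hom E (Dom E f) A \<and> i \<cdot> g = f)"
    using s unfolding is_kernel_def by simp
  have "p \<cdot> (i \<cdot> f) = Zero E T C" 
    using assms s by (simp add: comp_reduce[OF s(10)] Hom_iff)
  then have "\<exists>!h. h \<in> Hom E T A \<and> i \<cdot> h = i \<cdot> f"
    using K[rule_format, of "i \<cdot> f"] s assms(2) by (simp add: Hom_iff)
  then show ?thesis using assms by metis
qed

lemma cokernel_desc:
  assumes "ses A i B p C" "f \<in> Hom E B T" "f \<cdot> i = Zero E A T"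
  obtains g where "g \<in> Hom E C T" "g \<cdot> p = f"
proof -
  have "is_cokernel E p i" using assms(1) Confl_ker_coker by (auto simp: ses_def)
  then show ?thesis using that sesD[OF assms(1)] assms(2,3) unfolding is_cokernel_def
    by (auto simp: Hom_iff)
qed

lemma deflation_epi:
  assumes "ses A i B p C" "f \<in> Hom E C T" "g \<in> Hom E C T" "f \<cdot> p = g \<cdot> p"
  shows "f = g"
proof -
  note s = sesD[OF assms(1)]
  have "is_cokernel E p i" using assms(1) Confl_ker_coker by (auto simp: ses_def)
  then have K: "\<forall>f \<in> Arr E. Dom E f = B \<longrightarrow> f \<cdot> i = Zero E A (Cod E f) \<longrightarrow>
      (\<exists>!g. g \<in> Hom E C (Cod E f) \<and> g \<cdot> p = f)"
    using s unfolding is_cokernel_def by simp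
  have "\<exists>!h. h \<in> Hom E C T \<and> h \<cdot> p = f \<cdot> p"
    using K[rule_format, of "f \<cdot> p"] s assms(2) by (auto simp: Hom_iff)
  then show ?thesis using assms by metis
qed

lemma iso_Id: "A \<in> Obj E \<Longrightarrow> iso_arr E (Id E A)"
  unfolding iso_arr_def by (auto intro!: bexI[of _ "Id E A"] simp: Hom_iff)

text \<open>The two kernels of \<open>p\<close> are isomorphic, and conflations are closed under isomorphisms.\<close>

lemma ses_other_kernel:
  assumes "ses A j B p C" "i \<in> Hom E A' B" "p \<cdot> i = Zero E A' C"
    and lift: "\<And>T f. f \<in> Hom E T B \<Longrightarrow> p \<cdot> f = Zero E T C \<Longrightarrow> \<exists>g \<in> Hom E T A'. i \<cdot> g = f"
    and mono: "\<And>T f g. f \<in> Hom E T A' \<Longrightarrow> g \<in> Hom E T A' \<Longrightarrow> i \<cdot> f = i \<cdot> g \<Longrightarrow> f = g"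
  shows "ses A' i B p C"
proof -
  note s = sesD[OF assms(1)]
  have i: "i \<in> Arr E" "Dom E i = A'" "Cod E i = B" "A' \<in> Obj E" using assms(2) by (auto simp: Hom_iff)
  obtain g where g: "g \<in> Hom E A' A" "j \<cdot> g = i" using kernel_lift[OF assms(1-3)] .
  obtain h where h: "h \<in> Hom E A A'" "i \<cdot> h = j" using lift[of j A] s by (auto simp: Hom_iff)
  note [simp] = s i g[unfolded Hom_iff] h[unfolded Hom_iff]
  have "j \<cdot> (g \<cdot> h) = j \<cdot> Id E A" by (simp add: comp_reduce[OF g(2)])
  then have gh: "g \<cdot> h = Id E A" using inflation_mono[OF assms(1), of "g \<cdot> h" A "Id E A"]
    by (simp add: Hom_iff)
  have "i \<cdot> (h \<cdot> g) = i \<cdot> Id E A'" by (simp add: comp_reduce[OF h(2)])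
  then have hg: "h \<cdot> g = Id E A'" using mono[of "h \<cdot> g" A' "Id E A'"] by (simp add: Hom_iff)
  have "iso_arr E h" unfolding iso_arr_def using gh hg by (auto simp: Hom_iff)
  then have "(i, p) \<in> Confl E"
    using Confl_iso_closed[of j p i p h "Id E B" "Id E C"] assms(1) iso_Id[of B] iso_Id[of C]
    by (auto simp: ses_def Hom_iff)
  then show ?thesis by (auto simp: ses_def Hom_iff)
qed

lemma ses_other_cokernel:
  assumes "ses A i B q C" "p \<in> Hom E B C'" "p \<cdot> i = Zero E A C'"
    and desc: "\<And>T f. f \<in> Hom E B T \<Longrightarrow> f \<cdot> i = Zero E A T \<Longrightarrow> \<exists>g \<in> Hom E C' T. g \<cdot> p = f"
    and epi: "\<And>T f g. f \<in> Hom E C' T \<Longrightarrow> g \<in> Hom E C' T \<Longrightarrow> f \<cdot> p = g \<cdot> p \<Longrightarrow> f = g"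
  shows "ses A i B p C'"
proof -
  note s = sesD[OF assms(1)]
  have p: "p \<in> Arr E" "Dom E p = B" "Cod E p = C'" "C' \<in> Obj E" using assms(2) by (auto simp: Hom_iff)
  obtain g where g: "g \<in> Hom E C C'" "g \<cdot> q = p" using cokernel_desc[OF assms(1-3)] .
  obtain h where h: "h \<in> Hom E C' C" "h \<cdot> p = q" using desc[of q C] s by (auto simp: Hom_iff)
  note [simp] = s p g[unfolded Hom_iff] h[unfolded Hom_iff]
  have "(h \<cdot> g) \<cdot> q = Id E C \<cdot> q" by simp
  then have gh: "h \<cdot> g = Id E C" using deflation_epi[OF assms(1), of "h \<cdot> g" C "Id E C"]
    by (simp add: Hom_iff)
  have "(g \<cdot> h) \<cdot> p = Id E C' \<cdot> p" by simp
  then have hg: "g \<cdot> h = Id E C'" using epi[of "g \<cdot> h" C' "Id E C'"] by (simp add: Hom_iff)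
  have "iso_arr E g" unfolding iso_arr_def using gh hg by (auto simp: Hom_iff)
  then have "(i, p) \<in> Confl E"
    using Confl_iso_closed[of i q i p "Id E A" "Id E B" g] assms(1) iso_Id[of B] iso_Id[of A]
    by (auto simp: ses_def Hom_iff)
  then show ?thesis by (auto simp: ses_def Hom_iff)
qed

lemma zero_object_arr:
  assumes "zero_object E Z"
  shows "Z \<in> Obj E" "f \<in> Hom E A Z \<Longrightarrow> f = Zero E A Z" "f \<in> Hom E Z A \<Longrightarrow> f = Zero E Z A"
proof -
  show Z: "Z \<in> Obj E" using assms by (auto simp: zero_object_def)
  show "f \<in> Hom E A Z \<Longrightarrow> f = Zero E A Z"
    using assms Hom_Obj(1)[of f A Z] Z unfolding zero_object_def by (metis Hom_iff Zero_simps)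
  show "f \<in> Hom E Z A \<Longrightarrow> f = Zero E Z A"
    using assms Hom_Obj(2)[of f Z A] Z unfolding zero_object_def by (metis Hom_iff Zero_simps)
qed

lemma ses_Id:
  assumes "zero_object E Z" "C \<in> Obj E"
  shows "ses Z (Zero E Z C) C (Id E C) C"
proof -
  note Z = zero_object_arr[OF assms(1)]
  obtain j where "(j, Id E C) \<in> Confl E" using deflation_Id assms by (auto simp: deflation_def)
  from Confl_ses[OF this] have s: "ses (Dom E j) j C (Id E C) C" using assms by simp
  show ?thesis
  proof (rule ses_other_kernel[OF s])
    fix T f assume f: "f \<in> Hom E T C" "Id E C \<cdot> f = Zero E T C"
    then show "\<exists>g \<in> Hom E T Z. Zero E Z C \<cdot> g = f"
      using assms Z(1) Hom_Obj(1)[OF f(1)]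
      by (intro bexI[of _ "Zero E T Z"]) (auto simp: Hom_iff)
  next
    fix T f g assume "f \<in> Hom E T Z" "g \<in> Hom E T Z"
    then show "f = g" using Z(2) by metis
  qed (use assms Z(1) in \<open>auto simp: Hom_iff\<close>)
qed

section \<open>Pullbacks and pushouts of conflations\<close>

lemma is_pullbackD:
  assumes "is_pullback E p c b p'"
  shows "p \<in> Arr E" "c \<in> Arr E" "b \<in> Arr E" "p' \<in> Arr E" "Cod E c = Cod E p"
    "Cod E b = Dom E p" "Cod E p' = Dom E c" "Dom E b = Dom E p'" "p \<cdot> b = c \<cdot> p'"
  using assms unfolding is_pullback_def by auto

lemma is_pullback_ex1:
  assumes "is_pullback E p c b p'" "u \<in> Hom E T (Dom E p)" "v \<in> Hom E T (Dom E c)" "p \<cdot> u = c \<cdot> v"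
  shows "\<exists>!w. w \<in> Hom E T (Dom E p') \<and> b \<cdot> w = u \<and> p' \<cdot> w = v"
  using assms unfolding is_pullback_def by blast

lemma pullback_lift:
  assumes "is_pullback E p c b p'" "u \<in> Hom E T (Dom E p)" "v \<in> Hom E T (Dom E c)" "p \<cdot> u = c \<cdot> v"
  obtains w where "w \<in> Hom E T (Dom E p')" "b \<cdot> w = u" "p' \<cdot> w = v"
  using is_pullback_ex1[OF assms] by blast

lemma pullback_unique:
  assumes "is_pullback E p c b p'" "w \<in> Hom E T (Dom E p')" "w' \<in> Hom E T (Dom E p')"
    "b \<cdot> w = b \<cdot> w'" "p' \<cdot> w = p' \<cdot> w'"
  shows "w = w'"
proof -
  note s = is_pullbackD[OF assms(1)]
  have "p \<cdot> (b \<cdot> w) = c \<cdot> (p' \<cdot> w)" 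
    using s assms(2) by (simp add: comp_reduce[OF s(9)] Hom_iff)
  then have "\<exists>!v. v \<in> Hom E T (Dom E p') \<and> b \<cdot> v = b \<cdot> w \<and> p' \<cdot> v = p' \<cdot> w"
    using s assms(2) by (intro is_pullback_ex1[OF assms(1)]) (auto simp: Hom_iff)
  then show ?thesis using assms by metis
qed

lemma is_pullback_sym: "is_pullback E p c b p' \<Longrightarrow> is_pullback E c p p' b"
proof -
  assume pb: "is_pullback E p c b p'"
  note s = is_pullbackD[OF this]
  have "\<exists>!w. w \<in> Hom E T (Dom E b) \<and> p' \<cdot> w = u \<and> b \<cdot> w = v"
    if "u \<in> Hom E T (Dom E c)" "v \<in> Hom E T (Dom E p)" "c \<cdot> u = p \<cdot> v" for T u v
    using is_pullback_ex1[OF pb that(2,1) that(3)[symmetric]] unfolding s(8) by blast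
  then show ?thesis using s unfolding is_pullback_def by simp
qed

lemma is_pushoutD:
  assumes "is_pushout E i a b i'"
  shows "i \<in> Arr E" "a \<in> Arr E" "b \<in> Arr E" "i' \<in> Arr E" "Dom E a = Dom E i"
    "Dom E b = Cod E i" "Dom E i' = Cod E a" "Cod E b = Cod E i'" "b \<cdot> i = i' \<cdot> a"
  using assms unfolding is_pushout_def by auto

lemma is_pushout_ex1:
  assumes "is_pushout E i a b i'" "u \<in> Hom E (Cod E i) T" "v \<in> Hom E (Cod E a) T" "u \<cdot> i = v \<cdot> a"
  shows "\<exists>!w. w \<in> Hom E (Cod E i') T \<and> w \<cdot> b = u \<and> w \<cdot> i' = v"
  using assms unfolding is_pushout_def by blast

lemma pushout_desc:
  assumes "is_pushout E i a b i'" "u \<in> Hom E (Cod E i) T" "v \<in> Hom E (Cod E a) T" "u \<cdot> i = v \<cdot> a"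
  obtains w where "w \<in> Hom E (Cod E i') T" "w \<cdot> b = u" "w \<cdot> i' = v"
  using is_pushout_ex1[OF assms] by blast

lemma pushout_unique:
  assumes "is_pushout E i a b i'" "w \<in> Hom E (Cod E i') T" "w' \<in> Hom E (Cod E i') T"
    "w \<cdot> b = w' \<cdot> b" "w \<cdot> i' = w' \<cdot> i'"
  shows "w = w'"
proof -
  note s = is_pushoutD[OF assms(1)]
  have "(w \<cdot> b) \<cdot> i = (w \<cdot> i') \<cdot> a" 
    using s assms(2) by (simp add: Hom_iff)
  then have "\<exists>!v. v \<in> Hom E (Cod E i') T \<and> v \<cdot> b = w \<cdot> b \<and> v \<cdot> i' = w \<cdot> i'"
    using s assms(2) by (intro is_pushout_ex1[OF assms(1)]) (auto simp: Hom_iff)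
  then show ?thesis using assms by metis
qed

lemma is_pushout_sym: "is_pushout E i a b i' \<Longrightarrow> is_pushout E a i i' b"
proof -
  assume po: "is_pushout E i a b i'"
  note s = is_pushoutD[OF this]
  have "\<exists>!w. w \<in> Hom E (Cod E b) T \<and> w \<cdot> i' = u \<and> w \<cdot> b = v"
    if "u \<in> Hom E (Cod E a) T" "v \<in> Hom E (Cod E i) T" "u \<cdot> a = v \<cdot> i" for T u v
    using is_pushout_ex1[OF po that(2,1) that(3)[symmetric]] unfolding s(8) by blast
  then show ?thesis using s unfolding is_pushout_def by simp
qed

text \<open>
  The axioms provide one pullback whose projection is a deflation; any other pullback is isomorphic
  to it.
\<close>

lemma pullback_of_deflation:
  assumes "is_pullback E p c b p'" "deflation E p"
  shows "deflation E p'"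
proof -
  note s = is_pullbackD[OF assms(1)]
  obtain f' q where q: "is_pullback E p c f' q" "deflation E q"
    using pullback_deflation[OF assms(2) s(2,5)] by blast
  note t = is_pullbackD[OF q(1)]
  obtain x where x: "x \<in> Hom E (Dom E q) (Dom E p')" "b \<cdot> x = f'" "p' \<cdot> x = q"
    using pullback_lift[OF assms(1), of f' "Dom E q" q] t by (auto simp: Hom_iff)
  obtain y where y: "y \<in> Hom E (Dom E p') (Dom E q)" "f' \<cdot> y = b" "q \<cdot> y = p'"
    using pullback_lift[OF q(1), of b "Dom E p'" p'] s by (auto simp: Hom_iff)
  note [simp] = s t x[unfolded Hom_iff] y[unfolded Hom_iff]
  have "x \<cdot> y = Id E (Dom E p')"
    by (rule pullback_unique[OF assms(1), of _ "Dom E p'"])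
      (auto simp: Hom_iff comp_reduce[OF x(2)] comp_reduce[OF x(3)])
  moreover have "y \<cdot> x = Id E (Dom E q)"
    by (rule pullback_unique[OF q(1), of _ "Dom E q"])
      (auto simp: Hom_iff comp_reduce[OF y(2)] comp_reduce[OF y(3)])
  ultimately have iso: "iso_arr E x" unfolding iso_arr_def by (auto simp: Hom_iff)
  obtain j where j: "(j, q) \<in> Confl E" using q(2) by (auto simp: deflation_def)
  note [simp] = ConflD[OF j]
  have "(x \<cdot> j, p') \<in> Confl E"
    by (rule Confl_iso_closed[OF j, of _ _ "Id E (Dom E j)" x "Id E (Cod E q)"])
      (auto simp: Hom_iff iso iso_Id)
  then show ?thesis by (auto simp: deflation_def)
qed

lemma pullback_kernel:
  assumes "is_pullback E p c b p'" "ses A i B p C"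
  obtains i' where "ses A i' (Dom E p') p' (Dom E c)" "b \<cdot> i' = i"
proof -
  note s = is_pullbackD[OF assms(1)]
  note t = sesD[OF assms(2)]
  have "deflation E p'" using pullback_of_deflation[OF assms(1)] assms(2)
    by (auto simp: deflation_def ses_def)
  then obtain j where j: "(j, p') \<in> Confl E" by (auto simp: deflation_def)
  note [simp] = s t
  obtain i' where i': "i' \<in> Hom E A (Dom E p')" "b \<cdot> i' = i" "p' \<cdot> i' = Zero E A (Dom E c)"
    using pullback_lift[OF assms(1), of i A "Zero E A (Dom E c)"] by (auto simp: Hom_iff)
  note [simp] = i'[unfolded Hom_iff]
  have "ses A i' (Dom E p') p' (Dom E c)"
  proof (rule ses_other_kernel[OF Confl_ses[OF j, simplified]])
    fix T f assume f: "f \<in> Hom E T (Dom E p')" "p' \<cdot> f = Zero E T (Dom E c)"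
    note [simp] = f[unfolded Hom_iff] Hom_Obj[OF f(1)]
    obtain g where g: "g \<in> Hom E T A" "i \<cdot> g = b \<cdot> f"
      using kernel_lift[OF assms(2), of "b \<cdot> f" T] by (auto simp: Hom_iff comp_reduce[OF s(9)])
    note [simp] = g[unfolded Hom_iff]
    have "i' \<cdot> g = f"
      by (rule pullback_unique[OF assms(1), of _ T])
        (auto simp: Hom_iff comp_reduce[OF i'(2)] comp_reduce[OF i'(3)])
    then show "\<exists>g\<in>Hom E T A. i' \<cdot> g = f" using g by blast
  next
    fix T f g assume f: "f \<in> Hom E T A" "g \<in> Hom E T A" "i' \<cdot> f = i' \<cdot> g"
    then have "b \<cdot> (i' \<cdot> f) = b \<cdot> (i' \<cdot> g)" by simp
    then have "i \<cdot> f = i \<cdot> g" using f(1,2) by (simp add: comp_reduce[OF i'(2)] Hom_iff)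
    then show "f = g" using inflation_mono[OF assms(2) f(1,2)] by simp
  qed (auto simp: Hom_iff)
  then show ?thesis using that i'(2) by blast
qed

lemma pullback_ses:
  assumes "ses A i B p C" "c \<in> Hom E C' C"
  obtains i' B' p' b where "ses A i' B' p' C'" "b \<in> Hom E B' B" "p \<cdot> b = c \<cdot> p'" "b \<cdot> i' = i"
    "is_pullback E p c b p'"
proof -
  note s = sesD[OF assms(1)]
  have "deflation E p" using assms(1) by (auto simp: deflation_def ses_def)
  then obtain b p' where pb: "is_pullback E p c b p'"
    using pullback_deflation[of p c] assms(2) s by (auto simp: Hom_iff)
  from pullback_kernel[OF pb assms(1)] obtain i' where
    "ses A i' (Dom E p') p' (Dom E c)" "b \<cdot> i' = i" .
  then show ?thesis using that[of i' "Dom E p'" p' b] is_pullbackD[OF pb] pb assms s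
    by (auto simp: Hom_iff)
qed

text \<open>
  The pullback square is symmetric, so both projections are deflations, each with the kernel of the
  map opposite to it.
\<close>

lemma pullback_ses2:
  assumes "ses A i B p C" "ses R j D q C"
  obtains i' j' P p' q' where "ses A i' P p' D" "ses R j' P q' B"
    "p \<cdot> q' = q \<cdot> p'" "q' \<cdot> i' = i" "p' \<cdot> j' = j"
proof -
  note s = sesD[OF assms(1)] and t = sesD[OF assms(2)]
  obtain i' P p' b where P: "ses A i' P p' D" "b \<in> Hom E P B" "p \<cdot> b = q \<cdot> p'" "b \<cdot> i' = i"
    "is_pullback E p q b p'"
    using pullback_ses[OF assms(1), of q D] t by (auto simp: Hom_iff)
  obtain j' where "ses R j' (Dom E b) b (Dom E p)" "p' \<cdot> j' = j"
    using pullback_kernel[OF is_pullback_sym[OF P(5)] assms(2)] .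
  then show ?thesis using that[of i' P p' j' b] P s by (auto simp: Hom_iff)
qed

lemma pushout_of_inflation:
  assumes "is_pushout E i a b i'" "inflation E i"
  shows "inflation E i'"
proof -
  note s = is_pushoutD[OF assms(1)]
  obtain f' q where q: "is_pushout E i a f' q" "inflation E q"
    using pushout_inflation[OF assms(2) s(2,5)] by blast
  note t = is_pushoutD[OF q(1)]
  obtain x where x: "x \<in> Hom E (Cod E i') (Cod E q)" "x \<cdot> b = f'" "x \<cdot> i' = q"
    using pushout_desc[OF assms(1), of f' "Cod E q" q] t by (auto simp: Hom_iff)
  obtain y where y: "y \<in> Hom E (Cod E q) (Cod E i')" "y \<cdot> f' = b" "y \<cdot> q = i'"
    using pushout_desc[OF q(1), of b "Cod E i'" i'] s by (auto simp: Hom_iff)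
  note [simp] = s t x[unfolded Hom_iff] y[unfolded Hom_iff]
  have "y \<cdot> x = Id E (Cod E i')"
    by (rule pushout_unique[OF assms(1), of _ "Cod E i'"]) (auto simp: Hom_iff)
  moreover have "x \<cdot> y = Id E (Cod E q)"
    by (rule pushout_unique[OF q(1), of _ "Cod E q"]) (auto simp: Hom_iff)
  ultimately have iso: "iso_arr E y" unfolding iso_arr_def by (auto simp: Hom_iff)
  obtain j where j: "(q, j) \<in> Confl E" using q(2) by (auto simp: inflation_def)
  note [simp] = ConflD(2,4)[OF j] ConflD(3)[OF j, symmetric]
  have "(i', j \<cdot> x) \<in> Confl E"
    by (rule Confl_iso_closed[OF j, of _ _ "Id E (Cod E a)" y "Id E (Cod E j)"])
      (auto simp: Hom_iff iso iso_Id \<open>x \<cdot> y = _\<close>)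
  then show ?thesis by (auto simp: inflation_def)
qed

lemma pushout_cokernel:
  assumes "is_pushout E i a b i'" "ses A i B p C"
  obtains p' where "ses (Cod E a) i' (Cod E i') p' C" "p' \<cdot> b = p"
proof -
  note s = is_pushoutD[OF assms(1)]
  note t = sesD[OF assms(2)]
  have "inflation E i'" using pushout_of_inflation[OF assms(1)] assms(2)
    by (auto simp: inflation_def ses_def)
  then obtain q where q: "(i', q) \<in> Confl E" by (auto simp: inflation_def)
  note [simp] = s t
  note [simp] = ConflD(2,4)[OF q] ConflD(3)[OF q, symmetric]
  obtain p' where p': "p' \<in> Hom E (Cod E i') C" "p' \<cdot> b = p" "p' \<cdot> i' = Zero E (Cod E a) C"
    using pushout_desc[OF assms(1), of p C "Zero E (Cod E a) C"] by (auto simp: Hom_iff)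
  note [simp] = p'[unfolded Hom_iff]
  have "ses (Cod E a) i' (Cod E i') p' C"
  proof (rule ses_other_cokernel[OF Confl_ses[OF q, simplified]])
    fix T f assume f: "f \<in> Hom E (Cod E i') T" "f \<cdot> i' = Zero E (Cod E a) T"
    note [simp] = f[unfolded Hom_iff] Hom_Obj[OF f(1)]
    have "f \<cdot> (b \<cdot> i) = Zero E A T" by (simp add: comp_reduce[OF f(2)])
    then obtain g where g: "g \<in> Hom E C T" "g \<cdot> p = f \<cdot> b"
      using cokernel_desc[OF assms(2), of "f \<cdot> b" T] by (auto simp: Hom_iff)
    note [simp] = g[unfolded Hom_iff]
    have "g \<cdot> p' = f"
      by (rule pushout_unique[OF assms(1), of _ T]) (auto simp: Hom_iff)
    then show "\<exists>g\<in>Hom E C T. g \<cdot> p' = f" using g by blast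
  next
    fix T f g assume f: "f \<in> Hom E C T" "g \<in> Hom E C T" "f \<cdot> p' = g \<cdot> p'"
    then have "(f \<cdot> p') \<cdot> b = (g \<cdot> p') \<cdot> b" by simp
    then have "f \<cdot> p = g \<cdot> p" using f(1,2) by (simp add: Hom_iff)
    then show "f = g" using deflation_epi[OF assms(2) f(1,2)] by simp
  qed (auto simp: Hom_iff)
  then show ?thesis using that p'(2) by blast
qed

lemma pushout_ses:
  assumes "ses A i B p C" "a \<in> Hom E A A'"
  obtains i' B' p' b where "ses A' i' B' p' C" "b \<in> Hom E B B'" "b \<cdot> i = i' \<cdot> a" "p' \<cdot> b = p"
    "is_pushout E i a b i'"
proof -
  note s = sesD[OF assms(1)]
  have "inflation E i" using assms(1) by (auto simp: inflation_def ses_def)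
  then obtain b i' where po: "is_pushout E i a b i'"
    using pushout_inflation[of i a] assms(2) s by (auto simp: Hom_iff)
  from pushout_cokernel[OF po assms(1)] obtain p' where
    "ses (Cod E a) i' (Cod E i') p' C" "p' \<cdot> b = p" .
  then show ?thesis using that[of i' "Cod E i'" p' b] is_pushoutD[OF po] po assms s
    by (auto simp: Hom_iff)
qed

lemma pushout_ses2:
  assumes "ses A i B p C" "ses A j D q K"
  obtains i' j' P p' q' where "ses D i' P p' C" "ses B j' P q' K"
    "j' \<cdot> i = i' \<cdot> j" "p' \<cdot> j' = p" "q' \<cdot> i' = q"
proof -
  note s = sesD[OF assms(1)] and t = sesD[OF assms(2)]
  obtain i' P p' b where P: "ses D i' P p' C" "b \<in> Hom E B P" "b \<cdot> i = i' \<cdot> j" "p' \<cdot> b = p"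
    "is_pushout E i j b i'"
    using pushout_ses[OF assms(1), of j D] t by (auto simp: Hom_iff)
  obtain q' where "ses (Cod E i) b (Cod E b) q' K" "q' \<cdot> i' = q"
    using pushout_cokernel[OF is_pushout_sym[OF P(5)] assms(2)] .
  then show ?thesis using that[of i' P p' b q'] P s by (auto simp: Hom_iff)
qed

text \<open>
  If \<open>f\<close> is pulled back along the kernel of \<open>p\<close>, the other projection \<open>u\<close> of the pullback is a
  kernel of \<open>p \<cdot> f\<close>.
\<close>

lemma deflation_comp_ses:
  assumes "ses K i F p C" "ses R r X f F"
  obtains K' u \<kappa> r' where "ses K' u X (p \<cdot> f) C" "ses R r' K' \<kappa> K" "f \<cdot> u = i \<cdot> \<kappa>"
proof -
  note [simp] = sesD[OF assms(1)] sesD[OF assms(2)]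
  obtain r' K' \<kappa> u where K': "ses R r' K' \<kappa> K" "u \<in> Hom E K' X" "f \<cdot> u = i \<cdot> \<kappa>"
    "is_pullback E f i u \<kappa>"
    using pullback_ses[OF assms(2), of i K thesis] unfolding Hom_iff by simp
  note [simp] = sesD[OF K'(1)] K'(2)[unfolded Hom_iff]
  have "deflation E (p \<cdot> f)"
    using deflation_Comp[of f p] assms by (auto simp: deflation_def ses_def Hom_iff)
  then obtain j where j: "(j, p \<cdot> f) \<in> Confl E" by (auto simp: deflation_def)
  have "ses K' u X (p \<cdot> f) C"
  proof (rule ses_other_kernel[OF Confl_ses[OF j, simplified]])
    show "(p \<cdot> f) \<cdot> u = Zero E K' C"
      using K' by (simp add: comp_reduce[OF sesD(10)[OF assms(1)]])
  next
    fix T g assume g: "g \<in> Hom E T X" "(p \<cdot> f) \<cdot> g = Zero E T C"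
    note [simp] = g(1)[unfolded Hom_iff]
    obtain w where w: "w \<in> Hom E T K" "i \<cdot> w = f \<cdot> g"
      using kernel_lift[OF assms(1), of "f \<cdot> g" T] g by (auto simp: Hom_iff)
    obtain s where "s \<in> Hom E T K'" "u \<cdot> s = g"
      using pullback_lift[OF K'(4), of g T w] g w by (auto simp: Hom_iff)
    then show "\<exists>s \<in> Hom E T K'. u \<cdot> s = g" by blast
  next
    fix T g h assume g: "g \<in> Hom E T K'" "h \<in> Hom E T K'" "u \<cdot> g = u \<cdot> h"
    note [simp] = g(1,2)[unfolded Hom_iff]
    have "(f \<cdot> u) \<cdot> g = (f \<cdot> u) \<cdot> h" using g(3) by simp
    then have "i \<cdot> (\<kappa> \<cdot> g) = i \<cdot> (\<kappa> \<cdot> h)" unfolding K'(3) by simp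
    then have "\<kappa> \<cdot> g = \<kappa> \<cdot> h"
      using inflation_mono[OF assms(1), of "\<kappa> \<cdot> g" T "\<kappa> \<cdot> h"] by (auto simp: Hom_iff)
    then show "g = h" using pullback_unique[OF K'(4), of g T h] g by simp
  qed (auto simp: Hom_iff)
  then show ?thesis using that K' by blast
qed

lemma inflation_comp_ses:
  assumes "ses J j F q K" "ses F x X y Y"
  obtains K' q' where "ses J (x \<cdot> j) X q' K'"
proof -
  note [simp] = sesD[OF assms(1)] sesD[OF assms(2)]
  have "inflation E (x \<cdot> j)"
    using inflation_Comp[of j x] assms by (auto simp: inflation_def ses_def Hom_iff)
  then obtain q' where q': "(x \<cdot> j, q') \<in> Confl E" by (auto simp: inflation_def)
  from Confl_ses[OF this] have *: "ses J (x \<cdot> j) (Dom E q') q' (Cod E q')" by simp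
  then have "Dom E q' = X" using sesD(4)[OF *] by simp
  then show ?thesis using * that by simp
qed

section \<open>Extensions as chains of conflations\<close>

text \<open>
  An \<open>m\<close>-fold extension \<open>A \<rightarrow> E\<^sub>m \<rightarrow> \<dots> \<rightarrow> E\<^sub>1 \<rightarrow> C\<close> is kept as the list of its \<open>m\<close>
  conflations, starting at \<open>C\<close>: this is the order in which lifting arguments proceed.  The empty
  list serves as the identity of \<open>A = C\<close>, the starting point of all recursions.
\<close>

fun ext_chain :: "('m \<times> 'm) list \<Rightarrow> 'o \<Rightarrow> 'o \<Rightarrow> bool" where
  "ext_chain [] C A \<longleftrightarrow> C = A \<and> C \<in> Obj E"
| "ext_chain ((i, p) # S) C A \<longleftrightarrow> ses (Dom E i) i (Dom E p) p C \<and> ext_chain S (Dom E i) A"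

text \<open>
  Morphisms of extensions with components \<open>a\<close> and \<open>c\<close> at the two ends.  The maps \<open>k\<close> between the
  kernels are part of the recursion, so that on empty lists both ends have to agree.
\<close>

fun ext_mor :: "('m \<times> 'm) list \<Rightarrow> ('m \<times> 'm) list \<Rightarrow> 'm \<Rightarrow> 'm \<Rightarrow> bool" where
  "ext_mor [] [] a c \<longleftrightarrow> a = c"
| "ext_mor ((i, p) # R) ((j, q) # S) a c \<longleftrightarrow>
     (\<exists>b k. b \<in> Hom E (Dom E p) (Dom E q) \<and> k \<in> Hom E (Dom E i) (Dom E j) \<and>
        q \<cdot> b = c \<cdot> p \<and> b \<cdot> i = j \<cdot> k \<and> ext_mor R S a k)"
| "ext_mor _ _ a c \<longleftrightarrow> False"

text \<open>
  The class of \<open>S\<close> in \<open>Ext\<^sup>m(D, A)\<close>, pulled back along \<open>c : C \<rightarrow> D\<close>, lies in the image of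
  \<open>f\<^sub>* : Ext\<^sup>m(C, F) \<rightarrow> Ext\<^sup>m(C, A)\<close>.  For \<open>m = 0\<close> this says that \<open>c\<close> factors through \<open>f\<close>.  For
  \<open>m > 0\<close> the witness is found one conflation at a time: some conflation ending at \<open>C\<close> maps to the
  first conflation of \<open>S\<close> over \<open>c\<close>, and the induced map \<open>k\<close> of kernels satisfies the condition for
  the remaining conflations.  See \<open>in_image_obtain_ext\<close> and \<open>in_image_of_ext_mor\<close>.
\<close>

fun in_image :: "'m \<Rightarrow> ('m \<times> 'm) list \<Rightarrow> 'm \<Rightarrow> bool" where
  "in_image f [] c \<longleftrightarrow> (\<exists>x \<in> Hom E (Dom E c) (Dom E f). f \<cdot> x = c)"
| "in_image f ((i, p) # S) c \<longleftrightarrow>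
     (\<exists>j q b k. ses (Dom E j) j (Dom E q) q (Dom E c) \<and>
        b \<in> Hom E (Dom E q) (Dom E p) \<and> k \<in> Hom E (Dom E j) (Dom E i) \<and>
        p \<cdot> b = c \<cdot> q \<and> b \<cdot> j = i \<cdot> k \<and> in_image f S k)"

lemma in_image_Nil:
  assumes "c \<in> Hom E C D" "f \<in> Hom E F A"
  shows "in_image f [] c \<longleftrightarrow> (\<exists>x \<in> Hom E C F. f \<cdot> x = c)"
  using assms by (simp add: Hom_iff)

lemma in_image_ConsI:
  assumes "ses Q j B q C" "c \<in> Hom E C D" "ses K i P p D" "b \<in> Hom E B P" "k \<in> Hom E Q K"
    "p \<cdot> b = c \<cdot> q" "b \<cdot> j = i \<cdot> k" "in_image f S k"
  shows "in_image f ((i, p) # S) c"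
  unfolding in_image.simps using assms sesD[OF assms(1)] sesD[OF assms(3)]
  by (intro exI[of _ j] exI[of _ q] exI[of _ b] exI[of _ k]) (auto simp: Hom_iff)

lemma in_image_ConsE:
  assumes "in_image f ((i, p) # S) c" "c \<in> Hom E C D" "ses K i P p D"
  obtains Q j B q b k where "ses Q j B q C" "b \<in> Hom E B P" "k \<in> Hom E Q K"
    "p \<cdot> b = c \<cdot> q" "b \<cdot> j = i \<cdot> k" "in_image f S k"
proof -
  obtain j q b k where *: "ses (Dom E j) j (Dom E q) q (Dom E c)"
        "b \<in> Hom E (Dom E q) (Dom E p)" "k \<in> Hom E (Dom E j) (Dom E i)"
        "p \<cdot> b = c \<cdot> q" "b \<cdot> j = i \<cdot> k" "in_image f S k"
    using assms(1) by auto
  then show ?thesis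
    using that[of "Dom E j" j "Dom E q" q b k] assms(2) sesD[OF assms(3)] by (auto simp: Hom_iff)
qed

lemma ext_mor_ConsI:
  assumes "ses Q j B q C" "ses K i P p D" "b \<in> Hom E B P" "k \<in> Hom E Q K"
    "p \<cdot> b = c \<cdot> q" "b \<cdot> j = i \<cdot> k" "ext_mor R S a k"
  shows "ext_mor ((j, q) # R) ((i, p) # S) a c"
  unfolding ext_mor.simps using assms sesD[OF assms(1)] sesD[OF assms(2)]
  by (intro exI[of _ b] exI[of _ k]) auto

lemma ext_mor_ConsE:
  assumes "ext_mor ((j, q) # R) ((i, p) # S) a c" "ses Q j B q C" "ses K i P p D"
  obtains b k where "b \<in> Hom E B P" "k \<in> Hom E Q K"
    "p \<cdot> b = c \<cdot> q" "b \<cdot> j = i \<cdot> k" "ext_mor R S a k"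
  using assms sesD[OF assms(2)] sesD[OF assms(3)] by auto

lemma ext_chain_Obj: "ext_chain S C A \<Longrightarrow> C \<in> Obj E \<and> A \<in> Obj E"
  by (induction S C A rule: ext_chain.induct) (auto dest: sesD)

lemma ext_chain_append: "ext_chain (S @ T) C A \<longleftrightarrow> (\<exists>K. ext_chain S C K \<and> ext_chain T K A)"
  by (induction S arbitrary: C) (auto dest: ext_chain_Obj sesD)

lemma ext_chain_ConsI: "ses K i B p C \<Longrightarrow> ext_chain S K A \<Longrightarrow> ext_chain ((i, p) # S) C A"
  using sesD[of K i B p C] by auto

lemma ext_chain_ConsE:
  assumes "ext_chain ((i, p) # S) C A"
  obtains K B where "ses K i B p C" "ext_chain S K A"
  using assms by auto

lemma ext_mor_length: "ext_mor R S a c \<Longrightarrow> length R = length S"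
  by (induction R S a c rule: ext_mor.induct) auto

lemma ext_mor_refl: "ext_chain S C A \<Longrightarrow> ext_mor S S (Id E A) (Id E C)"
proof (induction S arbitrary: C)
  case (Cons x S)
  obtain i p where x: "x = (i, p)" by fastforce
  obtain K B where s: "ses K i B p C" "ext_chain S K A" using Cons.prems unfolding x by auto
  show ?case unfolding x
    by (rule ext_mor_ConsI[OF s(1) s(1), of "Id E B" "Id E K"])
      (use Cons.IH[OF s(2)] sesD[OF s(1)] in \<open>auto simp: Hom_iff\<close>)
qed auto

lemma ext_mor_comp:
  assumes "ext_mor R S a c" "ext_mor S T a' c'" "ext_chain R C A" "ext_chain S C' A'"
    "ext_chain T C'' A''" "c \<in> Hom E C C'" "c' \<in> Hom E C' C''"
  shows "ext_mor R T (a' \<cdot> a) (c' \<cdot> c)"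
  using assms
proof (induction R S a c arbitrary: T C C' C'' c' rule: ext_mor.induct)
  case (1 a c)
  then show ?case by (cases T) auto
next
  case (2 i p R j q S a c)
  obtain l r T' where T: "T = (l, r) # T'" using 2(3) by (cases T) auto
  obtain K B where s: "ses K i B p C" "ext_chain R K A" using 2(4) by (rule ext_chain_ConsE)
  obtain K' B' where s': "ses K' j B' q C'" "ext_chain S K' A'" using 2(5) by (rule ext_chain_ConsE)
  obtain K'' B'' where s'': "ses K'' l B'' r C''" "ext_chain T' K'' A''"
    using 2(6) unfolding T by (rule ext_chain_ConsE)
  obtain b k where b: "b \<in> Hom E B B'" "k \<in> Hom E K K'"
    "q \<cdot> b = c \<cdot> p" "b \<cdot> i = j \<cdot> k" "ext_mor R S a k"
    using 2(2) s(1) s'(1) by (rule ext_mor_ConsE)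
  obtain b' k' where b': "b' \<in> Hom E B' B''" "k' \<in> Hom E K' K''"
    "r \<cdot> b' = c' \<cdot> q" "b' \<cdot> j = l \<cdot> k'" "ext_mor S T' a' k'"
    using 2(3) s'(1) s''(1) unfolding T by (rule ext_mor_ConsE)
  note [simp] = sesD[OF s(1)] sesD[OF s'(1)] sesD[OF s''(1)]
    b(1,2)[unfolded Hom_iff] b'(1,2)[unfolded Hom_iff] 2(7,8)[unfolded Hom_iff]
  show ?case unfolding T
  proof (rule ext_mor_ConsI[OF s(1) s''(1), of "b' \<cdot> b" "k' \<cdot> k"])
    show "r \<cdot> (b' \<cdot> b) = (c' \<cdot> c) \<cdot> p" using b by (simp add: comp_reduce[OF b'(3)])
    show "b' \<cdot> b \<cdot> i = l \<cdot> (k' \<cdot> k)" using b by (simp add: comp_reduce[OF b'(4)])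
    show "ext_mor R T' (a' \<cdot> a) (k' \<cdot> k)"
      by (rule 2(1)[OF b(5) b'(5) s(2) s'(2) s''(2) b(2) b'(2)])
  qed (auto simp: Hom_iff)
qed auto

lemma ext_mor_append:
  "ext_mor R S k c \<Longrightarrow> ext_mor R' S' a k \<Longrightarrow> ext_mor (R @ R') (S @ S') a c"
  by (induction R S k c rule: ext_mor.induct) auto

section \<open>Pullback classes in the image of a map\<close>

lemma in_image_precomp:
  assumes "in_image f S c" "ext_chain S D A" "f \<in> Hom E F A" "c \<in> Hom E C D" "z \<in> Hom E C' C"
  shows "in_image f S (c \<cdot> z)"
proof (cases S)
  case Nil
  then obtain x where x: "x \<in> Hom E C F" "f \<cdot> x = c"
    using assms(1) in_image_Nil[OF assms(4,3)] by blast
  note [simp] = x(1)[unfolded Hom_iff] assms(3-5)[unfolded Hom_iff]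
  show ?thesis unfolding Nil in_image.simps
    by (intro bexI[of _ "x \<cdot> z"]) (simp_all add: Hom_iff comp_reduce[OF x(2)])
next
  case (Cons y S')
  then obtain i p where S: "S = (i, p) # S'" by (cases y) auto
  obtain K P where s: "ses K i P p D" using assms(2) unfolding S by (rule ext_chain_ConsE)
  obtain Q j B q b k where *: "ses Q j B q C" "b \<in> Hom E B P" "k \<in> Hom E Q K"
    "p \<cdot> b = c \<cdot> q" "b \<cdot> j = i \<cdot> k" "in_image f S' k"
    using assms(1,4) s unfolding S by (rule in_image_ConsE)
  obtain j' B' q' b' where b': "ses Q j' B' q' C'" "b' \<in> Hom E B' B" "q \<cdot> b' = z \<cdot> q'" "b' \<cdot> j' = j"
    "is_pullback E q z b' q'"
    using pullback_ses[OF *(1) assms(5)] .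
  note [simp] = sesD[OF *(1)] sesD[OF b'(1)] *(2,3)[unfolded Hom_iff] assms(4,5)[unfolded Hom_iff]
    sesD[OF s] b'(2)[unfolded Hom_iff]
  show ?thesis unfolding S
    by (rule in_image_ConsI[OF b'(1) _ s, of _ "b \<cdot> b'" k])
      (use * b' in \<open>auto simp: Hom_iff comp_reduce[OF *(4)]\<close>)
qed

text \<open>
  Maps that factor through the deflation \<open>p\<close> pull the extension back to a trivial one, so they may be
  added to \<open>c\<close>: the same conflation ending at \<open>C\<close> and the same map of kernels serve as a witness.
\<close>

lemma in_image_add_boundary:
  assumes "in_image f ((i, p) # S) c" "ses K i P p D" "c \<in> Hom E C D" "w \<in> Hom E C P"
  shows "in_image f ((i, p) # S) (c \<boxplus> p \<cdot> w)"
proof -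
  obtain Q j B q b k where *: "ses Q j B q C" "b \<in> Hom E B P" "k \<in> Hom E Q K"
    "p \<cdot> b = c \<cdot> q" "b \<cdot> j = i \<cdot> k" "in_image f S k"
    using assms(1,3,2) by (rule in_image_ConsE)
  note [simp] = sesD[OF *(1)] sesD[OF assms(2)] *(2,3)[unfolded Hom_iff] assms(3,4)[unfolded Hom_iff]
  show ?thesis
    by (rule in_image_ConsI[OF *(1) _ assms(2), of _ "b \<boxplus> w \<cdot> q" k])
      (use * in \<open>auto simp: Hom_iff\<close>)
qed

lemma in_image_push:
  assumes "ext_mor S S' a d" "in_image f S c" "ext_chain S D A" "ext_chain S' D' A'"
    "f \<in> Hom E F A" "c \<in> Hom E C D" "d \<in> Hom E D D'" "a \<in> Hom E A A'"
  shows "in_image (a \<cdot> f) S' (d \<cdot> c)"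
  using assms
proof (induction S S' a d arbitrary: c C D D' rule: ext_mor.induct)
  case (1 a d)
  then obtain x where x: "x \<in> Hom E C F" "f \<cdot> x = c"
    using in_image_Nil[OF 1(6,5)] by blast
  have [simp]: "D = A" "D' = A'" "d = a" using 1(1,3,4) by auto
  note [simp] = x(1)[unfolded Hom_iff] 1(5-8)[unfolded Hom_iff, simplified]
  show ?case unfolding in_image.simps
    by (intro bexI[of _ x]) (use x(2) 1(1) in \<open>simp_all add: Hom_iff\<close>)
next
  case (2 i p S j q S' a d)
  obtain K B where s: "ses K i B p D" "ext_chain S K A" using 2(4) by (rule ext_chain_ConsE)
  obtain K' B' where s': "ses K' j B' q D'" "ext_chain S' K' A'" using 2(5) by (rule ext_chain_ConsE)
  obtain b k where b: "b \<in> Hom E B B'" "k \<in> Hom E K K'"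
    "q \<cdot> b = d \<cdot> p" "b \<cdot> i = j \<cdot> k" "ext_mor S S' a k"
    using 2(2) s(1) s'(1) by (rule ext_mor_ConsE)
  obtain Q l G r e h where *: "ses Q l G r C" "e \<in> Hom E G B" "h \<in> Hom E Q K"
    "p \<cdot> e = c \<cdot> r" "e \<cdot> l = i \<cdot> h" "in_image f S h"
    using 2(3,7) s(1) by (rule in_image_ConsE)
  note [simp] = sesD[OF s(1)] sesD[OF s'(1)] sesD[OF *(1)]
    b(1,2)[unfolded Hom_iff] *(2,3)[unfolded Hom_iff] 2(7,8)[unfolded Hom_iff]
  show ?case
  proof (rule in_image_ConsI[OF *(1) _ s'(1), of _ "b \<cdot> e" "k \<cdot> h"])
    show "q \<cdot> (b \<cdot> e) = (d \<cdot> c) \<cdot> r" using * by (simp add: comp_reduce[OF b(3)])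
    show "b \<cdot> e \<cdot> l = j \<cdot> (k \<cdot> h)" using * by (simp add: comp_reduce[OF b(4)])
    show "in_image (a \<cdot> f) S' (k \<cdot> h)"
      by (rule 2(1)[OF b(5) *(6) s(2) s'(2) 2(6) *(3) b(2) 2(9)])
  qed (auto simp: Hom_iff)
qed auto

lemma in_image_mono:
  assumes "in_image (f \<cdot> g) S c" "ext_chain S D A" "f \<in> Hom E F A" "g \<in> Hom E G F" "c \<in> Hom E C D"
  shows "in_image f S c"
  using assms
proof (induction S arbitrary: c C D)
  case Nil
  have [simp]: "D = A" using Nil(2) by simp
  have "f \<cdot> g \<in> Hom E G A" using Nil(3,4) by (simp add: Hom_iff)
  then obtain x where x: "x \<in> Hom E C G" "(f \<cdot> g) \<cdot> x = c"
    using Nil(1) in_image_Nil[OF Nil(5)] by blast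
  note [simp] = x(1)[unfolded Hom_iff] Nil(3-5)[unfolded Hom_iff, simplified]
  show ?case unfolding in_image.simps
    by (intro bexI[of _ "g \<cdot> x"]) (use x(2) in \<open>simp_all add: Hom_iff\<close>)
next
  case (Cons y S)
  then obtain i p where y: "y = (i, p)" by (cases y) auto
  obtain K P where s: "ses K i P p D" "ext_chain S K A"
    using Cons.prems(2) unfolding y by (rule ext_chain_ConsE)
  obtain Q j B q b k where *: "ses Q j B q C" "b \<in> Hom E B P" "k \<in> Hom E Q K"
    "p \<cdot> b = c \<cdot> q" "b \<cdot> j = i \<cdot> k" "in_image (f \<cdot> g) S k"
    using Cons.prems(1,5) s(1) unfolding y by (rule in_image_ConsE)
  show ?case unfolding y
    by (rule in_image_ConsI[OF *(1) Cons.prems(5) s(1) *(2-5)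
          Cons.IH[OF *(6) s(2) Cons.prems(3,4) *(3)]])
qed

text \<open>
  Factoring through the zero endomorphism of \<open>A\<close> means being zero, so this is the vanishing of the
  pulled back class.
\<close>

abbreviation null :: "'o \<Rightarrow> ('m \<times> 'm) list \<Rightarrow> 'm \<Rightarrow> bool" where
  "null A \<equiv> in_image (Zero E A A)"

lemma null_Nil: "c \<in> Hom E C A \<Longrightarrow> null A [] c \<longleftrightarrow> c = Zero E C A"
proof -
  assume c: "c \<in> Hom E C A"
  note [simp] = c[unfolded Hom_iff] Hom_Obj[OF c]
  have Z: "Zero E A A \<in> Hom E A A" by (simp add: Hom_iff)
  have "Zero E A A \<cdot> x = Zero E C A" if "x \<in> Hom E C A" for x
    using that by (simp add: Hom_iff)
  moreover have "Zero E C A \<in> Hom E C A" by (simp add: Hom_iff)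
  ultimately show ?thesis unfolding in_image_Nil[OF c Z] by auto
qed

lemma in_image_zero:
  assumes "ext_chain S D A" "f \<in> Hom E F A" "C \<in> Obj E"
  shows "in_image f S (Zero E C D)"
  using assms(1)
proof (induction S arbitrary: D)
  case Nil
  then have [simp]: "D = A" "A \<in> Obj E" by auto
  note [simp] = assms(3) assms(2)[unfolded Hom_iff] Hom_Obj[OF assms(2)]
  show ?case unfolding in_image.simps
    by (intro bexI[of _ "Zero E C F"]) (simp_all add: Hom_iff)
next
  case (Cons y S)
  then obtain i p where y: "y = (i, p)" by (cases y) auto
  obtain K P where s: "ses K i P p D" "ext_chain S K A"
    using Cons.prems unfolding y by (rule ext_chain_ConsE)
  obtain Z where Z: "zero_object E Z" using zero_object_ex by blast
  note [simp] = sesD[OF s(1)] assms(3) zero_object_arr(1)[OF Z]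
  have IH: "in_image f S (Zero E Z K)"
    using in_image_precomp[OF Cons.IH[OF s(2)] s(2) assms(2), of C "Zero E Z C" Z]
    by (auto simp: Hom_iff)
  show ?case unfolding y
    by (rule in_image_ConsI[OF ses_Id[OF Z assms(3)] _ s(1), of _ "Zero E C P" "Zero E Z K"])
      (use IH in \<open>auto simp: Hom_iff\<close>)
qed

lemma in_image_boundary:
  assumes "ext_chain ((i, p) # S) D A" "f \<in> Hom E F A" "w \<in> Hom E C (Dom E p)"
  shows "in_image f ((i, p) # S) (p \<cdot> w)"
proof -
  obtain K P where s: "ses K i P p D" using assms(1) by (rule ext_chain_ConsE)
  have C: "C \<in> Obj E" using assms(3) Hom_Obj by blast
  have "in_image f ((i, p) # S) (Zero E C D \<boxplus> p \<cdot> w)"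
    using in_image_zero[OF assms(1,2) C] assms(3) C sesD[OF s]
    by (intro in_image_add_boundary[OF _ s]) (auto simp: Hom_iff)
  then show ?thesis using sesD[OF s] assms(3) by (simp add: Hom_iff)
qed

text \<open>
  For the conflation \<open>A \<rightarrow> B \<rightarrow> K\<close>, this is exactness of \<open>Ext\<^sup>m(C, B) \<rightarrow> Ext\<^sup>m(C, K) \<rightarrow>
  Ext\<^sup>m\<^sup>+\<^sup>1(C, A)\<close>, where the connecting map splices with the conflation.  It reduces to the case
  \<open>m = 0\<close>, since both sides unfold along the same conflations of \<open>S\<close>.
\<close>

lemma null_snoc:
  assumes "ext_chain S D K" "ses A i B p K" "c \<in> Hom E C D"
  shows "null A (S @ [(i, p)]) c \<longleftrightarrow> in_image p S c"
  using assms(1,3)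
proof (induction S arbitrary: c C D)
  case Nil
  then have [simp]: "D = K" by simp
  note s = assms(2)
  note [simp] = sesD[OF s] Nil(2)[unfolded Hom_iff] Hom_Obj[OF Nil(2)]
  show ?case
  proof
    assume n: "null A ([] @ [(i, p)]) c"
    obtain Q j G q b k where *: "ses Q j G q C" "b \<in> Hom E G B" "k \<in> Hom E Q A"
      "p \<cdot> b = c \<cdot> q" "b \<cdot> j = i \<cdot> k" "null A [] k"
      using n[unfolded append_Nil] Nil(2)[simplified] s by (rule in_image_ConsE)
    note [simp] = sesD[OF *(1)] *(2,3)[unfolded Hom_iff]
    have "k = Zero E Q A" using null_Nil *(3,6) by blast
    then have "b \<cdot> j = Zero E Q B" using *(5) by simp
    then obtain x where x: "x \<in> Hom E C B" "x \<cdot> q = b"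
      using cokernel_desc[OF *(1,2)] by blast
    note [simp] = x[unfolded Hom_iff]
    have "p \<cdot> x = c" using deflation_epi[OF *(1), of "p \<cdot> x" K c] *(4) by (auto simp: Hom_iff)
    then show "in_image p [] c" using x in_image_Nil[OF Nil(2), of p B K] by (auto simp: Hom_iff)
  next
    assume "in_image p [] c"
    then obtain x where "x \<in> Hom E C B" "p \<cdot> x = c"
      using in_image_Nil[OF Nil(2), of p B K] by (auto simp: Hom_iff)
    then show "null A ([] @ [(i, p)]) c"
      using in_image_boundary[of i p "[]" K A "Zero E A A" A x C] s by (auto simp: Hom_iff)
  qed
next
  case (Cons y S)
  then obtain j q where y: "y = (j, q)" by (cases y) auto
  obtain L P where s: "ses L j P q D" "ext_chain S L K"
    using Cons.prems(1) unfolding y by (rule ext_chain_ConsE)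
  show ?case
  proof
    assume n: "null A ((y # S) @ [(i, p)]) c"
    obtain Q j' G q' b k where *: "ses Q j' G q' C" "b \<in> Hom E G P" "k \<in> Hom E Q L"
      "q \<cdot> b = c \<cdot> q'" "b \<cdot> j' = j \<cdot> k" "null A (S @ [(i, p)]) k"
      using n[unfolded append_Cons y] Cons.prems(2) s(1) by (rule in_image_ConsE)
    show "in_image p (y # S) c" unfolding y
      by (rule in_image_ConsI[OF *(1) Cons.prems(2) s(1) *(2-5)])
        (use Cons.IH[OF s(2) *(3)] *(6) in blast)
  next
    assume n: "in_image p (y # S) c"
    obtain Q j' G q' b k where *: "ses Q j' G q' C" "b \<in> Hom E G P" "k \<in> Hom E Q L"
      "q \<cdot> b = c \<cdot> q'" "b \<cdot> j' = j \<cdot> k" "in_image p S k"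
      using n[unfolded y] Cons.prems(2) s(1) by (rule in_image_ConsE)
    show "null A ((y # S) @ [(i, p)]) c" unfolding y append_Cons
      by (rule in_image_ConsI[OF *(1) Cons.prems(2) s(1) *(2-5)])
        (use Cons.IH[OF s(2) *(3)] *(6) in blast)
  qed
qed

text \<open>
  The witnessing conflations already form an extension of \<open>C\<close>; only the last one has to be pushed out
  along the factorisation of its kernel map through \<open>f\<close>.
\<close>

lemma in_image_obtain_ext:
  assumes "in_image f S c" "S \<noteq> []" "ext_chain S D A" "f \<in> Hom E F A" "c \<in> Hom E C D"
  shows "\<exists>S'. ext_chain S' C F \<and> length S' = length S \<and> ext_mor S' S f c"
  using assms
proof (induction S arbitrary: c C D)
  case (Cons y S)
  then obtain i p where y: "y = (i, p)" by (cases y) auto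
  obtain K P where s: "ses K i P p D" "ext_chain S K A"
    using Cons.prems(3) unfolding y by (rule ext_chain_ConsE)
  obtain Q j B q b k where *: "ses Q j B q C" "b \<in> Hom E B P" "k \<in> Hom E Q K"
    "p \<cdot> b = c \<cdot> q" "b \<cdot> j = i \<cdot> k" "in_image f S k"
    using Cons.prems(1,5) s(1) unfolding y by (rule in_image_ConsE)
  note [simp] = sesD[OF *(1)] sesD[OF s(1)] *(2,3)[unfolded Hom_iff]
    Cons.prems(4,5)[unfolded Hom_iff] Hom_Obj[OF Cons.prems(4)] Hom_Obj[OF Cons.prems(5)]
  show ?case
  proof (cases "S = []")
    case True
    then obtain x where x: "x \<in> Hom E Q F" "f \<cdot> x = k"
      using *(6) in_image_Nil[OF *(3) Cons.prems(4)] by blast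
    have [simp]: "K = A" using True s(2) by simp
    obtain j' B' q' e where e: "ses F j' B' q' C" "e \<in> Hom E B B'" "e \<cdot> j = j' \<cdot> x" "q' \<cdot> e = q"
      "is_pushout E j x e j'"
      using pushout_ses[OF *(1) x(1)] .
    note [simp] = sesD[OF e(1)] e(2)[unfolded Hom_iff] x(1)[unfolded Hom_iff]
    obtain w where w: "w \<in> Hom E B' P" "w \<cdot> e = b" "w \<cdot> j' = i \<cdot> f"
      using pushout_desc[OF e(5), of b P "i \<cdot> f"] *(5) x(2) by (auto simp: Hom_iff)
    note [simp] = w(1)[unfolded Hom_iff]
    have "p \<cdot> w = c \<cdot> q'"
      by (rule pushout_unique[OF e(5), of _ D])
        (use *(4) w e in \<open>auto simp: Hom_iff comp_reduce[OF sesD(10)[OF s(1)]]\<close>)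
    then have "ext_mor [(j', q')] [(i, p)] f c"
      using w by (intro ext_mor_ConsI[OF e(1) s(1), of w f]) (auto simp: Hom_iff)
    then show ?thesis using True y
      by (intro exI[of _ "[(j', q')]"]) (use e(1) in \<open>auto\<close>)
  next
    case False
    then obtain S' where S': "ext_chain S' Q F" "length S' = length S" "ext_mor S' S f k"
      using Cons.IH[OF *(6) False s(2) Cons.prems(4) *(3)] by blast
    then show ?thesis
      using ext_chain_ConsI[OF *(1) S'(1)] ext_mor_ConsI[OF *(1) s(1) *(2-5) S'(3)] unfolding y
      by (metis length_Cons)
  qed
qed simp

lemma in_image_of_ext_mor:
  assumes "ext_mor S' S f c" "ext_chain S' C F" "ext_chain S D A" "c \<in> Hom E C D"
  shows "in_image f S c"
  using assms
proof (induction S' S f c arbitrary: C D rule: ext_mor.induct)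
  case (1 a c)
  then have [simp]: "F = C" "a = c" by auto
  show ?case using 1 in_image_Nil[OF 1(4), of c C D] by (auto simp: Hom_iff intro!: bexI[of _ "Id E C"])
next
  case (2 i p R j q S a c)
  obtain K B where s: "ses K i B p C" "ext_chain R K F" using 2(3) by (rule ext_chain_ConsE)
  obtain K' B' where s': "ses K' j B' q D" "ext_chain S K' A" using 2(4) by (rule ext_chain_ConsE)
  obtain b k where b: "b \<in> Hom E B B'" "k \<in> Hom E K K'"
    "q \<cdot> b = c \<cdot> p" "b \<cdot> i = j \<cdot> k" "ext_mor R S a k"
    using 2(2) s(1) s'(1) by (rule ext_mor_ConsE)
  show ?case
    by (rule in_image_ConsI[OF s(1) 2(5) s'(1) b(1-4) 2(1)[OF b(5) s(2) s'(2) b(2)]])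
qed auto

text \<open>
  Exactness of \<open>Ext\<^sup>m(C, G) \<rightarrow> Ext\<^sup>m(C, A) \<rightarrow> Ext\<^sup>m(C, A')\<close> for a conflation \<open>G \<rightarrow> A \<rightarrow> A'\<close>.  With
  \<open>G = 0\<close> it also shows that the vanishing of a pulled back class is invariant under Yoneda
  equivalence.

  A witness for \<open>S'\<close> is pulled back to \<open>S\<close>.  The two resulting maps to the middle term \<open>P'\<close> of
  the first conflation of \<open>S'\<close> differ by a map \<open>t\<close> to its kernel \<open>K'\<close>.  Replacing the witnessing
  deflation onto \<open>C\<close> by a finer one, \<open>t\<close> is made to lift through a given deflation onto \<open>K'\<close>.  If
  further conflations follow, that deflation is the next one of \<open>S'\<close>, and the difference is
  absorbed by \<open>in_image_add_boundary\<close>; at the last conflation it is \<open>a\<close>, and the lift of \<open>t\<close> is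
  subtracted from the map to \<open>P\<close>.
\<close>

lemma in_image_kernel:
  assumes "ext_mor S S' a d" "ses G g A a A'" "null A' S' (d \<cdot> c)" "ext_chain S D A"
    "ext_chain S' D' A'" "c \<in> Hom E C D" "d \<in> Hom E D D'"
  shows "in_image g S c"
  using assms
proof (induction S S' a d arbitrary: c C D D' rule: ext_mor.induct)
  case (1 a d)
  have [simp]: "D = A" "D' = A'" "d = a" using 1(1,4,5) by auto
  note [simp] = sesD[OF 1(2)] 1(6)[unfolded Hom_iff]
  have "a \<cdot> c = Zero E C A'" using 1(3) null_Nil[of "a \<cdot> c" C A'] by (simp add: Hom_iff)
  then obtain x where "x \<in> Hom E C G" "g \<cdot> x = c"
    using kernel_lift[OF 1(2), of c C] 1(6) by auto
  then show ?case using in_image_Nil[OF 1(6), of g G A] by (auto simp: Hom_iff)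
next
  case (2 i p S i' p' S' a d)
  obtain K P where s: "ses K i P p D" "ext_chain S K A" using 2(5) by (rule ext_chain_ConsE)
  obtain K' P' where s': "ses K' i' P' p' D'" "ext_chain S' K' A'" using 2(6) by (rule ext_chain_ConsE)
  obtain b\<^sub>\<alpha> k\<^sub>\<alpha> where \<alpha>: "b\<^sub>\<alpha> \<in> Hom E P P'" "k\<^sub>\<alpha> \<in> Hom E K K'"
    "p' \<cdot> b\<^sub>\<alpha> = d \<cdot> p" "b\<^sub>\<alpha> \<cdot> i = i' \<cdot> k\<^sub>\<alpha>" "ext_mor S S' a k\<^sub>\<alpha>"
    using 2(2) s(1) s'(1) by (rule ext_mor_ConsE)
  have dc: "d \<cdot> c \<in> Hom E C D'" using 2(7,8) by (simp add: Hom_iff)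
  obtain L j B q b k where \<rho>: "ses L j B q C" "b \<in> Hom E B P'" "k \<in> Hom E L K'"
    "p' \<cdot> b = (d \<cdot> c) \<cdot> q" "b \<cdot> j = i' \<cdot> k" "null A' S' k"
    using 2(4) dc s'(1) by (rule in_image_ConsE)
  note [simp] = sesD[OF s(1)] sesD[OF s'(1)] sesD[OF \<rho>(1)] \<alpha>(1,2)[unfolded Hom_iff]
    \<rho>(2,3)[unfolded Hom_iff] 2(7,8)[unfolded Hom_iff] sesD[OF 2(3)]
  have "c \<cdot> q \<in> Hom E B D" by (simp add: Hom_iff)
  obtain l B1 \<pi> e where e: "ses K l B1 \<pi> B" "e \<in> Hom E B1 P" "p \<cdot> e = (c \<cdot> q) \<cdot> \<pi>" "e \<cdot> l = i"
    "is_pullback E p (c \<cdot> q) e \<pi>"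
    using pullback_ses[OF s(1) \<open>c \<cdot> q \<in> _\<close>] .
  note [simp] = sesD[OF e(1)] e(2)[unfolded Hom_iff]
  \<comment> \<open>Both maps \<open>B1 \<rightarrow> P'\<close> lie over the same map to \<open>D'\<close>, so they differ by a map through \<open>K'\<close>.\<close>
  obtain v where v: "v \<in> Hom E B1 P'" "b\<^sub>\<alpha> \<cdot> e = b \<cdot> \<pi> \<boxplus> v"
    using add_diff_arr[of "b\<^sub>\<alpha> \<cdot> e" B1 P' "b \<cdot> \<pi>"] by (auto simp: Hom_iff)
  note [simp] = v(1)[unfolded Hom_iff]
  have "p' \<cdot> (b\<^sub>\<alpha> \<cdot> e) = d \<cdot> (c \<cdot> (q \<cdot> \<pi>))" using e(3) by (simp add: comp_reduce[OF \<alpha>(3)])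
  moreover have "p' \<cdot> (b \<cdot> \<pi>) = d \<cdot> (c \<cdot> (q \<cdot> \<pi>))" by (simp add: comp_reduce[OF \<rho>(4)])
  moreover have "p' \<cdot> (b\<^sub>\<alpha> \<cdot> e) = p' \<cdot> (b \<cdot> \<pi>) \<boxplus> p' \<cdot> v" unfolding v(2) by simp
  ultimately have "p' \<cdot> v = Zero E B1 D'"
    by (intro add_cancel_zero[of "d \<cdot> (c \<cdot> (q \<cdot> \<pi>))"]) (auto simp: Hom_iff)
  then obtain t where t: "t \<in> Hom E B1 K'" "i' \<cdot> t = v" using kernel_lift[OF s'(1) v(1)] by blast
  note [simp] = t(1)[unfolded Hom_iff]
  \<comment> \<open>\<open>B'\<close> covers \<open>B1\<close> so finely that \<open>t\<close> lifts along \<open>\<delta>\<close>; \<open>y\<close> and \<open>z\<close> are the kernel maps.\<close>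
  have refine: "\<exists>Q j' B' q' e' y z u. ses Q j' B' q' C \<and> e' \<in> Hom E B' P \<and> y \<in> Hom E Q K \<and>
      z \<in> Hom E Q L \<and> u \<in> Hom E B' G' \<and> p \<cdot> e' = c \<cdot> q' \<and> e' \<cdot> j' = i \<cdot> y \<and>
      k\<^sub>\<alpha> \<cdot> y = k \<cdot> z \<boxplus> \<delta> \<cdot> (u \<cdot> j')" if \<delta>: "ses W w G' \<delta> K'" for W w G' \<delta>
  proof -
    obtain w' B' \<sigma> u where u: "ses W w' B' \<sigma> B1" "u \<in> Hom E B' G'" "\<delta> \<cdot> u = t \<cdot> \<sigma>" "u \<cdot> w' = w"
      "is_pullback E \<delta> t u \<sigma>"
      using pullback_ses[OF \<delta> t(1)] .
    obtain K1 u1 \<kappa>1 r1 where 1: "ses K1 u1 B1 (q \<cdot> \<pi>) C" "ses K r1 K1 \<kappa>1 L" "\<pi> \<cdot> u1 = j \<cdot> \<kappa>1"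
      using deflation_comp_ses[OF \<rho>(1) e(1)] .
    obtain Q j' \<kappa>2 r2 where j': "ses Q j' B' ((q \<cdot> \<pi>) \<cdot> \<sigma>) C" "ses W r2 Q \<kappa>2 K1" "\<sigma> \<cdot> j' = u1 \<cdot> \<kappa>2"
      using deflation_comp_ses[OF 1(1) u(1)] .
    note [simp] = sesD[OF \<delta>] sesD[OF u(1)] u(2)[unfolded Hom_iff] 
    note [simp] = sesD(1-9)[OF 1(1)] sesD(1-9)[OF j'(1)]
    have z0: "q \<cdot> (\<pi> \<cdot> (\<sigma> \<cdot> j')) = Zero E Q C" using sesD(10)[OF j'(1)] by simp
    then obtain z where z: "z \<in> Hom E Q L" "j \<cdot> z = \<pi> \<cdot> (\<sigma> \<cdot> j')"
      using kernel_lift[OF \<rho>(1), of "\<pi> \<cdot> (\<sigma> \<cdot> j')" Q] by (auto simp: Hom_iff)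
    have "p \<cdot> (e \<cdot> (\<sigma> \<cdot> j')) = Zero E Q D" by (simp add: comp_reduce[OF e(3)] z0)
    then obtain y where y: "y \<in> Hom E Q K" "i \<cdot> y = e \<cdot> (\<sigma> \<cdot> j')"
      using kernel_lift[OF s(1), of "e \<cdot> (\<sigma> \<cdot> j')" Q] by (auto simp: Hom_iff)
    note [simp] = z(1)[unfolded Hom_iff] y(1)[unfolded Hom_iff]
    have "i' \<cdot> (k\<^sub>\<alpha> \<cdot> y) = b\<^sub>\<alpha> \<cdot> (i \<cdot> y)" by (simp add: comp_reduce[OF \<alpha>(4)])
    also have "\<dots> = (b\<^sub>\<alpha> \<cdot> e) \<cdot> (\<sigma> \<cdot> j')" by (simp add: y(2))
    also have "\<dots> = b \<cdot> (j \<cdot> z) \<boxplus> i' \<cdot> (t \<cdot> (\<sigma> \<cdot> j'))"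
      unfolding v(2) t(2)[symmetric] z(2) by simp
    also have "\<dots> = i' \<cdot> (k \<cdot> z \<boxplus> \<delta> \<cdot> (u \<cdot> j'))"
      by (simp add: comp_reduce[OF \<rho>(5)] comp_reduce[OF u(3)])
    finally have "k\<^sub>\<alpha> \<cdot> y = k \<cdot> z \<boxplus> \<delta> \<cdot> (u \<cdot> j')"
      using inflation_mono[OF s'(1), of "k\<^sub>\<alpha> \<cdot> y" Q "k \<cdot> z \<boxplus> \<delta> \<cdot> (u \<cdot> j')"] by (simp add: Hom_iff)
    moreover have "p \<cdot> (e \<cdot> \<sigma>) = c \<cdot> ((q \<cdot> \<pi>) \<cdot> \<sigma>)" by (simp add: comp_reduce[OF e(3)])
    moreover have "(e \<cdot> \<sigma>) \<cdot> j' = i \<cdot> y" by (simp add: y(2))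
    moreover have "e \<cdot> \<sigma> \<in> Hom E B' P" by (simp add: Hom_iff)
    ultimately show ?thesis using j'(1) y(1) z(1) u(2) by blast
  qed
  show ?case
  proof (cases S')
    case Nil
    then have "S = []" using ext_mor_length[OF \<alpha>(5)] by simp
    have [simp]: "K' = A'" "K = A" using s(2) s'(2) Nil \<open>S = []\<close> by auto
    have [simp]: "k\<^sub>\<alpha> = a" using \<alpha>(5) Nil \<open>S = []\<close> by simp
    have k: "k = Zero E L A'" using \<rho>(6) Nil null_Nil[OF \<rho>(3)] by simp
    obtain Q j' B' q' e' y z u where *: "ses Q j' B' q' C" "e' \<in> Hom E B' P" "y \<in> Hom E Q K"
      "z \<in> Hom E Q L" "u \<in> Hom E B' A" "p \<cdot> e' = c \<cdot> q'" "e' \<cdot> j' = i \<cdot> y"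
      "k\<^sub>\<alpha> \<cdot> y = k \<cdot> z \<boxplus> a \<cdot> (u \<cdot> j')"
      using refine[of G g A a] 2(3) by auto
    note [simp] = sesD[OF *(1)] *(2-5)[unfolded Hom_iff]
    have ay: "a \<cdot> y = a \<cdot> (u \<cdot> j')" using *(8) k by simp
    obtain y' where y': "y' \<in> Hom E Q A" "y = u \<cdot> j' \<boxplus> y'"
      using add_diff_arr[of y Q A "u \<cdot> j'"] by (auto simp: Hom_iff)
    note [simp] = y'(1)[unfolded Hom_iff]
    have "a \<cdot> (u \<cdot> j') = a \<cdot> (u \<cdot> j') \<boxplus> a \<cdot> y'" using ay unfolding y'(2) by simp
    then have "a \<cdot> y' = Zero E Q A'"
      by (intro add_cancel_zero[of "a \<cdot> (u \<cdot> j')"]) (auto simp: Hom_iff)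
    then obtain x where x: "x \<in> Hom E Q G" "g \<cdot> x = y'" using kernel_lift[OF 2(3) y'(1)] by blast
    note [simp] = x(1)[unfolded Hom_iff]
    obtain e'' where e'': "e'' \<in> Hom E B' P" "e' = i \<cdot> u \<boxplus> e''"
      using add_diff_arr[of e' B' P "i \<cdot> u"] by (auto simp: Hom_iff)
    note [simp] = e''(1)[unfolded Hom_iff]
    have "p \<cdot> e'' = c \<cdot> q'" using *(6) unfolding e''(2) 
      by (simp add: comp_reduce[OF sesD(10)[OF s(1)]])
    moreover have "e'' \<cdot> j' = i \<cdot> y'"
    proof (rule add_left_cancel[of "i \<cdot> (u \<cdot> j')" Q P])
      show "i \<cdot> (u \<cdot> j') \<boxplus> e'' \<cdot> j' = i \<cdot> (u \<cdot> j') \<boxplus> i \<cdot> y'"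
        using *(7) unfolding e''(2) y'(2) by simp
    qed (auto simp: Hom_iff)
    moreover have "in_image g S y'" using x \<open>S = []\<close> in_image_Nil[OF y'(1), of g G A]
      by (auto simp: Hom_iff)
    ultimately show ?thesis
      using in_image_ConsI[OF *(1) 2(7) s(1) e''(1), of y' g S] by (simp add: Hom_iff)
  next
    case (Cons x T)
    obtain l m where x: "x = (l, m)" by fastforce
    obtain W G' where W: "ses W l G' m K'"
      using s'(2) unfolding Cons x by (rule ext_chain_ConsE)
    obtain Q j' B' q' e' y z u where *: "ses Q j' B' q' C" "e' \<in> Hom E B' P" "y \<in> Hom E Q K"
      "z \<in> Hom E Q L" "u \<in> Hom E B' G'" "p \<cdot> e' = c \<cdot> q'" "e' \<cdot> j' = i \<cdot> y"
      "k\<^sub>\<alpha> \<cdot> y = k \<cdot> z \<boxplus> m \<cdot> (u \<cdot> j')"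
      using refine[OF W] by blast
    note [simp] = sesD[OF *(1)] *(2-5)[unfolded Hom_iff]
    have Z: "Zero E A' A' \<in> Hom E A' A'" by (simp add: Hom_iff)
    have "null A' S' (k \<cdot> z)"
      by (rule in_image_precomp[OF \<rho>(6) s'(2) Z \<rho>(3) *(4)])
    then have "null A' S' (k\<^sub>\<alpha> \<cdot> y)" unfolding *(8) Cons x
      by (rule in_image_add_boundary[OF _ W]) (auto simp: Hom_iff)
    then have "in_image g S y"
      by (rule 2(1)[OF \<alpha>(5) 2(3) _ s(2) s'(2) *(3) \<alpha>(2)])
    then show ?thesis by (rule in_image_ConsI[OF *(1) 2(7) s(1) *(2,3,6,7)])
  qed
qed auto

text \<open>
  Pushing out the leftmost conflation along \<open>a\<close>.  The universal property of the pushout is recorded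
  because it turns a morphism from \<open>S\<close> whose left end factors through \<open>a\<close> into one from the pushout.
\<close>

lemma ext_pushforward:
  assumes "S \<noteq> []" "ext_chain S C A" "a \<in> Hom E A A'"
  shows "\<exists>S'. ext_chain S' C A' \<and> length S' = length S \<and> ext_mor S S' a (Id E C) \<and>
    (\<forall>R D T x d. ext_chain R D T \<longrightarrow> x \<in> Hom E A' T \<longrightarrow> d \<in> Hom E C D \<longrightarrow>
       ext_mor S R (x \<cdot> a) d \<longrightarrow> ext_mor S' R x d)"
  using assms(1,2)
proof (induction S arbitrary: C)
  case (Cons y S)
  obtain i p where y: "y = (i, p)" by fastforce
  obtain K P where s: "ses K i P p C" "ext_chain S K A"
    using Cons.prems(2) unfolding y by (rule ext_chain_ConsE)
  note [simp] = sesD[OF s(1)] assms(3)[unfolded Hom_iff]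
  show ?case
  proof (cases "S = []")
    case True
    then have [simp]: "K = A" using s(2) by simp
    have a: "a \<in> Hom E K A'" using assms(3) by simp
    obtain i' P' p' e where e: "ses A' i' P' p' C" "e \<in> Hom E P P'" "e \<cdot> i = i' \<cdot> a" "p' \<cdot> e = p"
      "is_pushout E i a e i'"
      using pushout_ses[OF s(1) a] .
    note [simp] = sesD[OF e(1)] e(2)[unfolded Hom_iff]
    have "ext_mor [(i, p)] [(i', p')] a (Id E C)"
      by (rule ext_mor_ConsI[OF s(1) e(1), of e a]) (use e in \<open>auto simp: Hom_iff\<close>)
    moreover have "ext_mor [(i', p')] R x d"
      if R: "ext_chain R D T" and x: "x \<in> Hom E A' T" and d: "d \<in> Hom E C D"
        and m: "ext_mor [(i, p)] R (x \<cdot> a) d" for R D T x d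
    proof -
      obtain z where "R = [z]" using ext_mor_length[OF m] by (cases R) auto
      then obtain j q where jq: "R = [(j, q)]" by (cases z) auto
      obtain Q where t: "ses T j Q q D" using R unfolding jq by (auto dest: sesD(5))
      obtain b k where b: "b \<in> Hom E P Q" "k \<in> Hom E K T" "q \<cdot> b = d \<cdot> p" "b \<cdot> i = j \<cdot> k"
        "ext_mor [] [] (x \<cdot> a) k"
        using m[unfolded jq] s(1) t by (rule ext_mor_ConsE)
      note [simp] = sesD[OF t] b(1)[unfolded Hom_iff] x[unfolded Hom_iff] d[unfolded Hom_iff]
      have k: "k = x \<cdot> a" using b(5) by simp
      obtain w where w: "w \<in> Hom E P' Q" "w \<cdot> e = b" "w \<cdot> i' = j \<cdot> x"
        using pushout_desc[OF e(5), of b Q "j \<cdot> x"] b(4) k by (auto simp: Hom_iff)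
      note [simp] = w(1)[unfolded Hom_iff]
      have "q \<cdot> w = d \<cdot> p'"
        by (rule pushout_unique[OF e(5), of _ D])
          (use b w e in \<open>auto simp: Hom_iff comp_reduce[OF sesD(10)[OF t]]\<close>)
      then show ?thesis unfolding jq
        by (intro ext_mor_ConsI[OF e(1) t, of w x]) (use w in \<open>auto simp: Hom_iff\<close>)
    qed
    ultimately show ?thesis using True y e(1)
      by (intro exI[of _ "[(i', p')]"]) auto
  next
    case False
    obtain S' where S': "ext_chain S' K A'" "length S' = length S" "ext_mor S S' a (Id E K)"
      "\<And>R D T x d. ext_chain R D T \<Longrightarrow> x \<in> Hom E A' T \<Longrightarrow> d \<in> Hom E K D \<Longrightarrow>
         ext_mor S R (x \<cdot> a) d \<Longrightarrow> ext_mor S' R x d"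
      using Cons.IH[OF False s(2)] by blast
    have "ext_mor ((i, p) # S) ((i, p) # S') a (Id E C)"
      by (rule ext_mor_ConsI[OF s(1) s(1), of "Id E P" "Id E K"])
        (use S' in \<open>auto simp: Hom_iff\<close>)
    moreover have "ext_mor ((i, p) # S') R x d"
      if R: "ext_chain R D T" and x: "x \<in> Hom E A' T" and d: "d \<in> Hom E C D"
        and m: "ext_mor ((i, p) # S) R (x \<cdot> a) d" for R D T x d
    proof -
      obtain j q R' where jq: "R = (j, q) # R'" using ext_mor_length[OF m] by (cases R) auto
      obtain L Q where t: "ses L j Q q D" "ext_chain R' L T"
        using R unfolding jq by (rule ext_chain_ConsE)
      obtain b k where b: "b \<in> Hom E P Q" "k \<in> Hom E K L" "q \<cdot> b = d \<cdot> p" "b \<cdot> i = j \<cdot> k"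
        "ext_mor S R' (x \<cdot> a) k"
        using m[unfolded jq] s(1) t(1) by (rule ext_mor_ConsE)
      show ?thesis unfolding jq
        by (rule ext_mor_ConsI[OF s(1) t(1) b(1-4) S'(4)[OF t(2) x b(2,5)]])
    qed
    moreover have "ext_chain ((i, p) # S') C A'" by (rule ext_chain_ConsI[OF s(1) S'(1)])
    ultimately show ?thesis using S'(2) unfolding y
      by (intro exI[of _ "(i, p) # S'"]) auto
  qed
qed simp

lemma ext_pullback:
  assumes "S \<noteq> []" "ext_chain S D A" "c \<in> Hom E C D"
  obtains S' where "ext_chain S' C A" "length S' = length S" "ext_mor S' S (Id E A) c"
proof -
  obtain i p T where S: "S = (i, p) # T" using assms(1) by (cases S) auto
  obtain K P where s: "ses K i P p D" "ext_chain T K A"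
    using assms(2) unfolding S by (rule ext_chain_ConsE)
  obtain i' P' p' b where b: "ses K i' P' p' C" "b \<in> Hom E P' P" "p \<cdot> b = c \<cdot> p'" "b \<cdot> i' = i"
    "is_pullback E p c b p'"
    using pullback_ses[OF s(1) assms(3)] .
  have "ext_mor ((i', p') # T) S (Id E A) c" unfolding S
    by (rule ext_mor_ConsI[OF b(1) s(1) b(2) _ b(3) _ ext_mor_refl[OF s(2)]])
      (use b(4) sesD[OF s(1)] in \<open>auto simp: Hom_iff\<close>)
  then show ?thesis using that[OF ext_chain_ConsI[OF b(1) s(2)]] S by simp
qed

lemma null_ext_mor_iff:
  assumes "ext_mor S S' (Id E A) d" "ext_chain S D A" "ext_chain S' D' A" "d \<in> Hom E D D'"
    "c \<in> Hom E C D"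
  shows "null A S' (d \<cdot> c) \<longleftrightarrow> null A S c"
proof -
  have A: "A \<in> Obj E" using ext_chain_Obj[OF assms(2)] by simp
  obtain Z where Z: "zero_object E Z" using zero_object_ex by blast
  note [simp] = A zero_object_arr(1)[OF Z]
  show ?thesis
  proof
    assume "null A S' (d \<cdot> c)"
    then have "in_image (Zero E Z A) S c"
      by (rule in_image_kernel[OF assms(1) ses_Id[OF Z A] _ assms(2,3,5,4)])
    then have "in_image (Zero E A A \<cdot> Zero E Z A) S c" by simp
    then show "null A S c"
      by (rule in_image_mono[OF _ assms(2) _ _ assms(5)]) (auto simp: Hom_iff)
  next
    assume "null A S c"
    then have "in_image (Id E A \<cdot> Zero E A A) S' (d \<cdot> c)"
      by (rule in_image_push[OF assms(1) _ assms(2,3) _ assms(5,4)]) (auto simp: Hom_iff)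
    then show "null A S' (d \<cdot> c)" by simp
  qed
qed

section \<open>Exactness of Ext in the second argument\<close>

text \<open>
  The vanishing of \<open>Ext\<^sup>m(C, A)\<close> for \<open>m \<ge> 1\<close>; the link with Yoneda classes is \<open>Ext_vanishes_iff\<close>.
\<close>

definition ext_null :: "nat \<Rightarrow> 'o \<Rightarrow> 'o \<Rightarrow> bool" where
  "ext_null m C A \<longleftrightarrow> (\<forall>S. ext_chain S C A \<and> length S = m \<longrightarrow> null A S (Id E C))"

lemma ext_nullD:
  assumes "ext_null (length S) C A" "S \<noteq> []" "ext_chain S D A" "c \<in> Hom E C D"
  shows "null A S c"
proof -
  obtain S' where S': "ext_chain S' C A" "length S' = length S" "ext_mor S' S (Id E A) c"
    using ext_pullback[OF assms(2-4)] .
  have C: "C \<in> Obj E" using assms(4) Hom_Obj by blast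
  have "null A S' (Id E C)" using assms(1) S' unfolding ext_null_def by simp
  then have "null A S (c \<cdot> Id E C)"
    using null_ext_mor_iff[OF S'(3,1) assms(3,4), of "Id E C" C] C by (simp add: Hom_iff)
  then show ?thesis using assms(4) by (simp add: Hom_iff)
qed

text \<open>
  By \<open>null_snoc\<close> a class killed by the connecting map \<open>Ext\<^sup>m(C, K) \<rightarrow> Ext\<^sup>m\<^sup>+\<^sup>1(C, A)\<close> comes from
  \<open>Ext\<^sup>m(C, B) = 0\<close>.
\<close>

lemma null_drop_left_conflation:
  assumes "ext_null (length S) C B" "S \<noteq> []" "ses A i B p K" "ext_chain S D K" "c \<in> Hom E C D"
    "null A (S @ [(i, p)]) c"
  shows "null K S c"
proof -
  note [simp] = sesD[OF assms(3)] Hom_Obj[OF assms(5)] assms(5)[unfolded Hom_iff]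
  have p: "p \<in> Hom E B K" by (simp add: Hom_iff)
  have "in_image p S c" using null_snoc[OF assms(4,3,5)] assms(6) by simp
  then obtain S' where S': "ext_chain S' C B" "length S' = length S" "ext_mor S' S p c"
    using in_image_obtain_ext[OF _ assms(2,4) p assms(5)] by blast
  have "null B S' (Id E C)" using assms(1) S' unfolding ext_null_def by simp
  then have "in_image (p \<cdot> Zero E B B) S (c \<cdot> Id E C)"
    by (rule in_image_push[OF S'(3) _ S'(1) assms(4)]) (auto simp: Hom_iff)
  then have "in_image (Zero E K K \<cdot> Zero E B K) S c" by simp
  then show ?thesis by (rule in_image_mono[OF _ assms(4) _ _ assms(5)]) (auto simp: Hom_iff)
qed

lemma null_single:
  assumes "ses A i B p C" "c \<in> Hom E N C"
  shows "null A [(i, p)] c \<longleftrightarrow> (\<exists>x \<in> Hom E N B. p \<cdot> x = c)"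
  using null_snoc[of "[]" C C A i B p c N] in_image_Nil[OF assms(2), of p B C] assms sesD[OF assms(1)]
  by (simp add: Hom_iff)

lemma ext_null_deflation_codomain:
  assumes "ext_null (Suc m) N A" "ext_null m N B" "ses A i B p C" "m \<ge> 1"
  shows "ext_null m N C"
  unfolding ext_null_def
proof (intro allI impI, elim conjE)
  fix S assume S: "ext_chain S N C" "length S = m"
  have N: "N \<in> Obj E" using ext_chain_Obj[OF S(1)] by simp
  have "ext_chain (S @ [(i, p)]) N A" unfolding ext_chain_append
    using S(1) assms(3) sesD[OF assms(3)] by auto
  then have "null A (S @ [(i, p)]) (Id E N)"
    using assms(1) S(2) unfolding ext_null_def by simp
  then show "null C S (Id E N)"
    using null_drop_left_conflation[of S N B A i p C N "Id E N"] assms(2-4) S N by (cases S) (auto simp: Hom_iff)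
qed

lemma ext_null_middle_term:
  assumes "ext_null m N A" "ext_null m N C" "ses A i B p C" "m \<ge> 1"
  shows "ext_null m N B"
  unfolding ext_null_def
proof (intro allI impI, elim conjE)
  fix S assume S: "ext_chain S N B" "length S = m"
  have N: "N \<in> Obj E" using ext_chain_Obj[OF S(1)] by simp
  note [simp] = sesD[OF assms(3)] N
  have ip: "p \<in> Hom E B C" "i \<in> Hom E A B" "Id E N \<in> Hom E N N" by (auto simp: Hom_iff)
  have S0: "S \<noteq> []" using S(2) assms(4) by auto
  obtain S' where S': "ext_chain S' N C" "length S' = length S" "ext_mor S S' p (Id E N)"
    using ext_pushforward[OF S0 S(1) ip(1)] by blast
  have "null C S' (Id E N)" using assms(2) S' S(2) unfolding ext_null_def by simp
  then have "in_image i S (Id E N)"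
    using in_image_kernel[OF S'(3) assms(3) _ S(1) S'(1) ip(3) ip(3)] by simp
  then obtain R where R: "ext_chain R N A" "length R = length S" "ext_mor R S i (Id E N)"
    using in_image_obtain_ext[OF _ S0 S(1) ip(2,3)] by blast
  have "null A R (Id E N)" using assms(1) R S(2) unfolding ext_null_def by simp
  then have "in_image (i \<cdot> Zero E A A) S (Id E N \<cdot> Id E N)"
    by (rule in_image_push[OF R(3) _ R(1) S(1) _ ip(3,3,2)]) (auto simp: Hom_iff)
  then have "in_image (Zero E B B \<cdot> Zero E A B) S (Id E N)" by simp
  then show "null B S (Id E N)"
    by (rule in_image_mono[OF _ S(1) _ _ ip(3)]) (auto simp: Hom_iff)
qed

text \<open>
  Vanishing of \<open>Ext\<^sup>m\<^sup>+\<^sup>1\<close> passes from \<open>B\<close> to \<open>A\<close> when \<open>Ext\<^sup>m(N, C) = 0\<close>, where for \<open>m = 0\<close> the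
  condition is that \<open>Hom(N, B) \<rightarrow> Hom(N, C)\<close> is onto.  Let \<open>A \<rightarrow> F \<rightarrow> L\<close> be the leftmost conflation
  of an extension of \<open>N\<close> by \<open>A\<close>, and push it out to \<open>B \<rightarrow> P \<rightarrow> L\<close>; then \<open>F \<rightarrow> P \<rightarrow> C\<close> is a conflation.
  By assumption the remaining extension of \<open>N\<close> by \<open>L\<close> comes from one by \<open>P\<close>, and the obstruction
  to its coming from one by \<open>F\<close> lies in \<open>Ext\<^sup>m(N, C)\<close>.
\<close>

lemma ext_null_inflation_domain:
  assumes lift: "if m = 0 then \<forall>c \<in> Hom E N C. \<exists>x \<in> Hom E N B. p \<cdot> x = c else ext_null m N C"
    and "ext_null (Suc m) N B" "ses A i B p C"
  shows "ext_null (Suc m) N A"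
  unfolding ext_null_def
proof (intro allI impI, elim conjE)
  fix S assume S: "ext_chain S N A" "length S = Suc m"
  have N: "N \<in> Obj E" using ext_chain_Obj[OF S(1)] by simp
  then have IdN: "Id E N \<in> Hom E N N" by (simp add: Hom_iff)
  obtain S1 z where "S = S1 @ [z]" using S(2) by (cases S rule: rev_cases) auto
  then obtain j q where jq: "S = S1 @ [(j, q)]" by (cases z) auto
  have m: "length S1 = m" using S(2) jq by simp
  obtain L where L: "ext_chain S1 N L" "ext_chain [(j, q)] L A"
    using S(1) unfolding jq ext_chain_append by blast
  obtain F where F: "ses A j F q L" using L(2) by (auto dest: sesD(5))
  obtain j' e P q' p' where P: "ses B j' P q' L" "ses F e P p' C" "e \<cdot> j = j' \<cdot> i" "q' \<cdot> e = q"
    "p' \<cdot> j' = p"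
    using pushout_ses2[OF F assms(3)] .
  note [simp] = sesD[OF P(1)] sesD[OF P(2)] sesD[OF F] sesD[OF assms(3)] N
  have "ext_chain (S1 @ [(j', q')]) N B"
    unfolding ext_chain_append using L(1) P(1) by auto
  then have "null B (S1 @ [(j', q')]) (Id E N)"
    using assms(2) m unfolding ext_null_def by simp
  then have im: "in_image q' S1 (Id E N)" using null_snoc[OF L(1) P(1) IdN] by simp
  have q': "q' \<in> Hom E P L" and p': "p' \<in> Hom E P C" by (auto simp: Hom_iff)
  have "in_image q S1 (Id E N)"
  proof (cases "m = 0")
    case True
    then have [simp]: "L = N" and S1: "S1 = []" using L(1) m by auto
    obtain s where s: "s \<in> Hom E N P" "q' \<cdot> s = Id E N"
      using im S1 in_image_Nil[OF IdN q'[simplified]] by auto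
    note [simp] = s(1)[unfolded Hom_iff]
    obtain x where x: "x \<in> Hom E N B" "p \<cdot> x = p' \<cdot> s"
    proof -
      have "p' \<cdot> s \<in> Hom E N C" by (simp add: Hom_iff)
      then show ?thesis using lift True that by auto
    qed
    note [simp] = x(1)[unfolded Hom_iff]
    obtain u where u: "u \<in> Hom E N P" "s = j' \<cdot> x \<boxplus> u"
      using add_diff_arr[of s N P "j' \<cdot> x"] by (auto simp: Hom_iff)
    note [simp] = u(1)[unfolded Hom_iff]
    have "p' \<cdot> s = p' \<cdot> s \<boxplus> p' \<cdot> u"
      using x(2) unfolding u(2) by (simp add: comp_reduce[OF P(5)])
    then have "p' \<cdot> u = Zero E N C" by (intro add_cancel_zero[of "p' \<cdot> s"]) (auto simp: Hom_iff)
    then obtain y where y: "y \<in> Hom E N F" "e \<cdot> y = u" using kernel_lift[OF P(2) u(1)] by blast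
    note [simp] = y(1)[unfolded Hom_iff]
    have "q' \<cdot> (j' \<cdot> x) = Zero E N N" using sesD(10)[OF P(1)] comp_reduce[OF sesD(10)[OF P(1)], of x]
      by simp
    then have "q' \<cdot> u = Id E N" using s(2) unfolding u(2) by simp
    then have "q \<cdot> y = Id E N" using y(2) P(4) comp_reduce[OF P(4), of y] by simp
    then show ?thesis using y(1) S1 in_image_Nil[OF IdN, of q F N] by (auto simp: Hom_iff)
  next
    case False
    then have S1: "S1 \<noteq> []" using m by auto
    obtain R where R: "ext_chain R N P" "length R = length S1" "ext_mor R S1 q' (Id E N)"
      using in_image_obtain_ext[OF im S1 L(1) q' IdN] by blast
    have R0: "R \<noteq> []" using R(2) S1 by auto
    obtain R' where R': "ext_chain R' N C" "length R' = length R" "ext_mor R R' p' (Id E N)"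
      using ext_pushforward[OF R0 R(1) p'] by blast
    have "null C R' (Id E N)" using lift False R' R m unfolding ext_null_def by simp
    then have "in_image e R (Id E N)"
      using in_image_kernel[OF R'(3) P(2) _ R(1) R'(1) IdN IdN] by simp
    then have "in_image (q' \<cdot> e) S1 (Id E N \<cdot> Id E N)"
      by (rule in_image_push[OF R(3) _ R(1) L(1) _ IdN IdN q']) (simp add: Hom_iff)
    then show ?thesis using P(4) by simp
  qed
  then show "null A S (Id E N)" using null_snoc[OF L(1) F IdN] unfolding jq by simp
qed

section \<open>Acyclic sequences and Yoneda equivalence\<close>

fun seq_of :: "('m \<times> 'm) list \<Rightarrow> 'm list" where
  "seq_of [] = []"
| "seq_of ((i, p) # S) = (if S = [] then [i, p] else seq_splice E (seq_of S) [i, p])"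

lemma seq_of_Cons:
  "S \<noteq> [] \<Longrightarrow> seq_of ((i, p) # S) = butlast (seq_of S) @ [i \<cdot> last (seq_of S), p]"
  by (simp add: seq_splice_def)

lemma length_seq_of: "S \<noteq> [] \<Longrightarrow> length (seq_of S) = Suc (length S)"
  by (induction S rule: seq_of.induct) (auto simp: seq_splice_def)

lemma last_seq_of [simp]: "last (seq_of ((i, p) # S)) = p"
  by (simp add: seq_splice_def)

lemma hd_seq_of_Cons:
  assumes "S \<noteq> []"
  shows "hd (seq_of ((i, p) # S)) = hd (seq_of S)"
proof -
  have "length (seq_of S) \<ge> 2" using length_seq_of[OF assms] assms by (cases S) auto
  then obtain a b Y where "seq_of S = a # b # Y" by (cases "seq_of S" rule: remdups_adj.cases) auto
  then show ?thesis using seq_of_Cons[OF assms, of i p] by simp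
qed

lemma Dom_hd_seq_of: "S \<noteq> [] \<Longrightarrow> ext_chain S C A \<Longrightarrow> Dom E (hd (seq_of S)) = A"
proof (induction S arbitrary: C)
  case (Cons x S)
  obtain i p where x: "x = (i, p)" by fastforce
  show ?case
  proof (cases "S = []")
    case False
    then show ?thesis using Cons.IH[OF False] Cons.prems(2) hd_seq_of_Cons[OF False] unfolding x
      by auto
  qed (use Cons.prems(2) x in auto)
qed simp

lemma Cod_last_seq_of: "S \<noteq> [] \<Longrightarrow> ext_chain S C A \<Longrightarrow> Cod E (last (seq_of S)) = C"
proof (induction S arbitrary: C)
  case (Cons x S)
  obtain i p where x: "x = (i, p)" by fastforce
  show ?case using Cons.prems(2) unfolding x by (simp only: last_seq_of) (auto dest: sesD)
qed simp

lemma last_seq_of_Arr: "S \<noteq> [] \<Longrightarrow> ext_chain S C A \<Longrightarrow> last (seq_of S) \<in> Arr E"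
proof (induction S arbitrary: C)
  case (Cons x S)
  obtain i p where x: "x = (i, p)" by fastforce
  show ?case using Cons.prems(2) unfolding x by (simp only: last_seq_of) (auto dest: sesD)
qed simp

lemma acyclic_seq_of:
  "S \<noteq> [] \<Longrightarrow> ext_chain S C A \<Longrightarrow> acyclic_seq E (length S) (seq_of S)"
proof (induction S arbitrary: C)
  case (Cons x S)
  obtain i p where x: "x = (i, p)" by fastforce
  obtain K B where s: "ses K i B p C" "ext_chain S K A"
    using Cons.prems(2) unfolding x by (rule ext_chain_ConsE)
  have ip: "[i, p] \<in> {[i, p] | i p. (i, p) \<in> Confl E}" using ses_Confl[OF s(1)] by blast
  show ?case
  proof (cases "S = []")
    case True
    then show ?thesis unfolding acyclic_seq_def x using is_splicing.single[OF ip] by simp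
  next
    case False
    have "is_splicing E {[i, p] | i p. (i, p) \<in> Confl E} (Suc (length S)) (seq_splice E (seq_of S) [i, p])"
      by (rule is_splicing.splice[OF Cons.IH[OF False s(2), unfolded acyclic_seq_def] ip])
        (use Cod_last_seq_of[OF False s(2)] sesD[OF s(1)] in auto)
    then show ?thesis unfolding acyclic_seq_def x using False by simp
  qed
qed simp

lemma acyclic_seq_chain:
  assumes "acyclic_seq E k Y"
  shows "\<exists>S. S \<noteq> [] \<and> length S = k \<and> ext_chain S (Cod E (last Y)) (Dom E (hd Y)) \<and> Y = seq_of S"
  using assms unfolding acyclic_seq_def
proof (induction rule: is_splicing.induct)
  case (single Y)
  then obtain i p where Y: "Y = [i, p]" "(i, p) \<in> Confl E" by auto
  have s: "ses (Dom E i) i (Dom E p) p (Cod E p)" using Confl_ses[OF Y(2)] .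
  then have "ext_chain [(i, p)] (Cod E p) (Dom E i)" using ConflD[OF Y(2)] by simp
  then show ?case using Y(1) by (intro exI[of _ "[(i, p)]"]) auto
next
  case (splice k Y Z)
  then obtain i p where Z: "Z = [i, p]" "(i, p) \<in> Confl E" by auto
  obtain S where S: "S \<noteq> []" "length S = k" "ext_chain S (Cod E (last Y)) (Dom E (hd Y))"
    "Y = seq_of S"
    using splice.IH by blast
  have "ext_chain ((i, p) # S) (Cod E p) (Dom E (hd Y))"
    using Confl_ses[OF Z(2)] S(3) splice.hyps(3) Z(1) by simp
  moreover have YZ: "seq_splice E Y Z = seq_of ((i, p) # S)" using S(1,4) Z(1) by simp
  moreover have "last (seq_splice E Y Z) = p" unfolding YZ by (rule last_seq_of)
  moreover have "hd (seq_splice E Y Z) = hd Y"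
    unfolding YZ unfolding S(4) using hd_seq_of_Cons[OF S(1)] .
  ultimately show ?case using S(2) by (intro exI[of _ "(i, p) # S"]) auto
qed

lemma extensions_iff:
  "Y \<in> extensions E k C A \<longleftrightarrow> (\<exists>S. S \<noteq> [] \<and> length S = k \<and> ext_chain S C A \<and> Y = seq_of S)"
  unfolding extensions_def
  using acyclic_seq_chain[of k Y] acyclic_seq_of Dom_hd_seq_of Cod_last_seq_of by auto

lemma obj_at_Cons:
  assumes "ext_chain ((i, p) # S) C A" "S \<noteq> []"
  shows "t \<le> length S \<Longrightarrow> obj_at E (seq_of ((i, p) # S)) t = obj_at E (seq_of S) t"
    and "obj_at E (seq_of ((i, p) # S)) (Suc (length S)) = Dom E p"
    and "obj_at E (seq_of ((i, p) # S)) (Suc (Suc (length S))) = C"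
    and "obj_at E (seq_of S) (Suc (length S)) = Dom E i"
proof -
  obtain K B where s: "ses K i B p C" "ext_chain S K A" using assms(1) by (rule ext_chain_ConsE)
  have ne: "seq_of S \<noteq> []" using length_seq_of[OF assms(2)] by auto
  note [simp] = sesD[OF s(1)] seq_of_Cons[OF assms(2)] length_seq_of[OF assms(2)]
    last_seq_of_Arr[OF assms(2) s(2)] Cod_last_seq_of[OF assms(2) s(2)]
  show "obj_at E (seq_of S) (Suc (length S)) = Dom E i" by (simp add: obj_at_def)
  show "obj_at E (seq_of ((i, p) # S)) (Suc (length S)) = Dom E p"
    by (simp add: obj_at_def nth_append del: seq_of.simps)
  show "obj_at E (seq_of ((i, p) # S)) (Suc (Suc (length S))) = C"
    by (simp add: obj_at_def del: seq_of.simps)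
  show "obj_at E (seq_of ((i, p) # S)) t = obj_at E (seq_of S) t" if "t \<le> length S"
  proof (cases "t = length S")
    case True
    then have "obj_at E (seq_of ((i, p) # S)) t = Dom E (last (seq_of S))"
      by (simp add: obj_at_def nth_append del: seq_of.simps)
    then show ?thesis using ne True by (simp add: obj_at_def last_conv_nth del: seq_of.simps)
  next
    case False
    then show ?thesis using that
      by (simp add: obj_at_def nth_append nth_butlast del: seq_of.simps)
  qed
qed

lemma nth_seq_of_Cons:
  assumes "S \<noteq> []"
  shows "t < length S \<Longrightarrow> seq_of ((i, p) # S) ! t = seq_of S ! t"
    and "seq_of ((i, p) # S) ! length S = i \<cdot> seq_of S ! length S"
    and "seq_of ((i, p) # S) ! Suc (length S) = p"
proof -
  have ne: "seq_of S \<noteq> []" using length_seq_of[OF assms] by auto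
  note [simp] = seq_of_Cons[OF assms] length_seq_of[OF assms]
  show "seq_of ((i, p) # S) ! t = seq_of S ! t" if "t < length S"
    using that by (simp add: nth_append nth_butlast del: seq_of.simps)
  show "seq_of ((i, p) # S) ! length S = i \<cdot> seq_of S ! length S"
    using ne by (simp add: nth_append last_conv_nth del: seq_of.simps)
  show "seq_of ((i, p) # S) ! Suc (length S) = p"
    by (simp add: nth_append del: seq_of.simps)
qed

text \<open>
  A chain map induces maps of the kernels, because these are kernels of the deflations; together with
  its converse below this identifies chain maps with morphisms of chains of conflations.
\<close>

lemma chain_map_imp_ext_mor:
  assumes "chain_map E (seq_of R) (seq_of S) f" "R \<noteq> []" "length R = length S"
    "ext_chain R C A" "ext_chain S D B"
  shows "ext_mor R S (f 0) (f (Suc (length R)))"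
  using assms
proof (induction R arbitrary: S C D f)
  case (Cons x R)
  obtain i p where x: "x = (i, p)" by fastforce
  obtain j q S' where S: "S = (j, q) # S'" using Cons.prems(3) by (cases S) auto
  obtain K P where s: "ses K i P p C" "ext_chain R K A"
    using Cons.prems(4) unfolding x by (rule ext_chain_ConsE)
  obtain L Q where t: "ses L j Q q D" "ext_chain S' L B"
    using Cons.prems(5) unfolding S by (rule ext_chain_ConsE)
  note [simp] = sesD[OF s(1)] sesD[OF t(1)]
  have len: "length R = length S'" using Cons.prems(3) S by simp
  have cm: "\<And>n. n \<le> Suc (Suc (length R)) \<Longrightarrow>
        f n \<in> Hom E (obj_at E (seq_of ((i, p) # R)) n) (obj_at E (seq_of ((j, q) # S')) n)"
    "\<And>n. n < Suc (Suc (length R)) \<Longrightarrow>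
        f (Suc n) \<cdot> seq_of ((i, p) # R) ! n = seq_of ((j, q) # S') ! n \<cdot> f n"
    using Cons.prems(1) length_seq_of[of "(i, p) # R"] unfolding x S chain_map_def by auto
  show ?case
  proof (cases "R = []")
    case True
    then have S': "S' = []" using len by simp
    have "f 0 \<in> Hom E K L" "f 1 \<in> Hom E P Q" "f 2 \<in> Hom E C D"
      using cm(1)[of 0] cm(1)[of 1] cm(1)[of 2] True S' by (auto simp: obj_at_def)
    moreover have "f 1 \<cdot> i = j \<cdot> f 0" "f 2 \<cdot> p = q \<cdot> f 1"
      using cm(2)[of 0] cm(2)[of 1] True S' by (auto simp: numeral_2_eq_2)
    ultimately show ?thesis unfolding x S True S'
      by (intro ext_mor_ConsI[OF s(1) t(1), of "f 1" "f 0"]) (auto simp: numeral_2_eq_2)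
  next
    case False
    then have S': "S' \<noteq> []" using len by auto
    let ?m = "length R"
    note r = Cons.prems(4)[unfolded x] Cons.prems(5)[unfolded S]
    have b: "f (Suc ?m) \<in> Hom E P Q" and c: "f (Suc (Suc ?m)) \<in> Hom E C D"
      using cm(1)[of "Suc ?m"] cm(1)[of "Suc (Suc ?m)"] obj_at_Cons(2,3)[OF r(1) False]
        obj_at_Cons(2,3)[OF r(2) S'] len by (simp_all del: seq_of.simps)
    have f: "f n \<in> Hom E (obj_at E (seq_of R) n) (obj_at E (seq_of S') n)" if "n \<le> ?m" for n
      using cm(1)[of n] obj_at_Cons(1)[OF r(1) False, of n] obj_at_Cons(1)[OF r(2) S', of n] len that
      by (simp del: seq_of.simps)
    note nth = nth_seq_of_Cons[OF False, where i=i and p=p] nth_seq_of_Cons[OF S', where i=j and p=q]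
    have com: "f (Suc (Suc ?m)) \<cdot> p = q \<cdot> f (Suc ?m)"
        "f (Suc ?m) \<cdot> (i \<cdot> seq_of R ! ?m) = (j \<cdot> seq_of S' ! ?m) \<cdot> f ?m"
      using cm(2)[of "Suc ?m"] cm(2)[of ?m] nth(2,3,5,6) len by (simp_all del: seq_of.simps)
    have com3: "f (Suc n) \<cdot> seq_of R ! n = seq_of S' ! n \<cdot> f n" if "n < ?m" for n
      using cm(2)[of n] nth(1)[of n] nth(4)[of n] len that by (simp del: seq_of.simps)
    note [simp] = b[unfolded Hom_iff] c[unfolded Hom_iff]
    have "q \<cdot> (f (Suc ?m) \<cdot> i) = Zero E K D" by (simp add: comp_reduce[OF com(1)[symmetric]])
    then obtain k where k: "k \<in> Hom E K L" "j \<cdot> k = f (Suc ?m) \<cdot> i"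
      using kernel_lift[OF t(1), of "f (Suc ?m) \<cdot> i" K] by (auto simp: Hom_iff)
    note [simp] = k(1)[unfolded Hom_iff]
    have ne: "seq_of R \<noteq> []" "seq_of S' \<noteq> []"
      using length_seq_of[OF False] length_seq_of[OF S'] by auto
    have lR: "last (seq_of R) = seq_of R ! ?m" "last (seq_of S') = seq_of S' ! ?m"
      using ne length_seq_of[OF False] length_seq_of[OF S'] len by (auto simp: last_conv_nth)
    note [simp] = last_seq_of_Arr[OF False s(2), unfolded lR] last_seq_of_Arr[OF S' t(2), unfolded lR]
      Cod_last_seq_of[OF False s(2), unfolded lR] Cod_last_seq_of[OF S' t(2), unfolded lR]
    have fm: "f ?m \<in> Hom E (Dom E (seq_of R ! ?m)) (Dom E (seq_of S' ! ?m))"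
      using f[of ?m] length_seq_of[OF False] length_seq_of[OF S'] len by (auto simp: obj_at_def)
    note [simp] = fm[unfolded Hom_iff]
    have "j \<cdot> (k \<cdot> seq_of R ! ?m) = j \<cdot> (seq_of S' ! ?m \<cdot> f ?m)"
      using com(2) by (simp add: comp_reduce[OF k(2)])
    then have kc: "k \<cdot> seq_of R ! ?m = seq_of S' ! ?m \<cdot> f ?m"
      using inflation_mono[OF t(1), of "k \<cdot> seq_of R ! ?m" "Dom E (seq_of R ! ?m)"
          "seq_of S' ! ?m \<cdot> f ?m"] by (auto simp: Hom_iff)
    let ?f = "f(Suc ?m := k)"
    have "chain_map E (seq_of R) (seq_of S') ?f"
      unfolding chain_map_def length_seq_of[OF False] length_seq_of[OF S']
    proof (intro conjI allI impI)
      show "Suc (length R) = Suc (length S')" using len by simp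
      fix n assume n: "n \<le> Suc ?m"
      show "?f n \<in> Hom E (obj_at E (seq_of R) n) (obj_at E (seq_of S') n)"
        using n f[of n] k(1) obj_at_Cons(4)[OF r(1) False] obj_at_Cons(4)[OF r(2) S'] len
        by (cases "n = Suc ?m") (auto simp del: seq_of.simps)
    next
      fix n assume n: "n < Suc ?m"
      then show "?f (Suc n) \<cdot> seq_of R ! n = seq_of S' ! n \<cdot> ?f n"
        using kc com3[of n] by (cases "n = ?m") auto
    qed
    from Cons.IH[OF this False len s(2) t(2)] have "ext_mor R S' (f 0) k" by simp
    then show ?thesis unfolding x S
      by (intro ext_mor_ConsI[OF s(1) t(1) b k(1)]) (use com(1) k(2) in auto)
  qed
qed simp

lemma ext_mor_imp_chain_map:
  assumes "ext_mor R S a c" "R \<noteq> []" "ext_chain R C A" "ext_chain S D B" "c \<in> Hom E C D"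
  shows "\<exists>f. chain_map E (seq_of R) (seq_of S) f \<and> f 0 = a \<and> f (Suc (length R)) = c"
  using assms
proof (induction R S a c arbitrary: C D rule: ext_mor.induct)
  case (2 i p R j q S a c)
  obtain K P where s: "ses K i P p C" "ext_chain R K A"
    using 2(4) by (rule ext_chain_ConsE)
  obtain L Q where t: "ses L j Q q D" "ext_chain S L B"
    using 2(5) by (rule ext_chain_ConsE)
  obtain b k where b: "b \<in> Hom E P Q" "k \<in> Hom E K L" "q \<cdot> b = c \<cdot> p" "b \<cdot> i = j \<cdot> k"
    "ext_mor R S a k"
    using 2(2) s(1) t(1) by (rule ext_mor_ConsE)
  note [simp] = sesD[OF s(1)] sesD[OF t(1)] b(1,2)[unfolded Hom_iff] 2(6)[unfolded Hom_iff]
  have len: "length R = length S" using ext_mor_length[OF b(5)] .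
  show ?case
  proof (cases "R = []")
    case True
    then have [simp]: "R = []" "S = []" "a = k" using b(5) len by auto
    let ?f = "\<lambda>n. if n = 0 then k else if n = 1 then b else c"
    have "chain_map E (seq_of ((i, p) # R)) (seq_of ((j, q) # S)) ?f"
      using b(3,4) by (auto simp: chain_map_def obj_at_def Hom_iff less_Suc_eq le_Suc_eq)
    then show ?thesis by (intro exI[of _ ?f]) simp
  next
    case False
    then have S: "S \<noteq> []" using len by auto
    let ?m = "length R"
    obtain f where f: "chain_map E (seq_of R) (seq_of S) f" "f 0 = a" "f (Suc ?m) = k"
      using 2(1)[OF b(5) False s(2) t(2) b(2)] by blast
    let ?f = "f(Suc ?m := b, Suc (Suc ?m) := c)"
    have cm: "\<And>n. n \<le> Suc ?m \<Longrightarrow> f n \<in> Hom E (obj_at E (seq_of R) n) (obj_at E (seq_of S) n)"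
      "\<And>n. n < Suc ?m \<Longrightarrow> f (Suc n) \<cdot> seq_of R ! n = seq_of S ! n \<cdot> f n"
      using f(1) length_seq_of[OF False] unfolding chain_map_def by auto
    have ne: "seq_of R \<noteq> []" "seq_of S \<noteq> []"
      using length_seq_of[OF False] length_seq_of[OF S] by auto
    have lR: "last (seq_of R) = seq_of R ! ?m" "last (seq_of S) = seq_of S ! ?m"
      using ne length_seq_of[OF False] length_seq_of[OF S] len by (auto simp: last_conv_nth)
    note [simp] = last_seq_of_Arr[OF False s(2), unfolded lR] last_seq_of_Arr[OF S t(2), unfolded lR]
      Cod_last_seq_of[OF False s(2), unfolded lR] Cod_last_seq_of[OF S t(2), unfolded lR]
    have fm: "f ?m \<in> Hom E (Dom E (seq_of R ! ?m)) (Dom E (seq_of S ! ?m))"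
      using cm(1)[of ?m] length_seq_of[OF False] length_seq_of[OF S] len by (auto simp: obj_at_def)
    note [simp] = fm[unfolded Hom_iff]
    have "b \<cdot> (i \<cdot> seq_of R ! ?m) = j \<cdot> (seq_of S ! ?m \<cdot> f ?m)"
      using cm(2)[of ?m] f(3) by (simp add: comp_reduce[OF b(4)])
    then have bm: "b \<cdot> (i \<cdot> seq_of R ! ?m) = (j \<cdot> seq_of S ! ?m) \<cdot> f ?m" by simp
    have "chain_map E (seq_of ((i, p) # R)) (seq_of ((j, q) # S)) ?f"
      unfolding chain_map_def
    proof (intro conjI allI impI)
      show "length (seq_of ((i, p) # R)) = length (seq_of ((j, q) # S))"
        using length_seq_of[of "(i, p) # R"] length_seq_of[of "(j, q) # S"] len by simp
      fix n assume "n \<le> length (seq_of ((i, p) # R))"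
      then consider "n \<le> ?m" | "n = Suc ?m" | "n = Suc (Suc ?m)"
        using length_seq_of[of "(i, p) # R"] by fastforce
      then show "?f n \<in> Hom E (obj_at E (seq_of ((i, p) # R)) n) (obj_at E (seq_of ((j, q) # S)) n)"
        using cm(1)[of n] obj_at_Cons[OF 2(4) False] obj_at_Cons[OF 2(5) S] len b(1) 2(6)
        by cases (auto simp del: seq_of.simps)
    next
      fix n assume "n < length (seq_of ((i, p) # R))"
      then consider "n < ?m" | "n = ?m" | "n = Suc ?m"
        using length_seq_of[of "(i, p) # R"] by fastforce
      then show "?f (Suc n) \<cdot> seq_of ((i, p) # R) ! n = seq_of ((j, q) # S) ! n \<cdot> ?f n"
        using cm(2)[of n] nth_seq_of_Cons[OF False, where i=i and p=p]
          nth_seq_of_Cons[OF S, where i=j and p=q] len bm b(3)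
        by cases (auto simp del: seq_of.simps comp_assoc)
    qed
    moreover have "?f 0 = a" "?f (Suc (length ((i, p) # R))) = c" using f(2) by simp_all
    ultimately show ?thesis by blast
  qed
qed auto

lemma yoneda_step_iff:
  assumes "R \<noteq> []" "length R = k" "length S = k" "ext_chain R C A" "ext_chain S C A"
  shows "(seq_of R, seq_of S) \<in> yoneda_step E k C A \<longleftrightarrow> ext_mor R S (Id E A) (Id E C)"
proof -
  have "S \<noteq> []" using assms by auto
  then have "seq_of R \<in> extensions E k C A" "seq_of S \<in> extensions E k C A"
    unfolding extensions_iff using assms by blast+
  moreover have "Id E C \<in> Hom E C C" using ext_chain_Obj[OF assms(4)] by (simp add: Hom_iff)
  ultimately show ?thesis
    using chain_map_imp_ext_mor[OF _ assms(1) _ assms(4,5)] assms(2,3)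
      ext_mor_imp_chain_map[OF _ assms(1,4,5)]
    unfolding yoneda_step_def by (auto; metis)
qed

text \<open>
  Yoneda equivalence on chains of conflations, where it is visibly compatible with splicing, i.e. with
  concatenation.
\<close>

definition ext_step :: "'o \<Rightarrow> 'o \<Rightarrow> ('m \<times> 'm) list \<Rightarrow> ('m \<times> 'm) list \<Rightarrow> bool" where
  "ext_step C A R S \<longleftrightarrow> ext_chain R C A \<and> ext_chain S C A \<and>
     (ext_mor R S (Id E A) (Id E C) \<or> ext_mor S R (Id E A) (Id E C))"

abbreviation ext_equiv :: "'o \<Rightarrow> 'o \<Rightarrow> ('m \<times> 'm) list \<Rightarrow> ('m \<times> 'm) list \<Rightarrow> bool" where
  "ext_equiv C A \<equiv> (ext_step C A)\<^sup>*\<^sup>*"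

lemma ext_equiv_chain:
  "ext_equiv C A R S \<Longrightarrow> ext_chain R C A \<Longrightarrow> ext_chain S C A \<and> length S = length R"
  by (induction rule: rtranclp_induct) (auto simp: ext_step_def dest: ext_mor_length)

lemma ext_equiv_yoneda:
  assumes "ext_equiv C A R S" "ext_chain R C A" "R \<noteq> []"
  shows "(seq_of R, seq_of S) \<in> yoneda_rel E (length R) C A"
  using assms(1)
proof (induction rule: rtranclp_induct)
  case base
  then show ?case using assms(2,3) equiv_yoneda_rel[of E "length R" C A] extensions_iff
    unfolding equiv_def refl_on_def by blast
next
  case (step S T)
  have S: "ext_chain S C A" "length S = length R" using ext_equiv_chain[OF step(1) assms(2)] by auto
  have T: "ext_chain T C A" "length T = length R"
    using step(2) S unfolding ext_step_def by (auto dest: ext_mor_length)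
  have ne: "S \<noteq> []" "T \<noteq> []" using S T assms(3) by auto
  have "(seq_of S, seq_of T) \<in> yoneda_step E (length R) C A \<union> (yoneda_step E (length R) C A)\<inverse>"
    using step(2) yoneda_step_iff[OF ne(1) S(2) T(2) S(1) T(1)]
      yoneda_step_iff[OF ne(2) T(2) S(2) T(1) S(1)] unfolding ext_step_def by auto
  moreover have "seq_of T \<in> extensions E (length R) C A" using T ne extensions_iff by blast
  ultimately show ?case using step(3) unfolding yoneda_rel_def
    by (auto intro: rtrancl_into_rtrancl)
qed

text \<open>
  Several chains of conflations may have the same acyclic sequence, so the induction along the Yoneda
  equivalence carries its own chain; two chains with the same sequence are joined by a morphism with
  identities at both ends.
\<close>

lemma null_yoneda:
  assumes "(seq_of R, seq_of S) \<in> yoneda_rel E k C A" "ext_chain R C A" "ext_chain S C A"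
    "length R = k" "length S = k" "k \<ge> 1" "c \<in> Hom E N C" "null A R c"
  shows "null A S c"
proof -
  have C: "Id E C \<in> Hom E C C" "Id E C \<cdot> c = c"
    using ext_chain_Obj[OF assms(2)] assms(7) by (auto simp: Hom_iff)
  have ne: "R \<noteq> []" "S \<noteq> []" using assms by auto
  have inv: "null A T c \<longleftrightarrow> null A T' c"
    if "(seq_of T, seq_of T') \<in> yoneda_step E k C A" "T \<noteq> []" "length T = k" "length T' = k"
      "ext_chain T C A" "ext_chain T' C A" for T T'
    using null_ext_mor_iff[OF _ that(5,6) C(1) assms(7)] yoneda_step_iff[OF that(2-6)] that(1) C(2)
    by simp
  have "(seq_of R, seq_of S) \<in> (yoneda_step E k C A \<union> (yoneda_step E k C A)\<inverse>)\<^sup>*"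
    using assms(1) by (simp add: yoneda_rel_def)
  then have "\<exists>T. T \<noteq> [] \<and> length T = k \<and> ext_chain T C A \<and> seq_of S = seq_of T \<and> null A T c"
  proof (induction rule: rtrancl_induct)
    case base
    then show ?case using assms ne by blast
  next
    case (step Y Z)
    then obtain T where T: "T \<noteq> []" "length T = k" "ext_chain T C A" "Y = seq_of T" "null A T c"
      by blast
    have "Z \<in> extensions E k C A" using step(2) unfolding yoneda_step_def by auto
    then obtain T' where T': "T' \<noteq> []" "length T' = k" "ext_chain T' C A" "Z = seq_of T'"
      unfolding extensions_iff by blast
    have "null A T' c" using step(2) inv[of T T'] inv[of T' T] T T' by auto
    then show ?case using T' by blast
  qed
  then obtain T where T: "T \<noteq> []" "length T = k" "ext_chain T C A" "seq_of S = seq_of T" "null A T c"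
    by blast
  have "(seq_of T, seq_of S) \<in> yoneda_step E k C A"
    using yoneda_step_iff[OF ne(2) assms(5,5,3,3)] ext_mor_refl[OF assms(3)] T(4) by simp
  then show ?thesis using inv[of T S] T assms by blast
qed

text \<open>
  The extension is \<open>0 \<rightarrow> 0 \<rightarrow> \<dots> \<rightarrow> 0 \<rightarrow> C \<rightarrow> C\<close>.  It receives a morphism from any extension \<open>S\<close>
  of \<open>C\<close> by \<open>0\<close>: the deflation onto \<open>C\<close>, followed to the left by zero maps.
\<close>

lemma trivial_chain:
  assumes Z: "zero_object E Z" and "C \<in> Obj E" "m \<ge> 1"
  shows "\<exists>U. ext_chain U C Z \<and> length U = m \<and>
    (\<forall>S. ext_chain S C Z \<and> length S = m \<longrightarrow> ext_mor S U (Id E Z) (Id E C))"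
proof -
  note [simp] = zero_object_arr(1)[OF Z] assms(2)
  have IdZ: "Id E Z = Zero E Z Z" using zero_object_arr(2)[OF Z, of "Id E Z" Z] by (simp add: Hom_iff)
  let ?z = "(Zero E Z Z, Id E Z)"
  note sz = ses_Id[OF Z zero_object_arr(1)[OF Z]] and sC = ses_Id[OF Z assms(2)]
  have z: "ext_chain (replicate l ?z) Z Z" for l
    by (induction l) (use sz in simp_all)
  have mz: "ext_mor S (replicate (length S) ?z) (Id E Z) (Zero E Q Z)" if "ext_chain S Q Z" for S Q
    using that
  proof (induction S arbitrary: Q)
    case Nil
    then show ?case using IdZ by simp
  next
    case (Cons x S)
    obtain i p where x: "x = (i, p)" by fastforce
    obtain K P where s: "ses K i P p Q" "ext_chain S K Z"
      using Cons.prems unfolding x by (rule ext_chain_ConsE)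
    note [simp] = sesD[OF s(1)]
    show ?case unfolding x
      by (simp only: length_Cons replicate_Suc,
          rule ext_mor_ConsI[OF s(1) sz _ _ _ _ Cons.IH[OF s(2)], of "Zero E P Z"])
        (auto simp: Hom_iff IdZ)
  qed
  define U where "U = (Zero E Z C, Id E C) # replicate (m - 1) ?z"
  have "ext_chain U C Z" unfolding U_def by (rule ext_chain_ConsI[OF sC z])
  moreover have "length U = m" using assms(3) by (simp add: U_def)
  moreover have "ext_mor S U (Id E Z) (Id E C)" if S: "ext_chain S C Z" "length S = m" for S
  proof -
    obtain i p S' where x: "S = (i, p) # S'" using S(2) assms(3) by (cases S) auto
    obtain K P where s: "ses K i P p C" "ext_chain S' K Z"
      using S(1) unfolding x by (rule ext_chain_ConsE)
    note [simp] = sesD[OF s(1)]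
    have "length S' = m - 1" using S(2) x by simp
    then have m: "ext_mor S' (replicate (m - 1) ?z) (Id E Z) (Zero E K Z)" using mz[OF s(2)] by simp
    show ?thesis unfolding x U_def
      by (rule ext_mor_ConsI[OF s(1) sC _ _ _ _ m, of p]) (auto simp: Hom_iff)
  qed
  ultimately show ?thesis by blast
qed

text \<open>
  The reference point is the trivial extension \<open>W\<close>, the pushout along \<open>0 \<rightarrow> A\<close> of the extension \<open>U\<close>
  of \<open>C\<close> by \<open>0\<close>.  A null extension \<open>S\<close> receives a morphism from an extension \<open>S'\<close> of \<open>C\<close> by
  \<open>0\<close>; the pushout \<open>T\<close> of \<open>S'\<close> along \<open>0 \<rightarrow> A\<close> maps to \<open>S\<close> and, since \<open>S'\<close> maps to \<open>U\<close>, also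
  to \<open>W\<close>.  Conversely \<open>W\<close> is null and nullity is invariant.
\<close>

lemma Ext_vanishes_iff:
  assumes "C \<in> Obj E" "A \<in> Obj E" "m \<ge> 1"
  shows "Ext_vanishes E m C A \<longleftrightarrow> ext_null m C A"
proof -
  obtain Z where Z: "zero_object E Z" using zero_object_ex by blast
  note [simp] = assms(1,2) zero_object_arr(1)[OF Z]
  have IdC: "Id E C \<in> Hom E C C" and z: "Zero E Z A \<in> Hom E Z A" and IdA: "Id E A \<in> Hom E A A"
    and IdZ: "Id E Z \<in> Hom E Z Z" by (auto simp: Hom_iff)
  obtain U where U: "ext_chain U C Z" "length U = m"
    "\<And>S. ext_chain S C Z \<Longrightarrow> length S = m \<Longrightarrow> ext_mor S U (Id E Z) (Id E C)"
    using trivial_chain[OF Z assms(1,3)] by auto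
  have U0: "U \<noteq> []" using U(2) assms(3) by auto
  obtain W where W: "ext_chain W C A" "length W = m" "ext_mor U W (Zero E Z A) (Id E C)"
    using ext_pushforward[OF U0 U(1) z] U(2) by auto
  have W0: "W \<noteq> []" using W(2) assms(3) by auto
  have Wx: "seq_of W \<in> extensions E m C A" using W W0 extensions_iff by blast
  have "in_image (Zero E A A \<cdot> Zero E Z A) W (Id E C)"
    using in_image_of_ext_mor[OF W(3) U(1) W(1) IdC] by simp
  then have Wn: "null A W (Id E C)"
    by (rule in_image_mono[OF _ W(1) _ z IdC]) (simp add: Hom_iff)
  have rel: "(seq_of S, seq_of W) \<in> yoneda_rel E m C A"
    if S: "ext_chain S C A" "length S = m" "null A S (Id E C)" for S
  proof -
    have S0: "S \<noteq> []" using S(2) assms(3) by auto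
    have "in_image (Zero E Z A \<cdot> Zero E A Z) S (Id E C)" using S(3) by simp
    then have "in_image (Zero E Z A) S (Id E C)"
      by (rule in_image_mono[OF _ S(1) z _ IdC]) (simp add: Hom_iff)
    then obtain S' where S': "ext_chain S' C Z" "length S' = length S" "ext_mor S' S (Zero E Z A) (Id E C)"
      using in_image_obtain_ext[OF _ S0 S(1) z IdC] by blast
    have S'0: "S' \<noteq> []" using S' S0 by auto
    have "ext_mor S' U (Id E Z) (Id E C)" using U(3) S' S(2) by simp
    then have S'W: "ext_mor S' W (Zero E Z A) (Id E C)"
      using ext_mor_comp[OF _ W(3) S'(1) U(1) W(1) IdC IdC, of "Id E Z"] by simp
    obtain T where T: "ext_chain T C A" "length T = length S'"
      "\<And>R x. ext_chain R C A \<Longrightarrow> x \<in> Hom E A A \<Longrightarrow>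
         ext_mor S' R (x \<cdot> Zero E Z A) (Id E C) \<Longrightarrow> ext_mor T R x (Id E C)"
      using ext_pushforward[OF S'0 S'(1) z] IdC by metis
    have "ext_mor T S (Id E A) (Id E C)" "ext_mor T W (Id E A) (Id E C)"
      using T(3)[OF S(1) IdA] T(3)[OF W(1) IdA] S'(3) S'W by auto
    then have "ext_step C A S T" "ext_step C A T W" unfolding ext_step_def using S(1) T(1) W(1) by auto
    then have "ext_equiv C A S W" by simp
    then show ?thesis using ext_equiv_yoneda[OF _ S(1) S0] S(2) by simp
  qed
  note eq = equiv_yoneda_rel[of E m C A]
  show ?thesis
  proof
    assume v: "Ext_vanishes E m C A"
    show "ext_null m C A" unfolding ext_null_def
    proof (intro allI impI, elim conjE)
      fix S assume S: "ext_chain S C A" "length S = m"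
      have "S \<noteq> []" using S(2) assms(3) by auto
      then have Sx: "seq_of S \<in> extensions E m C A" using S extensions_iff by blast
      have "yoneda_rel E m C A `` {seq_of W} = yoneda_rel E m C A `` {seq_of S}"
        using v Wx Sx unfolding Ext_vanishes_def Ext_def is_singleton_def
        by (metis quotientI singletonD)
      then have "(seq_of W, seq_of S) \<in> yoneda_rel E m C A"
        using eq_equiv_class_iff[OF eq Wx Sx] by simp
      then show "null A S (Id E C)"
        using null_yoneda[OF _ W(1) S(1) W(2) S(2) assms(3) IdC Wn] by simp
    qed
  next
    assume n: "ext_null m C A"
    have "Ext E m C A = {yoneda_rel E m C A `` {seq_of W}}"
    proof -
      have "yoneda_rel E m C A `` {Y} = yoneda_rel E m C A `` {seq_of W}"
        if "Y \<in> extensions E m C A" for Y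
        using that n rel eq_equiv_class_iff[OF eq that Wx] unfolding extensions_iff ext_null_def
        by blast
      then show ?thesis using Wx unfolding Ext_def quotient_def by blast
    qed
    then show "Ext_vanishes E m C A" unfolding Ext_vanishes_def by (simp add: is_singleton_def)
  qed
qed

section \<open>Exactness and homotopies of acyclic sequences\<close>

lemma seq_of_typing:
  assumes "ext_chain S C A" "t \<le> length S" "S \<noteq> []"
  shows "seq_of S ! t \<in> Hom E (obj_at E (seq_of S) t) (obj_at E (seq_of S) (Suc t))"
  using assms
proof (induction S arbitrary: C t)
  case (Cons x S)
  obtain i p where x: "x = (i, p)" by fastforce
  obtain K P where s: "ses K i P p C" "ext_chain S K A"
    using Cons.prems(1) unfolding x by (rule ext_chain_ConsE)
  note [simp] = sesD[OF s(1)]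
  show ?case
  proof (cases "S = []")
    case True
    then show ?thesis using Cons.prems(2) x by (cases t) (auto simp: obj_at_def Hom_iff)
  next
    case False
    note o = obj_at_Cons[OF Cons.prems(1)[unfolded x] False]
    note nth = nth_seq_of_Cons[OF False, where i=i and p=p]
    consider "t < length S" | "t = length S" | "t = Suc (length S)" using Cons.prems(2) by fastforce
    then show ?thesis
    proof cases
      case 1
      then show ?thesis unfolding x
        using Cons.IH[OF s(2) _ False, of t] o(1)[of t] o(1)[of "Suc t"] nth(1)[of t]
        by (simp del: seq_of.simps)
    next
      case 2
      then show ?thesis unfolding x
        using Cons.IH[OF s(2) _ False, of t] o(1)[of t] o(2,4) nth(2)
        by (simp add: Hom_iff del: seq_of.simps)
    next
      case 3
      then show ?thesis unfolding x using o(2,3) nth(3) by (simp add: Hom_iff del: seq_of.simps)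
    qed
  qed
qed simp

lemma seq_of_complex:
  assumes "ext_chain S C A" "t < length S"
  shows "seq_of S ! Suc t \<cdot> seq_of S ! t =
    Zero E (obj_at E (seq_of S) t) (obj_at E (seq_of S) (Suc (Suc t)))"
  using assms
proof (induction S arbitrary: C)
  case (Cons x S)
  obtain i p where x: "x = (i, p)" by fastforce
  obtain K P where s: "ses K i P p C" "ext_chain S K A"
    using Cons.prems(1) unfolding x by (rule ext_chain_ConsE)
  note [simp] = sesD[OF s(1)]
  show ?case
  proof (cases "S = []")
    case True
    then show ?thesis using Cons.prems(2) x by (auto simp: obj_at_def)
  next
    case False
    note o = obj_at_Cons[OF Cons.prems(1)[unfolded x] False]
    note nth = nth_seq_of_Cons[OF False, where i=i and p=p]
    have ty: "seq_of S ! t \<in> Hom E (obj_at E (seq_of S) t) (obj_at E (seq_of S) (Suc t))"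
      if "t \<le> length S" for t using seq_of_typing[OF s(2) that False] .
    consider "Suc t < length S" | "Suc t = length S" | "t = length S" using Cons.prems(2) by fastforce
    then show ?thesis
    proof cases
      case 1
      then show ?thesis unfolding x
        using Cons.IH[OF s(2)] o(1)[of t] o(1)[of "Suc (Suc t)"] nth(1)[of t] nth(1)[of "Suc t"]
        by (simp del: seq_of.simps)
    next
      case 2
      note [simp] = ty[of t, unfolded Hom_iff] ty[of "Suc t", unfolded Hom_iff]
        ty[of "length S", unfolded Hom_iff]
      have eq: "seq_of (x # S) ! Suc t \<cdot> seq_of (x # S) ! t = (i \<cdot> seq_of S ! Suc t) \<cdot> seq_of S ! t"
        unfolding x using 2 nth(1)[of t] nth(2) by (simp del: seq_of.simps comp_assoc)
      have "obj_at E (seq_of S) t \<in> Obj E" using Hom_Obj[OF ty[of t]] 2 by simp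
      then show ?thesis unfolding eq using 2 Cons.IH[OF s(2)] o(1)[of t] o(2,4) x
        by (simp del: seq_of.simps)
    next
      case 3
      note [simp] = ty[of t, unfolded Hom_iff] ty[of "length S", unfolded Hom_iff]
      have eq: "seq_of (x # S) ! Suc t \<cdot> seq_of (x # S) ! t = p \<cdot> (i \<cdot> seq_of S ! t)"
        unfolding x using 3 nth(2,3) by (simp del: seq_of.simps comp_assoc)
      have "obj_at E (seq_of S) t \<in> Obj E" using Hom_Obj[OF ty[of t]] 3 by simp
      then show ?thesis unfolding eq using 3 o(1)[of t] o(3,4) x
        by (simp add: comp_reduce[OF sesD(10)[OF s(1)]] del: seq_of.simps)
    qed
  qed
qed simp

lemma hd_seq_of_mono:
  assumes "ext_chain S C A" "S \<noteq> []" "f \<in> Hom E T A" "g \<in> Hom E T A"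
    "seq_of S ! 0 \<cdot> f = seq_of S ! 0 \<cdot> g"
  shows "f = g"
  using assms
proof (induction S arbitrary: C)
  case (Cons x S)
  obtain i p where x: "x = (i, p)" by fastforce
  obtain K P where s: "ses K i P p C" "ext_chain S K A"
    using Cons.prems(1) unfolding x by (rule ext_chain_ConsE)
  show ?case
  proof (cases "S = []")
    case True
    then show ?thesis using inflation_mono[of A i P p C f T g] Cons.prems s x by simp
  next
    case False
    then have "seq_of (x # S) ! 0 = seq_of S ! 0"
      using nth_seq_of_Cons(1)[OF False, of 0] x by simp
    then show ?thesis using Cons.IH[OF s(2) False Cons.prems(3,4)] Cons.prems(5) by simp
  qed
qed simp

definition lifts_from :: "'o \<Rightarrow> 'm \<Rightarrow> bool" where
  "lifts_from N p \<longleftrightarrow> (\<forall>c \<in> Hom E N (Cod E p). \<exists>x \<in> Hom E N (Dom E p). p \<cdot> x = c)"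

text \<open>
  A map that is killed by a differential factors through the kernel of the corresponding deflation, and
  then lifts along the preceding deflation.  The deflation onto \<open>C\<close> precedes nothing, hence the tail.
\<close>

lemma seq_of_Hom_exact:
  assumes "ext_chain S C A" "\<forall>(i, p) \<in> set (tl S). lifts_from N p" "1 \<le> t" "t \<le> length S"
    "f \<in> Hom E N (obj_at E (seq_of S) t)"
    "seq_of S ! t \<cdot> f = Zero E N (obj_at E (seq_of S) (Suc t))"
  shows "\<exists>g \<in> Hom E N (obj_at E (seq_of S) (t - 1)). seq_of S ! (t - 1) \<cdot> g = f"
  using assms
proof (induction S arbitrary: C)
  case (Cons x S)
  obtain i p where x: "x = (i, p)" by fastforce
  obtain K P where s: "ses K i P p C" "ext_chain S K A"
    using Cons.prems(1) unfolding x by (rule ext_chain_ConsE)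
  note [simp] = sesD[OF s(1)]
  show ?case
  proof (cases "S = []")
    case True
    then have t: "t = 1" using Cons.prems(3,4) by simp
    have "f \<in> Hom E N P" "p \<cdot> f = Zero E N C"
      using Cons.prems(5,6) t True x by (auto simp: obj_at_def)
    then obtain g where "g \<in> Hom E N K" "i \<cdot> g = f" using kernel_lift[OF s(1)] by blast
    then show ?thesis using t True x by (auto simp: obj_at_def)
  next
    case False
    note o = obj_at_Cons[OF Cons.prems(1)[unfolded x] False]
    note nth = nth_seq_of_Cons[OF False, where i=i and p=p]
    have ty: "seq_of S ! t \<in> Hom E (obj_at E (seq_of S) t) (obj_at E (seq_of S) (Suc t))"
      if "t \<le> length S" for t using seq_of_typing[OF s(2) that False] .
    have N: "N \<in> Obj E" using Hom_Obj[OF Cons.prems(5)] by simp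
    have tl: "\<forall>(i, p) \<in> set (tl S). lifts_from N p" using Cons.prems(2) by (cases S) auto
    consider "t < length S" | "t = length S" | "t = Suc (length S)" using Cons.prems(4) by fastforce
    then show ?thesis
    proof cases
      case 1
      then have "f \<in> Hom E N (obj_at E (seq_of S) t)"
        "seq_of S ! t \<cdot> f = Zero E N (obj_at E (seq_of S) (Suc t))"
        using Cons.prems(5,6) o(1)[of t] o(1)[of "Suc t"] nth(1)[of t] x by (simp_all del: seq_of.simps)
      from Cons.IH[OF s(2) tl Cons.prems(3) _ this] show ?thesis
        using 1 o(1)[of "t - 1"] nth(1)[of "t - 1"] x by (simp del: seq_of.simps)
    next
      case 2
      then have f: "f \<in> Hom E N (obj_at E (seq_of S) t)"
        using Cons.prems(5) o(1)[of t] x by (simp_all del: seq_of.simps)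
      note [simp] = f[unfolded Hom_iff] ty[of t, unfolded Hom_iff] N
        f[unfolded Hom_iff 2] ty[of "length S", unfolded Hom_iff]
      have "(i \<cdot> seq_of S ! t) \<cdot> f = Zero E N P"
        using 2 Cons.prems(6) nth(2) o(2) x by (simp del: seq_of.simps comp_assoc)
      then have "i \<cdot> (seq_of S ! t \<cdot> f) = i \<cdot> Zero E N K" using 2 o(4) by simp
      then have "seq_of S ! t \<cdot> f = Zero E N K"
        using inflation_mono[OF s(1), of "seq_of S ! t \<cdot> f" N "Zero E N K"] 2 o(4)
        by (simp add: Hom_iff)
      then have "seq_of S ! t \<cdot> f = Zero E N (obj_at E (seq_of S) (Suc t))" using 2 o(4) by simp
      from Cons.IH[OF s(2) tl Cons.prems(3) _ f this] show ?thesis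
        using 2 Cons.prems(3) o(1)[of "t - 1"] nth(1)[of "t - 1"] x by (simp del: seq_of.simps)
    next
      case 3
      have f: "f \<in> Hom E N P" "p \<cdot> f = Zero E N C"
        using Cons.prems(5,6) 3 o(2,3) nth(3) x by (auto simp del: seq_of.simps)
      then obtain g where g: "g \<in> Hom E N K" "i \<cdot> g = f" using kernel_lift[OF s(1)] by blast
      obtain j q S' where S: "S = (j, q) # S'" using False by (cases S) auto
      have ne: "seq_of S \<noteq> []" using length_seq_of[OF False] by auto
      have q: "seq_of S ! length S = q"
        using last_conv_nth[OF ne] length_seq_of[OF False] S last_seq_of by (simp del: seq_of.simps)
      have q': "q \<in> Hom E (obj_at E (seq_of S) (length S)) K"
        using ty[of "length S"] o(4) q by simp
      have "lifts_from N q" using Cons.prems(2) S by auto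
      moreover have "Dom E q = obj_at E (seq_of S) (length S)" "Cod E q = K"
        using q' by (auto simp: Hom_iff)
      ultimately obtain y where y: "y \<in> Hom E N (obj_at E (seq_of S) (length S))" "q \<cdot> y = g"
        using g(1) unfolding lifts_from_def by metis
      note [simp] = q'[unfolded Hom_iff] y(1)[unfolded Hom_iff]
      have "(i \<cdot> q) \<cdot> y = f" using y g by simp
      then show ?thesis using 3 y(1) o(1)[of "length S"] nth(2) q x
        by (auto simp del: seq_of.simps comp_assoc)
    qed
  qed
qed simp

text \<open>
  The homotopy is built from the right end, where \<open>h = 0\<close>.  Once \<open>h\<^sup>j\<^sup>+\<^sup>1\<close> is known, the difference
  \<open>\<psi> = \<phi>\<^sup>j - 1 - h\<^sup>j\<^sup>+\<^sup>1 d\<^sup>j\<close> is killed by \<open>d\<^sup>j\<close>, so it equals \<open>d\<^sup>j\<^sup>-\<^sup>1 h\<^sup>j\<close> for some \<open>h\<^sup>j\<close>.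
  The equation \<open>\<phi>\<^sup>j d\<^sup>j\<^sup>-\<^sup>1 = d\<^sup>j\<^sup>-\<^sup>1 + d\<^sup>j\<^sup>-\<^sup>1 h\<^sup>j d\<^sup>j\<^sup>-\<^sup>1\<close> is carried along because it is what
  the next step uses, and because it holds at the right end too.
\<close>

lemma homotopic_Id_of_exact:
  fixes Y :: "'m list" and m :: nat
  defines "ob \<equiv> obj_at E Y"
  assumes len: "length Y = Suc m"
    and arrows: "\<And>t. t \<le> m \<Longrightarrow> Y ! t \<in> Hom E (ob t) (ob (Suc t))"
    and square0: "\<And>t. t < m \<Longrightarrow> Y ! Suc t \<cdot> Y ! t = Zero E (ob t) (ob (Suc (Suc t)))"
    and exact: "\<And>t f. 1 \<le> t \<Longrightarrow> t \<le> m \<Longrightarrow> f \<in> Hom E (ob t) (ob t) \<Longrightarrow>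
        Y ! t \<cdot> f = Zero E (ob t) (ob (Suc t)) \<Longrightarrow> \<exists>g \<in> Hom E (ob t) (ob (t - 1)). Y ! (t - 1) \<cdot> g = f"
    and mono: "\<And>f g. f \<in> Hom E (ob 0) (ob 0) \<Longrightarrow> g \<in> Hom E (ob 0) (ob 0) \<Longrightarrow>
        Y ! 0 \<cdot> f = Y ! 0 \<cdot> g \<Longrightarrow> f = g"
    and map: "chain_map E Y Y \<phi>" and end1: "\<phi> (Suc m) = Id E (ob (Suc m))"
  shows "chain_homotopic E Y Y \<phi> (\<lambda>j. Id E (ob j))"
proof -
  have \<phi>: "\<And>t. t \<le> Suc m \<Longrightarrow> \<phi> t \<in> Hom E (ob t) (ob t)"
    "\<And>t. t \<le> m \<Longrightarrow> \<phi> (Suc t) \<cdot> Y ! t = Y ! t \<cdot> \<phi> t"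
    using map unfolding chain_map_def len ob_def by auto
  have OO: "ob t \<in> Obj E" if "t \<le> Suc m" for t using Hom_Obj[OF \<phi>(1)[OF that]] by simp
  have "\<exists>h. h (Suc m) = Zero E (ob (Suc m)) (ob m) \<and>
      (\<forall>j. Suc m - s \<le> j \<and> j \<le> Suc m \<longrightarrow> h j \<in> Hom E (ob j) (ob (j - 1)) \<and>
        \<phi> j \<cdot> Y ! (j - 1) = Y ! (j - 1) \<boxplus> Y ! (j - 1) \<cdot> (h j \<cdot> Y ! (j - 1))) \<and>
      (\<forall>j. Suc m - s \<le> j \<and> j \<le> m \<longrightarrow>
        \<phi> j = Id E (ob j) \<boxplus> (Y ! (j - 1) \<cdot> h j \<boxplus> h (Suc j) \<cdot> Y ! j))" if "s \<le> m" for s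
    using that
  proof (induction s)
    case 0
    note [simp] = arrows[of m, unfolded Hom_iff] OO
    show ?case
      by (rule exI[of _ "\<lambda>_. Zero E (ob (Suc m)) (ob m)"])
        (auto simp: Hom_iff end1 dest!: le_antisym)
  next
    case (Suc s)
    define j where "j = m - s"
    have j: "1 \<le> j" "j \<le> m" "Suc m - Suc s = j" "Suc m - s = Suc j" using Suc.prems by (auto simp: j_def)
    obtain h where h: "h (Suc m) = Zero E (ob (Suc m)) (ob m)"
      "\<And>l. Suc j \<le> l \<Longrightarrow> l \<le> Suc m \<Longrightarrow> h l \<in> Hom E (ob l) (ob (l - 1))"
      "\<And>l. Suc j \<le> l \<Longrightarrow> l \<le> Suc m \<Longrightarrow>
         \<phi> l \<cdot> Y ! (l - 1) = Y ! (l - 1) \<boxplus> Y ! (l - 1) \<cdot> (h l \<cdot> Y ! (l - 1))"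
      "\<And>l. Suc j \<le> l \<Longrightarrow> l \<le> m \<Longrightarrow> \<phi> l = Id E (ob l) \<boxplus> (Y ! (l - 1) \<cdot> h l \<boxplus> h (Suc l) \<cdot> Y ! l)"
      using Suc.IH Suc.prems unfolding j(4) by auto
    have h1: "h (Suc j) \<in> Hom E (ob (Suc j)) (ob j)" using h(2)[of "Suc j"] j by simp
    have dj1: "Y ! (j - 1) \<in> Hom E (ob (j - 1)) (ob j)" using arrows[of "j - 1"] j by simp
    have dj: "Y ! j \<in> Hom E (ob j) (ob (Suc j))" using arrows[of j] j by simp
    have \<phi>j: "\<phi> j \<in> Hom E (ob j) (ob j)" using \<phi>(1)[of j] j by simp
    have OOj: "ob j \<in> Obj E" "ob (j - 1) \<in> Obj E" "ob (Suc j) \<in> Obj E" using OO j by auto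
    note [simp] = h1[unfolded Hom_iff] dj[unfolded Hom_iff] \<phi>j[unfolded Hom_iff] OOj
      dj1[unfolded Hom_iff]
    obtain \<psi> where \<psi>: "\<psi> \<in> Hom E (ob j) (ob j)" "\<phi> j = (Id E (ob j) \<boxplus> h (Suc j) \<cdot> Y ! j) \<boxplus> \<psi>"
      using add_diff_arr[of "\<phi> j" "ob j" "ob j" "Id E (ob j) \<boxplus> h (Suc j) \<cdot> Y ! j"]
      by (auto simp: Hom_iff)
    note [simp] = \<psi>(1)[unfolded Hom_iff]
    have "Y ! j \<cdot> \<phi> j = Y ! j \<boxplus> Y ! j \<cdot> (h (Suc j) \<cdot> Y ! j)"
      using \<phi>(2)[of j] h(3)[of "Suc j"] j by simp
    then have "Y ! j \<boxplus> Y ! j \<cdot> (h (Suc j) \<cdot> Y ! j) =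
        (Y ! j \<boxplus> Y ! j \<cdot> (h (Suc j) \<cdot> Y ! j)) \<boxplus> Y ! j \<cdot> \<psi>"
      unfolding \<psi>(2) by simp
    then have "Y ! j \<cdot> \<psi> = Zero E (ob j) (ob (Suc j))"
      by (intro add_cancel_zero[of "Y ! j \<boxplus> Y ! j \<cdot> (h (Suc j) \<cdot> Y ! j)"]) (auto simp: Hom_iff)
    then obtain g where g: "g \<in> Hom E (ob j) (ob (j - 1))" "Y ! (j - 1) \<cdot> g = \<psi>"
      using exact[OF j(1,2) \<psi>(1)] by blast
    note [simp] = g(1)[unfolded Hom_iff]
    have eq: "\<phi> j = Id E (ob j) \<boxplus> (Y ! (j - 1) \<cdot> g \<boxplus> h (Suc j) \<cdot> Y ! j)"
      unfolding \<psi>(2) g(2)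
      using add_assoc[of "Id E (ob j)" "ob j" "ob j" "h (Suc j) \<cdot> Y ! j" \<psi>]
        add_comm[of "h (Suc j) \<cdot> Y ! j" "ob j" "ob j" \<psi>]
      by (simp add: Hom_iff)
    note [simp del] = One_nat_def
    have z: "Y ! j \<cdot> Y ! (j - 1) = Zero E (ob (j - 1)) (ob (Suc j))"
      using square0[of "j - 1"] j by simp
    have "(h (Suc j) \<cdot> Y ! j) \<cdot> Y ! (j - 1) = Zero E (ob (j - 1)) (ob j)" by (simp add: z)
    then have inv: "\<phi> j \<cdot> Y ! (j - 1) = Y ! (j - 1) \<boxplus> Y ! (j - 1) \<cdot> (g \<cdot> Y ! (j - 1))"
      unfolding eq by simp
    show ?case unfolding j(3)
    proof (intro exI[of _ "h(j := g)"] conjI allI impI)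
      show "(h(j := g)) (Suc m) = Zero E (ob (Suc m)) (ob m)" using h(1) j by simp
    next
      fix l assume l: "j \<le> l \<and> l \<le> Suc m"
      show "(h(j := g)) l \<in> Hom E (ob l) (ob (l - 1))"
        using l h(2)[of l] g(1) by (cases "l = j") auto
      show "\<phi> l \<cdot> Y ! (l - 1) = Y ! (l - 1) \<boxplus> Y ! (l - 1) \<cdot> ((h(j := g)) l \<cdot> Y ! (l - 1))"
        using l h(3)[of l] inv by (cases "l = j") auto
    next
      fix l assume l: "j \<le> l \<and> l \<le> m"
      show "\<phi> l = Id E (ob l) \<boxplus> (Y ! (l - 1) \<cdot> (h(j := g)) l \<boxplus> (h(j := g)) (Suc l) \<cdot> Y ! l)"
        using l h(4)[of l] eq by (cases "l = j") auto
    qed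
  qed
  from this[of m] obtain h where h: "h (Suc m) = Zero E (ob (Suc m)) (ob m)"
    "\<And>j. 1 \<le> j \<Longrightarrow> j \<le> Suc m \<Longrightarrow> h j \<in> Hom E (ob j) (ob (j - 1))"
    "\<And>j. 1 \<le> j \<Longrightarrow> j \<le> Suc m \<Longrightarrow>
       \<phi> j \<cdot> Y ! (j - 1) = Y ! (j - 1) \<boxplus> Y ! (j - 1) \<cdot> (h j \<cdot> Y ! (j - 1))"
    "\<And>j. 1 \<le> j \<Longrightarrow> j \<le> m \<Longrightarrow> \<phi> j = Id E (ob j) \<boxplus> (Y ! (j - 1) \<cdot> h j \<boxplus> h (Suc j) \<cdot> Y ! j)"
    by auto
  have h1: "h (Suc 0) \<in> Hom E (ob (Suc 0)) (ob 0)" using h(2)[of 1] by simp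
  have d0: "Y ! 0 \<in> Hom E (ob 0) (ob (Suc 0))" using arrows[of 0] by simp
  have \<phi>0: "\<phi> 0 \<in> Hom E (ob 0) (ob 0)" using \<phi>(1)[of 0] by simp
  note [simp] = h1[unfolded Hom_iff] d0[unfolded Hom_iff] \<phi>0[unfolded Hom_iff] OO[of 0]
  have "Y ! 0 \<cdot> \<phi> 0 = \<phi> (Suc 0) \<cdot> Y ! 0" using \<phi>(2)[of 0] by simp
  also have "\<dots> = Y ! 0 \<boxplus> Y ! 0 \<cdot> (h (Suc 0) \<cdot> Y ! 0)" using h(3)[of "Suc 0"] by simp
  also have "\<dots> = Y ! 0 \<cdot> (Id E (ob 0) \<boxplus> h (Suc 0) \<cdot> Y ! 0)" by simp
  finally have "Y ! 0 \<cdot> \<phi> 0 = Y ! 0 \<cdot> (Id E (ob 0) \<boxplus> h (Suc 0) \<cdot> Y ! 0)" .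
  then have "\<phi> 0 = Id E (ob 0) \<boxplus> h (Suc 0) \<cdot> Y ! 0"
    by (rule mono[rotated 2]) (simp_all add: Hom_iff)
  moreover have "\<phi> (length Y) = Id E (ob (length Y)) \<boxplus> last Y \<cdot> h (length Y)"
  proof -
    have "last Y = Y ! m" using len by (metis diff_Suc_1 last_conv_nth list.size(3) nat.distinct(1))
    then show ?thesis using h(1) len end1 arrows[of m] OO by (simp add: Hom_iff)
  qed
  ultimately show ?thesis unfolding chain_homotopic_def
    using h(2,4) len by (intro exI[of _ h]) (auto simp: ob_def less_Suc_eq_le)
qed

lemma chain_map_comp:
  assumes "chain_map E X Y f" "chain_map E Y Z g"
    and X: "\<And>t. t < length X \<Longrightarrow> X ! t \<in> Hom E (obj_at E X t) (obj_at E X (Suc t))"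
    and Y: "\<And>t. t < length Y \<Longrightarrow> Y ! t \<in> Hom E (obj_at E Y t) (obj_at E Y (Suc t))"
    and Z: "\<And>t. t < length Z \<Longrightarrow> Z ! t \<in> Hom E (obj_at E Z t) (obj_at E Z (Suc t))"
  shows "chain_map E X Z (\<lambda>j. g j \<cdot> f j)"
proof -
  have len: "length X = length Y" "length Y = length Z" using assms(1,2) by (auto simp: chain_map_def)
  have f: "\<And>j. j \<le> length X \<Longrightarrow> f j \<in> Hom E (obj_at E X j) (obj_at E Y j)"
    "\<And>j. j < length X \<Longrightarrow> f (Suc j) \<cdot> X ! j = Y ! j \<cdot> f j"
    using assms(1) by (auto simp: chain_map_def)
  have g: "\<And>j. j \<le> length X \<Longrightarrow> g j \<in> Hom E (obj_at E Y j) (obj_at E Z j)"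
    "\<And>j. j < length X \<Longrightarrow> g (Suc j) \<cdot> Y ! j = Z ! j \<cdot> g j"
    using assms(2) len by (auto simp: chain_map_def)
  show ?thesis unfolding chain_map_def
  proof (intro conjI allI impI)
    show "length X = length Z" using len by simp
    show "g j \<cdot> f j \<in> Hom E (obj_at E X j) (obj_at E Z j)" if "j \<le> length X" for j
      using f(1)[OF that] g(1)[OF that] by (simp add: Hom_iff)
    fix j assume j: "j < length X"
    then have "j \<le> length X" "Suc j \<le> length X" by auto
    note ty = f(1)[OF this(1)] f(1)[OF this(2)] g(1)[OF this(1)] g(1)[OF this(2)]
      X[OF j] Y[OF j[unfolded len(1)]] Z[OF j[unfolded len]]
    note [simp] = ty[unfolded Hom_iff]
    show "g (Suc j) \<cdot> f (Suc j) \<cdot> X ! j = Z ! j \<cdot> (g j \<cdot> f j)"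
      by (simp add: f(2)[OF j] comp_reduce[OF g(2)[OF j]])
  qed
qed

lemma seq_of_append:
  "S \<noteq> [] \<Longrightarrow> T \<noteq> [] \<Longrightarrow> seq_of (S @ T) = seq_splice E (seq_of T) (seq_of S)"
proof (induction S)
  case (Cons x S)
  obtain i p where x: "x = (i, p)" by fastforce
  show ?case
  proof (cases "S = []")
    case True
    then show ?thesis using Cons.prems x by simp
  next
    case False
    have "length (seq_of S) \<ge> 2" using length_seq_of[OF False] False by (cases S) auto
    then obtain a b Y where Y: "seq_of S = a # b # Y"
      by (cases "seq_of S" rule: remdups_adj.cases) auto
    have "seq_of (S @ T) = seq_splice E (seq_of T) (seq_of S)" using Cons.IH False Cons.prems(2) by simp
    then show ?thesis using False Y x by (simp add: seq_splice_def butlast_append)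
  qed
qed simp

lemma ext_equiv_append:
  assumes "ext_equiv C K R R'" "ext_equiv K A T T'" "ext_chain R C K" "ext_chain T K A"
  shows "ext_equiv C A (R @ T) (R' @ T')"
proof -
  have "ext_equiv C A (R @ T) (R' @ T)"
    using assms(1)
  proof (induction rule: rtranclp_induct)
    case (step S S')
    then have "ext_step C A (S @ T) (S' @ T)"
      using assms(4) ext_mor_refl[OF assms(4)] ext_mor_append
      unfolding ext_step_def ext_chain_append by blast
    then show ?case using step.IH by simp
  qed simp
  moreover have R': "ext_chain R' C K" using ext_equiv_chain[OF assms(1,3)] by simp
  have "ext_equiv C A (R' @ T) (R' @ T')"
    using assms(2)
  proof (induction rule: rtranclp_induct)
    case (step S S')
    then have "ext_step C A (R' @ S) (R' @ S')"
      using R' ext_mor_refl[OF R'] ext_mor_append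
      unfolding ext_step_def ext_chain_append by blast
    then show ?case using step.IH by simp
  qed simp
  ultimately show ?thesis by simp
qed

end

section \<open>Cluster tilting subcategories\<close>

locale n_cluster_tilting = exact_cat E
  for E :: "('o, 'm, 'z) exact_cat_scheme" (structure) +
  fixes M :: "'o set" and n :: nat
  assumes n_pos: "n \<ge> 1" and tilting: "cluster_tilting E n M"
begin

lemma M_Obj: "A \<in> M \<Longrightarrow> A \<in> Obj E"
  using tilting unfolding cluster_tilting_def additive_subcategory_def by blast

lemma ext_null_M: "N \<in> M \<Longrightarrow> A \<in> M \<Longrightarrow> 1 \<le> i \<Longrightarrow> i < n \<Longrightarrow> ext_null i N A"
proof -
  assume *: "N \<in> M" "A \<in> M" "1 \<le> i" "i < n"
  have "\<forall>A \<in> M. \<forall>N \<in> M. \<forall>i. 1 \<le> i \<and> i \<le> n - 1 \<longrightarrow> Ext_vanishes E i N A"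
    using tilting unfolding cluster_tilting_def by blast
  then have "Ext_vanishes E i N A" using * by simp
  then show ?thesis using Ext_vanishes_iff M_Obj * by blast
qed

lemma in_M:
  assumes "A \<in> Obj E" "\<And>N i. N \<in> M \<Longrightarrow> 1 \<le> i \<Longrightarrow> i < n \<Longrightarrow> ext_null i N A"
  shows "A \<in> M"
proof -
  have "M = {A \<in> Obj E. \<forall>N \<in> M. \<forall>i. 1 \<le> i \<and> i \<le> n - 1 \<longrightarrow> Ext_vanishes E i N A}"
    using tilting unfolding cluster_tilting_def by blast
  moreover have "Ext_vanishes E i N A" if "N \<in> M" "1 \<le> i" "i \<le> n - 1" for N i
    using assms that n_pos Ext_vanishes_iff M_Obj by auto
  ultimately show ?thesis using assms(1) by blast
qed

lemma inflation_into_M: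
  assumes "A \<in> Obj E"
  obtains X x q Q where "X \<in> M" "ses A x X q Q"
proof -
  obtain x where x: "Dom E x = A" "left_approximation E M x" "inflation E x"
    using tilting assms unfolding cluster_tilting_def by blast
  obtain q where q: "(x, q) \<in> Confl E" using x(3) by (auto simp: inflation_def)
  have "Dom E q \<in> M" using x(2) ConflD[OF q] by (auto simp: left_approximation_def)
  then show ?thesis using that Confl_ses[OF q] x(1) by blast
qed

lemma right_approx:
  assumes "A \<in> Obj E"
  shows "\<exists>R r X f. X \<in> M \<and> ses R r X f A \<and>
    (\<forall>N \<in> M. \<forall>c \<in> Hom E N A. \<exists>x \<in> Hom E N X. f \<cdot> x = c)"
proof -
  obtain f where f: "Cod E f = A" "right_approximation E M f" "deflation E f"
    using tilting assms unfolding cluster_tilting_def by blast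
  obtain r where r: "(r, f) \<in> Confl E" using f(3) by (auto simp: deflation_def)
  have "Dom E f \<in> M" "\<forall>N \<in> M. \<forall>c \<in> Hom E N A. \<exists>x \<in> Hom E N (Dom E f). f \<cdot> x = c"
    using f(1,2) by (auto simp: right_approximation_def)
  then show ?thesis using Confl_ses[OF r] f(1) by blast
qed

text \<open>
  The lift property of the approximation gives \<open>Ext\<^sup>1(M, R) = 0\<close>, and in higher degrees \<open>R\<close> inherits
  vanishing from \<open>A\<close> with a shift by one.
\<close>

lemma approx_kernel:
  assumes "A \<in> Obj E" "Suc t < n" "\<And>N i. N \<in> M \<Longrightarrow> 1 \<le> i \<Longrightarrow> i \<le> t \<Longrightarrow> ext_null i N A"
  shows "\<exists>R r X f. X \<in> M \<and> ses R r X f A \<and>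
    (\<forall>N \<in> M. \<forall>i. 1 \<le> i \<and> i \<le> Suc t \<longrightarrow> ext_null i N R)"
proof -
  obtain R r X f where f: "X \<in> M" "ses R r X f A"
    "\<forall>N \<in> M. \<forall>c \<in> Hom E N A. \<exists>x \<in> Hom E N X. f \<cdot> x = c"
    using right_approx[OF assms(1)] by blast
  have "ext_null i N R" if N: "N \<in> M" "1 \<le> i" "i \<le> Suc t" for N i
  proof -
    obtain m where m: "i = Suc m" using N(2) by (cases i) auto
    show ?thesis unfolding m
    proof (rule ext_null_inflation_domain[OF _ _ f(2)])
      show "if m = 0 then \<forall>c \<in> Hom E N A. \<exists>x \<in> Hom E N X. f \<cdot> x = c else ext_null m N A"
        using f(3) N(1) assms(3)[OF N(1), of m] N(3) m by auto
      show "ext_null (Suc m) N X" using ext_null_M[OF N(1) f(1), of "Suc m"] N m assms(2) by simp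
    qed
  qed
  then show ?thesis using f by blast
qed

abbreviation middle_in_M :: "('m \<times> 'm) list \<Rightarrow> bool" where
  "middle_in_M S \<equiv> \<forall>(i, p) \<in> set S. Dom E p \<in> M"

text \<open>
  In each step the middle term \<open>F\<close> next to \<open>K\<close> is embedded into an object of \<open>M\<close>; this enlarges
  \<open>K\<close> to \<open>K'\<close>, and the following conflation is pushed out along \<open>K \<rightarrow> K'\<close>.  The last middle term
  absorbs the final pushout and remains arbitrary.
\<close>

lemma resolve_from_left:
  assumes "S \<noteq> []" "ext_chain S C A"
  shows "\<exists>S'. S' \<noteq> [] \<and> ext_chain S' C A \<and> length S' = length S \<and> middle_in_M (tl S') \<and>
    ext_mor S S' (Id E A) (Id E C)"
  using assms
proof (induction S arbitrary: C)
  case (Cons x S)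
  obtain i p where x: "x = (i, p)" by fastforce
  obtain K P where s: "ses K i P p C" "ext_chain S K A"
    using Cons.prems(2) unfolding x by (rule ext_chain_ConsE)
  show ?case
  proof (cases "S = []")
    case True
    then show ?thesis using Cons.prems ext_mor_refl[OF Cons.prems(2)] by (intro exI[of _ "x # S"]) auto
  next
    case False
    obtain S' where S': "S' \<noteq> []" "ext_chain S' K A" "length S' = length S" "middle_in_M (tl S')"
      "ext_mor S S' (Id E A) (Id E K)"
      using Cons.IH[OF False s(2)] by blast
    obtain j q T where T: "S' = (j, q) # T" using S'(1) by (cases S') auto
    obtain J F where t: "ses J j F q K" "ext_chain T J A"
      using S'(2) unfolding T by (rule ext_chain_ConsE)
    note [simp] = sesD[OF s(1)] sesD[OF t(1)]
    obtain X y Y e where e: "X \<in> M" "ses F e X y Y" using inflation_into_M[OF sesD(8)[OF t(1)]] .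
    obtain K' q' where q': "ses J (e \<cdot> j) X q' K'" using inflation_comp_ses[OF t(1) e(2)] .
    note [simp] = sesD(1-9)[OF q'] sesD[OF e(2)]
    have "q' \<cdot> (e \<cdot> j) = Zero E J K'" by (rule sesD(10)[OF q'])
    then obtain \<kappa> where \<kappa>: "\<kappa> \<in> Hom E K K'" "\<kappa> \<cdot> q = q' \<cdot> e"
      using cokernel_desc[OF t(1), of "q' \<cdot> e" K'] by (auto simp: Hom_iff)
    obtain i' P' p' b where b: "ses K' i' P' p' C" "b \<in> Hom E P P'" "b \<cdot> i = i' \<cdot> \<kappa>" "p' \<cdot> b = p"
      "is_pushout E i \<kappa> b i'"
      using pushout_ses[OF s(1) \<kappa>(1)] .
    let ?T = "(e \<cdot> j, q') # T"
    have cT: "ext_chain ?T K' A" by (rule ext_chain_ConsI[OF q' t(2)])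
    have "ext_mor S' ?T (Id E A) \<kappa>" unfolding T
      by (rule ext_mor_ConsI[OF t(1) q' _ _ _ _ ext_mor_refl[OF t(2)], of e])
        (use \<kappa> in \<open>auto simp: Hom_iff\<close>)
    then have "ext_mor S ?T (Id E A \<cdot> Id E A) (\<kappa> \<cdot> Id E K)"
      using ext_mor_comp[OF S'(5) _ s(2) S'(2) cT _ \<kappa>(1)] by (auto simp: Hom_iff)
    then have m: "ext_mor S ?T (Id E A) \<kappa>"
      using \<kappa>(1) ext_chain_Obj[OF s(2)] by (simp add: Hom_iff)
    have "ext_mor (x # S) ((i', p') # ?T) (Id E A) (Id E C)" unfolding x
      by (rule ext_mor_ConsI[OF s(1) b(1,2) \<kappa>(1) _ b(3) m]) (use b(4) in simp)
    moreover have "ext_chain ((i', p') # ?T) C A" by (rule ext_chain_ConsI[OF b(1) cT])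
    moreover have "middle_in_M ?T" using S'(4) e(1) T by auto
    ultimately show ?thesis using S'(3) T by (intro exI[of _ "(i', p') # ?T"]) auto
  qed
qed simp

text \<open>
  A right approximation \<open>X \<rightarrow> F\<close> of the rightmost middle term, with kernel \<open>R\<close>, replaces \<open>K\<close> by an
  extension \<open>K'\<close> of \<open>K\<close> by \<open>R\<close>, and the next middle term \<open>X1\<close> by an extension \<open>F1\<close> of \<open>X1\<close> by \<open>R\<close>.
  As \<open>X1\<close> is in \<open>M\<close>, \<open>F1\<close> satisfies the vanishing of \<open>R\<close>, which reaches one degree further than
  that of \<open>F\<close>.  This is the hypothesis for the shorter extension.
\<close>

lemma resolve_from_right:
  assumes "ext_chain ((i, p) # T) C A" "length T < n" "middle_in_M T"
    "\<And>N j. N \<in> M \<Longrightarrow> 1 \<le> j \<Longrightarrow> j + length T < n \<Longrightarrow> ext_null j N (Dom E p)"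
  shows "\<exists>S. ext_chain S C A \<and> length S = Suc (length T) \<and> middle_in_M S \<and>
    ext_mor S ((i, p) # T) (Id E A) (Id E C)"
  using assms
proof (induction T arbitrary: i p C)
  case Nil
  have "Dom E p \<in> M" using Nil(1,4) by (intro in_M) (auto dest: sesD)
  then show ?case using Nil(1) ext_mor_refl[OF Nil(1)] by (intro exI[of _ "[(i, p)]"]) auto
next
  case (Cons x T)
  obtain j q where x: "x = (j, q)" by fastforce
  obtain K F where s: "ses K i F p C" "ext_chain (x # T) K A"
    using Cons.prems(1) by (rule ext_chain_ConsE)
  obtain L X1 where t: "ses L j X1 q K" "ext_chain T L A"
    using s(2) unfolding x by (rule ext_chain_ConsE)
  note [simp] = sesD[OF s(1)] sesD[OF t(1)]
  \<comment> \<open>The largest degree in which the hypothesis provides vanishing for \<open>F\<close>.\<close>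
  define d where "d = n - 1 - length (x # T)"
  have d: "Suc d < n" "\<And>i. i \<le> d \<Longrightarrow> i + length (x # T) < n" "Suc d = n - 1 - length T"
    using Cons.prems(2) by (auto simp: d_def)
  obtain R r X f where f: "X \<in> M" "ses R r X f F"
    "\<forall>N \<in> M. \<forall>i. 1 \<le> i \<and> i \<le> Suc d \<longrightarrow> ext_null i N R"
  proof -
    have F: "F \<in> Obj E" by simp
    have "ext_null l N F" if "N \<in> M" "1 \<le> l" "l \<le> d" for N l
      using Cons.prems(4)[OF that(1,2) d(2)[OF that(3)]] by simp
    then show ?thesis using approx_kernel[OF F d(1)] that by metis
  qed
  obtain K' u \<kappa> r' where K': "ses K' u X (p \<cdot> f) C" "ses R r' K' \<kappa> K" "f \<cdot> u = i \<cdot> \<kappa>"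
    using deflation_comp_ses[OF s(1) f(2)] .
  obtain j' r'' F1 q' g where F1: "ses L j' F1 q' K'" "ses R r'' F1 g X1"
    "q \<cdot> g = \<kappa> \<cdot> q'" "g \<cdot> j' = j" "q' \<cdot> r'' = r'"
    using pullback_ses2[OF t(1) K'(2)] .
  note [simp] = sesD[OF f(2)] sesD(1-9)[OF K'(1)] sesD[OF K'(2)] sesD[OF F1(1)] sesD[OF F1(2)]
  have X1: "X1 \<in> M" using Cons.prems(3) x by auto
  have "ext_null l N (Dom E q')" if "N \<in> M" "1 \<le> l" "l + length T < n" for N l
    using ext_null_middle_term[OF _ ext_null_M[OF that(1) X1 that(2)] F1(2) that(2)] f(3)
      that d(3) by simp
  moreover have cT: "ext_chain ((j', q') # T) K' A" by (rule ext_chain_ConsI[OF F1(1) t(2)])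
  ultimately obtain S where S: "ext_chain S K' A" "length S = Suc (length T)" "middle_in_M S"
    "ext_mor S ((j', q') # T) (Id E A) (Id E K')"
    using Cons.IH[of j' q' K'] Cons.prems(2,3) by auto
  have "ext_mor ((j', q') # T) (x # T) (Id E A) \<kappa>" unfolding x
    by (rule ext_mor_ConsI[OF F1(1) t(1) _ _ F1(3) _ ext_mor_refl[OF t(2)]])
      (use F1(4) in \<open>auto simp: Hom_iff\<close>)
  then have "ext_mor S (x # T) (Id E A \<cdot> Id E A) (\<kappa> \<cdot> Id E K')"
    using ext_mor_comp[OF S(4) _ S(1) cT s(2)] by (auto simp: Hom_iff)
  then have m: "ext_mor S (x # T) (Id E A) \<kappa>" using ext_chain_Obj[OF S(1)] by simp
  have "ext_mor ((u, p \<cdot> f) # S) ((i, p) # x # T) (Id E A) (Id E C)"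
    by (rule ext_mor_ConsI[OF K'(1) s(1) _ _ _ K'(3) m]) (auto simp: Hom_iff)
  moreover have "ext_chain ((u, p \<cdot> f) # S) C A" by (rule ext_chain_ConsI[OF K'(1) S(1)])
  ultimately show ?case using S(2,3) f(1) by (intro exI[of _ "(u, p \<cdot> f) # S"]) auto
qed

lemma n_resolution:
  assumes "ext_chain S C A" "length S = n"
  obtains X where "ext_chain X C A" "length X = n" "middle_in_M X" "ext_equiv C A S X"
proof -
  have "S \<noteq> []" using assms(2) n_pos by auto
  then obtain S' where S': "S' \<noteq> []" "ext_chain S' C A" "length S' = length S" "middle_in_M (tl S')"
    "ext_mor S S' (Id E A) (Id E C)"
    using resolve_from_left[OF _ assms(1)] by blast
  obtain i p T where T: "S' = (i, p) # T" using S'(1) by (cases S') auto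
  have "length T < n" "n = Suc (length T)" using S'(3) assms(2) T by auto
  then obtain X where X: "ext_chain X C A" "length X = n" "middle_in_M X"
      "ext_mor X S' (Id E A) (Id E C)"
    using resolve_from_right[of i p T C A] S'(2,4) T by auto
  have "ext_step C A S S'" "ext_step C A S' X"
    using assms(1) S'(2,5) X(1,4) unfolding ext_step_def by auto
  then have "ext_equiv C A S X" by simp
  then show ?thesis using that X by blast
qed

text \<open>
  The leftmost conflations are removed one after the other: the connecting maps are injective on \<open>Ext\<close>
  of \<open>N\<close> because the middle terms lie in \<open>M\<close>.
\<close>

lemma lift_of_null:
  assumes "ext_chain ((i, p) # U) D A" "middle_in_M U" "length U < n" "N \<in> M" "c \<in> Hom E N D"
    "null A ((i, p) # U) c"
  shows "\<exists>x \<in> Hom E N (Dom E p). p \<cdot> x = c"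
  using assms
proof (induction U arbitrary: A rule: rev_induct)
  case Nil
  then show ?case using null_single[of A i "Dom E p" p D c N] by (auto dest: sesD(5))
next
  case (snoc x U)
  obtain i1 p1 where x: "x = (i1, p1)" by fastforce
  have "ext_chain (((i, p) # U) @ [(i1, p1)]) D A" using snoc.prems(1) x by simp
  then obtain K where K: "ext_chain ((i, p) # U) D K" "ext_chain [(i1, p1)] K A"
    unfolding ext_chain_append by blast
  have s: "ses A i1 (Dom E p1) p1 K" using K(2) by auto
  have "ext_null (length ((i, p) # U)) N (Dom E p1)"
    using ext_null_M[OF snoc.prems(4), of "Dom E p1" "length ((i, p) # U)"] snoc.prems(2,3) x by auto
  then have "null K ((i, p) # U) c"
    using null_drop_left_conflation[OF _ _ s K(1) snoc.prems(5)] snoc.prems(6) x by simp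
  then show ?case using snoc.IH[OF K(1) _ _ snoc.prems(4,5)] snoc.prems(2,3) by simp
qed

text \<open>
  Every conflation but the first is the beginning of an extension by \<open>A\<close> of length less than \<open>n\<close>; its
  pullbacks to \<open>N\<close> vanish as \<open>A \<in> M\<close>, so \<open>lift_of_null\<close> applies.
\<close>

lemma lifts_tl:
  assumes "ext_chain S C A" "A \<in> M" "middle_in_M S" "length S \<le> n" "N \<in> M"
  shows "\<forall>(i, p) \<in> set (tl S). lifts_from N p"
proof (clarify)
  fix i p assume "(i, p) \<in> set (tl S)"
  then obtain V U where VU: "tl S = V @ (i, p) # U" by (auto simp: in_set_conv_decomp)
  then obtain x where S: "S = (x # V) @ (i, p) # U" by (cases S) auto
  obtain D where D: "ext_chain ((i, p) # U) D A" using assms(1) unfolding S ext_chain_append by blast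
  have p: "Cod E p = D" using D by (auto dest: sesD)
  have "ext_null (length ((i, p) # U)) N A"
    using ext_null_M[OF assms(5,2), of "length ((i, p) # U)"] assms(4) S by auto
  then have "null A ((i, p) # U) c" if "c \<in> Hom E N D" for c
    using ext_nullD[OF _ _ D that] by simp
  then show "lifts_from N p" unfolding lifts_from_def p
    using lift_of_null[OF D _ _ assms(5)] assms(3,4) S by auto
qed

lemma ext_mor_of_lifts:
  assumes "ext_chain R C B" "ext_chain S D A" "length R = length S" "middle_in_M R"
    "\<And>i p N. (i, p) \<in> set S \<Longrightarrow> N \<in> M \<Longrightarrow> lifts_from N p" "c \<in> Hom E C D"
  shows "\<exists>a. ext_mor R S a c"
  using assms
proof (induction R arbitrary: S C D c)
  case (Cons x R)
  obtain i p where x: "x = (i, p)" by fastforce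
  obtain j q S' where S: "S = (j, q) # S'" using Cons.prems(3) by (cases S) auto
  obtain K P where s: "ses K i P p C" "ext_chain R K B"
    using Cons.prems(1) unfolding x by (rule ext_chain_ConsE)
  obtain L Q where t: "ses L j Q q D" "ext_chain S' L A"
    using Cons.prems(2) unfolding S by (rule ext_chain_ConsE)
  note [simp] = sesD[OF s(1)] sesD[OF t(1)] Cons.prems(6)[unfolded Hom_iff]
  have "P \<in> M" using Cons.prems(4) x by auto
  then have "lifts_from P q" using Cons.prems(5)[of j q P] S by simp
  moreover have "c \<cdot> p \<in> Hom E P D" by (simp add: Hom_iff)
  ultimately obtain b where b: "b \<in> Hom E P Q" "q \<cdot> b = c \<cdot> p"
    unfolding lifts_from_def using sesD(5,6)[OF t(1)] by metis
  note [simp] = b(1)[unfolded Hom_iff]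
  have "q \<cdot> (b \<cdot> i) = Zero E K D" by (simp add: comp_reduce[OF b(2)])
  then obtain k where k: "k \<in> Hom E K L" "j \<cdot> k = b \<cdot> i"
    using kernel_lift[OF t(1), of "b \<cdot> i" K] by (auto simp: Hom_iff)
  have "length R = length S'" using Cons.prems(3) S by simp
  then obtain a where "ext_mor R S' a k"
    using Cons.IH[OF s(2) t(2) _ _ _ k(1)] Cons.prems(4,5) S by auto
  then show ?case unfolding x S
    using ext_mor_ConsI[OF s(1) t(1) b(1) k(1) b(2)] k(2) by metis
qed auto

text \<open>
  Over the first conflation the lift is not a matter of vanishing \<open>Ext\<close> groups but of the Yoneda
  equivalence: the deflation \<open>p\<close> of \<open>R\<close> pulls \<open>R\<close> back to a trivial extension, hence also \<open>S\<close>.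
\<close>

lemma ext_mor_of_yoneda:
  assumes "ext_chain R C A" "ext_chain S C A" "length R = n" "length S = n" "A \<in> M"
    "middle_in_M R" "middle_in_M S" "(seq_of R, seq_of S) \<in> yoneda_rel E n C A"
  shows "\<exists>a. ext_mor R S a (Id E C)"
proof -
  obtain i p R' where R: "R = (i, p) # R'" using assms(3) n_pos by (cases R) auto
  obtain j q S' where S: "S = (j, q) # S'" using assms(4) n_pos by (cases S) auto
  obtain K P where s: "ses K i P p C" "ext_chain R' K A"
    using assms(1) unfolding R by (rule ext_chain_ConsE)
  obtain L Q where t: "ses L j Q q C" "ext_chain S' L A"
    using assms(2) unfolding S by (rule ext_chain_ConsE)
  note [simp] = sesD[OF s(1)] sesD[OF t(1)]
  have A: "Zero E A A \<in> Hom E A A" using M_Obj[OF assms(5)] by (simp add: Hom_iff)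
  have P: "P \<in> M" using assms(6) R by auto
  have p: "p \<in> Hom E P C" by (simp add: Hom_iff)
  have "null A R (p \<cdot> Id E P)" unfolding R
    by (rule in_image_boundary[OF assms(1)[unfolded R] A]) (simp add: Hom_iff)
  then have "null A R p" by simp
  then have "null A S p" using null_yoneda[OF assms(8,1,2,3,4) n_pos p] by simp
  then obtain b where b: "b \<in> Hom E P Q" "q \<cdot> b = p"
    using lift_of_null[OF assms(2)[unfolded S] _ _ P p] assms(4,7) S by auto
  note [simp] = b(1)[unfolded Hom_iff]
  have "q \<cdot> (b \<cdot> i) = Zero E K C" by (simp add: comp_reduce[OF b(2)])
  then obtain k where k: "k \<in> Hom E K L" "j \<cdot> k = b \<cdot> i"
    using kernel_lift[OF t(1), of "b \<cdot> i" K] by (auto simp: Hom_iff)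
  have "length R' = length S'" using assms(3,4) R S by simp
  moreover have "lifts_from N p'" if "(i', p') \<in> set S'" "N \<in> M" for i' p' N
    using lifts_tl[OF assms(2,5,7) _ that(2)] assms(4) that(1) S by auto
  ultimately obtain a where "ext_mor R' S' a k"
    using ext_mor_of_lifts[OF s(2) t(2) _ _ _ k(1)] assms(6) R by auto
  then have "ext_mor R S a (Id E C)" unfolding R S
    by (intro ext_mor_ConsI[OF s(1) t(1) b(1) k(1)]) (use b(2) k(2) in auto)
  then show ?thesis by blast
qed

lemma homotopic_Id:
  assumes "ext_chain S C A" "length S = n" "A \<in> M" "middle_in_M S"
    "chain_map E (seq_of S) (seq_of S) \<phi>" "\<phi> (Suc n) = Id E C"
    "\<And>t. t \<le> n \<Longrightarrow> obj_at E (seq_of S) t \<in> M"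
  shows "chain_homotopic E (seq_of S) (seq_of S) \<phi> (\<lambda>j. Id E (obj_at E (seq_of S) j))"
proof -
  have S0: "S \<noteq> []" using assms(2) n_pos by auto
  have len: "length (seq_of S) = Suc n" using length_seq_of[OF S0] assms(2) by simp
  have ne: "seq_of S \<noteq> []" using len by auto
  have C: "obj_at E (seq_of S) (Suc n) = C"
    using len Cod_last_seq_of[OF S0 assms(1)] by (simp add: obj_at_def)
  have A: "obj_at E (seq_of S) 0 = A"
    using ne Dom_hd_seq_of[OF S0 assms(1)] by (simp add: obj_at_def hd_conv_nth)
  show ?thesis
  proof (rule homotopic_Id_of_exact[OF len _ _ _ _ assms(5)])
    show "seq_of S ! t \<in> Hom E (obj_at E (seq_of S) t) (obj_at E (seq_of S) (Suc t))" if "t \<le> n" for t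
      using seq_of_typing[OF assms(1) _ S0] that assms(2) by simp
    show "seq_of S ! Suc t \<cdot> seq_of S ! t =
        Zero E (obj_at E (seq_of S) t) (obj_at E (seq_of S) (Suc (Suc t)))" if "t < n" for t
      using seq_of_complex[OF assms(1)] that assms(2) by simp
    show "\<exists>g \<in> Hom E (obj_at E (seq_of S) t) (obj_at E (seq_of S) (t - 1)). seq_of S ! (t - 1) \<cdot> g = f"
      if t: "1 \<le> t" "t \<le> n" and f: "f \<in> Hom E (obj_at E (seq_of S) t) (obj_at E (seq_of S) t)"
        "seq_of S ! t \<cdot> f = Zero E (obj_at E (seq_of S) t) (obj_at E (seq_of S) (Suc t))" for t f
      using seq_of_Hom_exact[OF assms(1) lifts_tl[OF assms(1,3,4) _ assms(7)[OF t(2)]] t(1) _ f]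
        assms(2) t(2) by simp
    show "f = g" if "f \<in> Hom E (obj_at E (seq_of S) 0) (obj_at E (seq_of S) 0)"
      "g \<in> Hom E (obj_at E (seq_of S) 0) (obj_at E (seq_of S) 0)"
      "seq_of S ! 0 \<cdot> f = seq_of S ! 0 \<cdot> g" for f g
      using hd_seq_of_mono[OF assms(1) S0] that A by simp
    show "\<phi> (Suc n) = Id E (obj_at E (seq_of S) (Suc n))" using assms(6) C by simp
  qed
qed

lemma obj_at_in_M_iff:
  assumes "S \<noteq> []" "ext_chain S C A"
  shows "(\<forall>t \<le> length S. obj_at E (seq_of S) t \<in> M) \<longleftrightarrow> A \<in> M \<and> middle_in_M S"
  using assms
proof (induction S arbitrary: C)
  case (Cons x S)
  obtain i p where x: "x = (i, p)" by fastforce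
  obtain K P where s: "ses K i P p C" "ext_chain S K A"
    using Cons.prems(2) unfolding x by (rule ext_chain_ConsE)
  show ?case
  proof (cases "S = []")
    case True
    then show ?thesis using s sesD[OF s(1)] unfolding x
      by (auto simp: obj_at_def le_Suc_eq)
  next
    case False
    note o = obj_at_Cons[OF Cons.prems(2)[unfolded x] False]
    have "(\<forall>t \<le> length (x # S). obj_at E (seq_of (x # S)) t \<in> M) \<longleftrightarrow>
        (\<forall>t \<le> length S. obj_at E (seq_of S) t \<in> M) \<and> Dom E p \<in> M"
      using o(1,2) unfolding x by (auto simp: le_Suc_eq simp del: seq_of.simps)
    then show ?thesis using Cons.IH[OF False s(2)] x by auto
  qed
qed simp

lemma admissible_seq_of:
  assumes "ext_chain S C A" "length S = n"
  shows "admissible_n_exact E n M (seq_of S) \<longleftrightarrow> A \<in> M \<and> C \<in> M \<and> middle_in_M S"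
proof -
  have S0: "S \<noteq> []" using assms(2) n_pos by auto
  have "obj_at E (seq_of S) (Suc n) = C"
    using Cod_last_seq_of[OF S0 assms(1)] length_seq_of[OF S0] assms(2) by (simp add: obj_at_def)
  then show ?thesis
    using obj_at_in_M_iff[OF S0 assms(1)] acyclic_seq_of[OF S0 assms(1)] assms(2)
    unfolding admissible_n_exact_def by (auto simp: le_Suc_eq)
qed

lemma n_exact_homotopy_equivalent:
  assumes "ext_chain R C A" "ext_chain S C A" "length R = n" "length S = n" "A \<in> M"
    "middle_in_M R" "middle_in_M S" "(seq_of R, seq_of S) \<in> yoneda_rel E n C A"
  shows "homotopy_equivalent E (seq_of R) (seq_of S)"
proof -
  have R0: "R \<noteq> []" and S0: "S \<noteq> []" using assms(3,4) n_pos by auto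
  have IdC: "Id E C \<in> Hom E C C" using ext_chain_Obj[OF assms(1)] by (simp add: Hom_iff)
  have sym: "(seq_of S, seq_of R) \<in> yoneda_rel E n C A"
    using equiv_yoneda_rel[of E n C A] assms(8) unfolding equiv_def sym_def by blast
  obtain a a' where "ext_mor R S a (Id E C)" "ext_mor S R a' (Id E C)"
    using ext_mor_of_yoneda[OF assms] ext_mor_of_yoneda[OF assms(2,1,4,3,5,7,6) sym] by blast
  then obtain f g where f: "chain_map E (seq_of R) (seq_of S) f" "f (Suc n) = Id E C"
    and g: "chain_map E (seq_of S) (seq_of R) g" "g (Suc n) = Id E C"
    using ext_mor_imp_chain_map[OF _ R0 assms(1,2) IdC] ext_mor_imp_chain_map[OF _ S0 assms(2,1) IdC]
      assms(3,4) by metis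
  have ty: "seq_of T ! t \<in> Hom E (obj_at E (seq_of T) t) (obj_at E (seq_of T) (Suc t))"
    if "T \<in> {R, S}" "t < length (seq_of T)" for T t
    using seq_of_typing[of T C A t] that assms(1,2) R0 S0 length_seq_of[of T] by auto
  have fg: "chain_map E (seq_of R) (seq_of R) (\<lambda>j. g j \<cdot> f j)"
    "chain_map E (seq_of S) (seq_of S) (\<lambda>j. f j \<cdot> g j)"
    using chain_map_comp[OF f(1) g(1)] chain_map_comp[OF g(1) f(1)] ty by auto
  have e: "g (Suc n) \<cdot> f (Suc n) = Id E C" "f (Suc n) \<cdot> g (Suc n) = Id E C"
    using f(2) g(2) IdC by (auto simp: Hom_iff)
  have o: "obj_at E (seq_of R) t \<in> M" "obj_at E (seq_of S) t \<in> M" if "t \<le> n" for t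
    using obj_at_in_M_iff[OF R0 assms(1)] obj_at_in_M_iff[OF S0 assms(2)] assms(3-7) that by auto
  show ?thesis unfolding homotopy_equivalent_def
    using f(1) g(1) homotopic_Id[OF assms(1,3,5,6) fg(1) e(1) o(1)]
      homotopic_Id[OF assms(2,4,5,7) fg(2) e(2) o(2)] by blast
qed

text \<open>
  By descending induction on \<open>j\<close>.  For \<open>j = n - 1\<close> the object \<open>Q\<close> is in \<open>M\<close>; for smaller \<open>j\<close> the
  kernel of a right approximation of \<open>Q\<close> satisfies the hypothesis for \<open>j + 1\<close>.  The degrees
  \<open>kn + j\<close> that occur are never multiples of \<open>n\<close>.
\<close>

lemma ext_null_multiple_shift:
  assumes vanish: "\<And>k N A. k \<ge> 1 \<Longrightarrow> \<not> n dvd k \<Longrightarrow> N \<in> M \<Longrightarrow> A \<in> M \<Longrightarrow> ext_null k N A"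
    and "C \<in> M" "1 \<le> j" "j < n" "Q \<in> Obj E"
    "\<And>N i. N \<in> M \<Longrightarrow> 1 \<le> i \<Longrightarrow> i \<le> j \<Longrightarrow> ext_null i N Q"
  shows "ext_null (k * n + j) C Q"
proof -
  have nd: "\<not> n dvd k * n + j" if "1 \<le> j" "j < n" for j
    using that by (simp add: nat_dvd_not_less dvd_add_right_iff)
  show ?thesis using assms(3-6)
  proof (induction "n - j" arbitrary: j Q)
    case (Suc l)
    show ?case
    proof (cases "Suc j = n")
      case True
      then have "Q \<in> M" using Suc.prems(3,4) by (intro in_M) auto
      then show ?thesis using vanish[of "k * n + j" C Q] nd[of j] Suc.prems(1,2) assms(2) by simp
    next
      case False
      then have j: "Suc j < n" using Suc.prems(2) by simp
      obtain R r X f where f: "X \<in> M" "ses R r X f Q"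
        "\<forall>N \<in> M. \<forall>i. 1 \<le> i \<and> i \<le> Suc j \<longrightarrow> ext_null i N R"
        using approx_kernel[OF Suc.prems(3) j Suc.prems(4)] by blast
      have "ext_null (k * n + Suc j) C R"
        using Suc.hyps(1)[of "Suc j" R] Suc.hyps(2) j sesD[OF f(2)] f(3) by auto
      moreover have "ext_null (k * n + j) C X"
        using vanish[of "k * n + j" C X] nd[of j] Suc.prems(1,2) assms(2) f(1) by simp
      ultimately show ?thesis using ext_null_deflation_codomain[OF _ _ f(2)] Suc.prems(1) by simp
    qed
  qed simp
qed

text \<open>
  The obstruction to lifting the class of \<open>S\<close> along a right approximation \<open>X \<rightarrow> K\<close> with kernel \<open>R\<close>
  lies in \<open>Ext\<^sup>k\<^sup>n\<^sup>+\<^sup>1(C, R)\<close>.  For \<open>n = 1\<close> every object is in \<open>M\<close> and \<open>S\<close> itself will do.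
\<close>

lemma lift_left_end_to_M:
  assumes vanish: "\<And>k N A. k \<ge> 1 \<Longrightarrow> \<not> n dvd k \<Longrightarrow> N \<in> M \<Longrightarrow> A \<in> M \<Longrightarrow> ext_null k N A"
    and "C \<in> M" "ext_chain S C K" "length S = k * n" "k \<ge> 1"
  shows "\<exists>X p S'. X \<in> M \<and> p \<in> Hom E X K \<and> ext_chain S' C X \<and> length S' = length S \<and>
    ext_mor S' S p (Id E C)"
proof (cases "n = 1")
  case True
  have K: "K \<in> Obj E" using ext_chain_Obj[OF assms(3)] by simp
  then have "K \<in> M" using True by (intro in_M) auto
  then show ?thesis using ext_mor_refl[OF assms(3)] assms(3) K
    by (intro exI[of _ K] exI[of _ "Id E K"] exI[of _ S]) (auto simp: Hom_iff)
next
  case False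
  then have n: "Suc 0 < n" using n_pos by simp
  have K: "K \<in> Obj E" "C \<in> Obj E" using ext_chain_Obj[OF assms(3)] by auto
  then have IdC: "Id E C \<in> Hom E C C" by (simp add: Hom_iff)
  obtain R r X f where f: "X \<in> M" "ses R r X f K"
    "\<forall>N \<in> M. \<forall>i. 1 \<le> i \<and> i \<le> Suc 0 \<longrightarrow> ext_null i N R"
    using approx_kernel[OF K(1) n] by auto
  note [simp] = sesD[OF f(2)]
  have S0: "S \<noteq> []" using assms(4,5) n_pos by auto
  have "ext_null (k * n + 1) C R"
    using ext_null_multiple_shift[OF vanish assms(2), of 1 R k] n f(3) by auto
  moreover have "ext_chain (S @ [(r, f)]) C R" unfolding ext_chain_append
    using assms(3) f(2) by auto
  ultimately have "null R (S @ [(r, f)]) (Id E C)"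
    using assms(4) unfolding ext_null_def by simp
  then have im: "in_image f S (Id E C)" using null_snoc[OF assms(3) f(2) IdC] by simp
  have fH: "f \<in> Hom E X K" by (simp add: Hom_iff)
  show ?thesis using in_image_obtain_ext[OF im S0 assms(3) fH IdC] f(1) fH by blast
qed

text \<open>
  The block next to \<open>A\<close> is split off, so the list of blocks, like the list of conflations, starts
  at \<open>C\<close>.
\<close>

lemma kn_resolution:
  assumes vanish: "\<And>k N A. k \<ge> 1 \<Longrightarrow> \<not> n dvd k \<Longrightarrow> N \<in> M \<Longrightarrow> A \<in> M \<Longrightarrow> ext_null k N A"
    and "C \<in> M" "A \<in> M" "ext_chain S C A" "length S = k * n" "k \<ge> 1"
  shows "\<exists>Bs. length Bs = k \<and>
    (\<forall>B \<in> set Bs. length B = n \<and> (\<exists>C' \<in> M. \<exists>A' \<in> M. ext_chain B C' A') \<and> middle_in_M B) \<and>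
    ext_equiv C A S (concat Bs)"
  using assms(6,3-5)
proof (induction k arbitrary: S A rule: dec_induct)
  case base
  obtain X where "ext_chain X C A" "length X = n" "middle_in_M X" "ext_equiv C A S X"
    using n_resolution[OF base(2)] base(3) by auto
  then show ?case using assms(2) base(1) by (intro exI[of _ "[X]"]) auto
next
  case (step k)
  define S1 S2 where "S1 = take (k * n) S" and "S2 = drop (k * n) S"
  have S: "S = S1 @ S2" "length S1 = k * n" "length S2 = n"
    using step.prems(3) by (auto simp: S1_def S2_def)
  obtain K where K: "ext_chain S1 C K" "ext_chain S2 K A"
    using step.prems(2) unfolding S(1) ext_chain_append by blast
  obtain X p S' where X: "X \<in> M" "p \<in> Hom E X K" "ext_chain S' C X" "length S' = length S1"
    "ext_mor S' S1 p (Id E C)"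
    using lift_left_end_to_M[OF vanish assms(2) K(1) S(2) step.hyps(1)] by blast
  have "S2 \<noteq> []" using S(3) n_pos by auto
  then obtain T where T: "ext_chain T X A" "length T = length S2" "ext_mor T S2 (Id E A) p"
    using ext_pullback[OF _ K(2) X(2)] by blast
  have "ext_mor (S' @ T) S (Id E A) (Id E C)" unfolding S(1) by (rule ext_mor_append[OF X(5) T(3)])
  moreover have "ext_chain (S' @ T) C A" unfolding ext_chain_append using X(3) T(1) by blast
  ultimately have 1: "ext_step C A S (S' @ T)" using step.prems(2) by (simp add: ext_step_def)
  obtain Y where Y: "ext_chain Y X A" "length Y = n" "middle_in_M Y" "ext_equiv X A T Y"
    using n_resolution[OF T(1)] T(2) S(3) by auto
  obtain Bs where Bs: "length Bs = k"
    "\<forall>B \<in> set Bs. length B = n \<and> (\<exists>C' \<in> M. \<exists>A' \<in> M. ext_chain B C' A') \<and> middle_in_M B"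
    "ext_equiv C X S' (concat Bs)"
    using step.IH[OF X(1,3)] X(4) S(2) by auto
  have "ext_equiv C A (S' @ T) (concat Bs @ Y)" by (rule ext_equiv_append[OF Bs(3) Y(4) X(3) T(1)])
  then have "ext_equiv C A S (concat (Bs @ [Y]))" using 1 by (simp add: converse_rtranclp_into_rtranclp)
  then show ?case using Bs(1,2) Y(1-3) X(1) step.prems(1) by (intro exI[of _ "Bs @ [Y]"]) auto
qed

lemma is_splicing_concat:
  assumes "Bs \<noteq> []" "ext_chain (concat Bs) C A"
    "\<forall>B \<in> set Bs. length B = n \<and> (\<exists>C' \<in> M. \<exists>A' \<in> M. ext_chain B C' A') \<and> middle_in_M B"
  shows "is_splicing E {Y. admissible_n_exact E n M Y} (length Bs) (seq_of (concat Bs))"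
  using assms
proof (induction Bs arbitrary: C)
  case (Cons B Bs)
  obtain C' A' where B: "length B = n" "ext_chain B C' A'" "C' \<in> M" "A' \<in> M" "middle_in_M B"
    using Cons.prems(3) by auto
  have adm: "seq_of B \<in> {Y. admissible_n_exact E n M Y}"
    using admissible_seq_of[OF B(2,1)] B(3-5) by simp
  show ?case
  proof (cases "Bs = []")
    case True
    then show ?thesis using is_splicing.single[OF adm] by simp
  next
    case False
    obtain K where K: "ext_chain B C K" "ext_chain (concat Bs) K A"
      using Cons.prems(2) unfolding concat.simps ext_chain_append by blast
    have "length (hd Bs) = n" "hd Bs \<in> set Bs" using False Cons.prems(3) by auto
    then have ne: "B \<noteq> []" "concat Bs \<noteq> []" using B(1) n_pos by (auto intro!: bexI[of _ "hd Bs"])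
    have "is_splicing E {Y. admissible_n_exact E n M Y} (length Bs) (seq_of (concat Bs))"
      using Cons.IH[OF False K(2)] Cons.prems(3) by auto
    from is_splicing.splice[OF this adm] show ?thesis
      using Cod_last_seq_of[OF ne(2) K(2)] Dom_hd_seq_of[OF ne(1) K(1)] seq_of_append[OF ne] by simp
  qed
qed simp

end

theorem theorem1p2:
  fixes E :: "('o, 'm) exact_cat" and M :: "'o set" and n :: nat
  assumes "exact_category E" and "n \<ge> 1" and "cluster_tilting E n M"
  shows "(\<forall>A \<in> M. \<forall>C \<in> M. \<forall>\<xi> \<in> extensions E n C A.
            (\<exists>X. admissible_n_exact E n M X \<and> (\<xi>, X) \<in> yoneda_rel E n C A) \<and>
            (\<forall>X X'. admissible_n_exact E n M X \<and> (\<xi>, X) \<in> yoneda_rel E n C A \<and>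
                    admissible_n_exact E n M X' \<and> (\<xi>, X') \<in> yoneda_rel E n C A \<longrightarrow>
                    homotopy_equivalent E X X')) \<and>
         (nZ_cluster_tilting E n M \<longrightarrow>
           (\<forall>k \<ge> 1. \<forall>A \<in> M. \<forall>C \<in> M. \<forall>\<xi> \<in> extensions E (k * n) C A.
              \<exists>X. is_splicing E {Y. admissible_n_exact E n M Y} k X \<and>
                  (\<xi>, X) \<in> yoneda_rel E (k * n) C A))"
proof -
  interpret exact_category E by fact
  interpret n_cluster_tilting E M n by unfold_locales (use assms in auto)
  have existence: "\<exists>X. admissible_n_exact E n M X \<and> (\<xi>, X) \<in> yoneda_rel E n C A"
    if "A \<in> M" "C \<in> M" "\<xi> \<in> extensions E n C A" for A C \<xi>
  proof -
    obtain S where S: "S \<noteq> []" "length S = n" "ext_chain S C A" "\<xi> = seq_of S"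
      using \<open>\<xi> \<in> _\<close> unfolding extensions_iff by blast
    obtain X where X: "ext_chain X C A" "length X = n" "middle_in_M X" "ext_equiv C A S X"
      using n_resolution[OF S(3,2)] .
    then show ?thesis
      using admissible_seq_of[OF X(1,2)] that(1,2) ext_equiv_yoneda[OF X(4) S(3,1)] S(2,4)
      by (intro exI[of _ "seq_of X"]) simp
  qed
  have uniqueness: "homotopy_equivalent E X X'"
    if "admissible_n_exact E n M X" "(\<xi>, X) \<in> yoneda_rel E n C A"
      "admissible_n_exact E n M X'" "(\<xi>, X') \<in> yoneda_rel E n C A" for A C \<xi> X X'
  proof -
    have XX': "(X, X') \<in> yoneda_rel E n C A"
      using equiv_yoneda_rel[of E n C A] that(2,4) unfolding equiv_def sym_def trans_def by blast
    then have "X \<in> extensions E n C A" "X' \<in> extensions E n C A" by (auto simp: yoneda_rel_def)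
    then obtain R S where R: "length R = n" "ext_chain R C A" "X = seq_of R"
      and S: "length S = n" "ext_chain S C A" "X' = seq_of S"
      unfolding extensions_iff by blast
    show ?thesis
      using n_exact_homotopy_equivalent[OF R(2) S(2) R(1) S(1)] admissible_seq_of[OF R(2,1)]
        admissible_seq_of[OF S(2,1)] that(1,3) XX' R(3) S(3) by simp
  qed
  have splicing: "\<exists>X. is_splicing E {Y. admissible_n_exact E n M Y} k X \<and>
      (\<xi>, X) \<in> yoneda_rel E (k * n) C A"
    if nZ: "nZ_cluster_tilting E n M" and k: "k \<ge> 1" and A: "A \<in> M" and C: "C \<in> M"
      and \<xi>: "\<xi> \<in> extensions E (k * n) C A" for k A C \<xi>
  proof -
    have vanish: "ext_null l N B" if "l \<ge> 1" "\<not> n dvd l" "N \<in> M" "B \<in> M" for l N B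
      using nZ that Ext_vanishes_iff[of N B l] M_Obj unfolding nZ_cluster_tilting_def by blast
    obtain S where S: "S \<noteq> []" "length S = k * n" "ext_chain S C A" "\<xi> = seq_of S"
      using \<xi> unfolding extensions_iff by blast
    obtain Bs where Bs: "length Bs = k"
      "\<forall>B \<in> set Bs. length B = n \<and> (\<exists>C' \<in> M. \<exists>A' \<in> M. ext_chain B C' A') \<and> middle_in_M B"
      "ext_equiv C A S (concat Bs)"
      using kn_resolution[OF vanish C A S(3,2) k] by blast
    have chain: "ext_chain (concat Bs) C A" using ext_equiv_chain[OF Bs(3) S(3)] by simp
    have "Bs \<noteq> []" using Bs(1) k by auto
    then have "is_splicing E {Y. admissible_n_exact E n M Y} k (seq_of (concat Bs))"
      using is_splicing_concat[OF _ chain Bs(2)] unfolding Bs(1) by blast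
    then show ?thesis using ext_equiv_yoneda[OF Bs(3) S(3,1)] S(2,4) by auto
  qed
  show ?thesis using existence uniqueness splicing by blast
qed

end
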